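(* For every integer $t\ge 4$ the following hold for the class of graphs that contain no cycle of length at least $t$ as an induced subgraph. (1) There exist a polynomial $p$ in two variables (depending on $t$) and an algorithm that, given such a graph $G$ with $n$ vertices, a weight function $\mathbf{w}\colon V(G)\to\mathbb{N}$ and a real $\varepsilon>0$, outputs an independent set $I$ of $G$ with $\mathbf{w}(I)\ge (1-\varepsilon)\mathbf{w}(I')$ for every independent set $I'$ of $G$, in time at most $2^{p(\log n,\varepsilon^{-1})}$. (2) There is an algorithm that, given such a graph $G$ with $n$ vertices and a weight function $\mathbf{w}\colon V(G)\to\mathbb{N}$, outputs an independent set of $G$ of maximum total weight in time $2^{\mathcal{O}(n^{1/2}\log n)}$ (the constant depending on $t$).
   Context: For $S\subseteq V(G)$, $\mathbf{w}(S)=\sum_{v\in S}\mathbf{w}(v)$. *)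

theory Defs
  imports
    "Graph_Theory.Graph_Theory"
    "HOL-Library.Landau_Symbols"
    "HOL-Computational_Algebra.Polynomial"
begin

section \<open>Graphs\<close>

text \<open>
  A finite simple graph is a \<^locale>\<open>pair_graph\<close>: a finite, loop-free, symmetric
  digraph without parallel arcs, an edge being represented by its two arcs.
\<close>

definition cycle_graph :: "nat \<Rightarrow> 'a pair_pre_digraph \<Rightarrow> bool" where
  "cycle_graph k H \<longleftrightarrow> 3 \<le> k \<and> (\<exists>vs. length vs = k \<and> distinct vs \<and> pverts H = set vs \<and>
     parcs H = {(u, v). \<exists>i<k. {u, v} = {vs ! i, vs ! (Suc i mod k)}})"

definition no_long_induced_cycle :: "nat \<Rightarrow> 'a pair_pre_digraph \<Rightarrow> bool" where
  "no_long_induced_cycle t G \<longleftrightarrow>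
     \<not> (\<exists>k H. t \<le> k \<and> cycle_graph k H \<and> induced_subgraph (with_proj H) (with_proj G))"

definition independent_set :: "'a pair_pre_digraph \<Rightarrow> 'a set \<Rightarrow> bool" where
  "independent_set G I \<longleftrightarrow> I \<subseteq> pverts G \<and> (\<forall>u\<in>I. \<forall>v\<in>I. (u, v) \<notin> parcs G)"

section \<open>Algorithms\<close>

text \<open>
  Algorithms are structured programs for a unit-cost random access machine.  The memory consists
  of arrays of natural numbers of unbounded length and size (a program mentions only finitely many
  arrays; an index may be any computed number) and of real registers.  The only arithmetic is
  addition, (truncated) subtraction and comparison.  There is deliberately no multiplication and no
  rounding, so unit cost does not give the machine any unreasonable power, and no real constants
  other than those coming from natural numbers, so a program cannot carry infinite advice.
\<close>

type_synonym memory = "(nat \<Rightarrow> nat \<Rightarrow> nat) \<times> (nat \<Rightarrow> real)"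

datatype nexp = Const nat | Load nat nexp | Add nexp nexp | Sub nexp nexp

datatype rexp = Reg nat | OfNat nexp | RAdd rexp rexp | RSub rexp rexp

datatype bexp = Less nexp nexp | RLess rexp rexp | Neg bexp | Conj bexp bexp

datatype prog =
    Skip
  | Store nat nexp nexp
  | RStore nat rexp
  | Seq prog prog
  | Cond bexp prog prog
  | Loop bexp prog

primrec nval :: "nexp \<Rightarrow> memory \<Rightarrow> nat" where
  "nval (Const c) m = c"
| "nval (Load a e) m = fst m a (nval e m)"
| "nval (Add e f) m = nval e m + nval f m"
| "nval (Sub e f) m = nval e m - nval f m"

primrec rval :: "rexp \<Rightarrow> memory \<Rightarrow> real" where
  "rval (Reg r) m = snd m r"
| "rval (OfNat e) m = real (nval e m)"
| "rval (RAdd e f) m = rval e m + rval f m"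
| "rval (RSub e f) m = rval e m - rval f m"

primrec bval :: "bexp \<Rightarrow> memory \<Rightarrow> bool" where
  "bval (Less e f) m \<longleftrightarrow> nval e m < nval f m"
| "bval (RLess e f) m \<longleftrightarrow> rval e m < rval f m"
| "bval (Neg b) m \<longleftrightarrow> \<not> bval b m"
| "bval (Conj b c) m \<longleftrightarrow> bval b m \<and> bval c m"

primrec ncost :: "nexp \<Rightarrow> nat" where
  "ncost (Const c) = 1"
| "ncost (Load a e) = 1 + ncost e"
| "ncost (Add e f) = 1 + ncost e + ncost f"
| "ncost (Sub e f) = 1 + ncost e + ncost f"

primrec rcost :: "rexp \<Rightarrow> nat" where
  "rcost (Reg r) = 1"
| "rcost (OfNat e) = 1 + ncost e"
| "rcost (RAdd e f) = 1 + rcost e + rcost f"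
| "rcost (RSub e f) = 1 + rcost e + rcost f"

primrec bcost :: "bexp \<Rightarrow> nat" where
  "bcost (Less e f) = 1 + ncost e + ncost f"
| "bcost (RLess e f) = 1 + rcost e + rcost f"
| "bcost (Neg b) = 1 + bcost b"
| "bcost (Conj b c) = 1 + bcost b + bcost c"

text \<open>\<open>exec P m T m'\<close>: started in memory \<open>m\<close>, program \<open>P\<close> halts after \<open>T\<close> steps in memory \<open>m'\<close>.\<close>

inductive exec :: "prog \<Rightarrow> memory \<Rightarrow> nat \<Rightarrow> memory \<Rightarrow> bool" where
  Skip: "exec Skip m 1 m"
| Store: "exec (Store a e f) m (1 + ncost e + ncost f)
     ((fst m)(a := (fst m a)(nval e m := nval f m)), snd m)"
| RStore: "exec (RStore r e) m (1 + rcost e) (fst m, (snd m)(r := rval e m))"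
| Seq: "exec P m S m' \<Longrightarrow> exec Q m' T m'' \<Longrightarrow> exec (Seq P Q) m (S + T) m''"
| CondT: "bval b m \<Longrightarrow> exec P m T m' \<Longrightarrow> exec (Cond b P Q) m (bcost b + T) m'"
| CondF: "\<not> bval b m \<Longrightarrow> exec Q m T m' \<Longrightarrow> exec (Cond b P Q) m (bcost b + T) m'"
| LoopF: "\<not> bval b m \<Longrightarrow> exec (Loop b P) m (bcost b) m"
| LoopT: "bval b m \<Longrightarrow> exec P m S m' \<Longrightarrow> exec (Loop b P) m' T m'' \<Longrightarrow>
     exec (Loop b P) m (bcost b + S + T) m''"

lemma exec_deterministic:
  "exec P m T m' \<Longrightarrow> exec P m S m'' \<Longrightarrow> S = T \<and> m'' = m'"
proof (induction arbitrary: S m'' rule: exec.induct)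
  case (Seq P m S1 m1 Q T1 m2)
  from Seq.prems show ?case by cases (use Seq.IH in blast)
next
  case (LoopT b m P S1 m1 T1 m2)
  from LoopT.prems show ?case by cases (use LoopT.IH LoopT.hyps in blast)+
next
  case (CondT b m P T m' Q)
  from CondT.prems show ?case by cases (use CondT.IH CondT.hyps in blast)+
next
  case (CondF b m Q T m' P)
  from CondF.prems show ?case by cases (use CondF.IH CondF.hyps in blast)+
next
  case (LoopF b m P)
  from LoopF.prems show ?case by cases (use LoopF.hyps in blast)+
qed (erule exec.cases; simp)+

text \<open>
  Input convention for a graph with vertex set \<open>{..<n}\<close>: array 0 holds \<open>n\<close>, array 1 the vertex
  weights (one memory cell each) and array 2 the adjacency matrix, row by row; all other cells are 0.
  A real parameter is passed in real register 0.
  Output convention: array 3 holds the indicator function of the output set.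
\<close>

definition graph_input :: "nat \<Rightarrow> nat pair_pre_digraph \<Rightarrow> (nat \<Rightarrow> nat) \<Rightarrow> nat \<Rightarrow> nat \<Rightarrow> nat" where
  "graph_input n G w a i =
     (if a = 0 \<and> i = 0 then n
      else if a = 1 \<and> i < n then w i
      else if a = 2 \<and> i < n * n \<and> (i div n, i mod n) \<in> parcs G then 1
      else 0)"

definition input :: "nat \<Rightarrow> nat pair_pre_digraph \<Rightarrow> (nat \<Rightarrow> nat) \<Rightarrow> memory" where
  "input n G w = (graph_input n G w, \<lambda>_. 0)"

definition input_with_real ::
  "nat \<Rightarrow> nat pair_pre_digraph \<Rightarrow> (nat \<Rightarrow> nat) \<Rightarrow> real \<Rightarrow> memory" where
  "input_with_real n G w x = (graph_input n G w, (\<lambda>_. 0)(0 := x))"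

definition output_set :: "memory \<Rightarrow> nat set" where
  "output_set m = {v. fst m 3 v \<noteq> 0}"

text \<open>A polynomial in two variables is a polynomial in the first variable over the
  polynomials in the second one.\<close>

definition poly2 :: "real poly poly \<Rightarrow> real \<Rightarrow> real \<Rightarrow> real" where
  "poly2 p x y = poly (poly p [:x:]) y"

end

theory Submission
  imports Defs
begin

text \<open>
  Both algorithms run the same recursion \<open>val S k\<close> on a vertex set \<open>S\<close> with a budget \<open>k\<close>.  A
  disconnected set is split; on a connected set one may pay one unit to pick any vertex \<open>v\<close> of the
  graph, delete its closed neighbourhood and gain \<open>v\<close> if \<open>v\<close> is in \<open>S\<close>, or delete a vertex of maximum
  degree free of charge.  The recursion tree has at most \<open>n\<close> to the power \<open>O(k + 1)\<close> nodes.

  The graph property enters through Gyarfas paths: if there is no induced cycle of length at least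
  \<open>t\<close>, then the closed neighbourhood of at most \<open>t\<close> vertices is a balanced separator.

  For the approximation, let \<open>I\<close> be an optimum.  Picking \<open>O(log\<^sup>2 n)\<close> members of \<open>I\<close> (times
  the inverse accuracy) makes every remaining closed neighbourhood light with respect to \<open>I\<close>, so that
  deleting a separator loses little; this is iterated on logarithmically many levels.  For the exact
  algorithm, a vertex of degree at least the square root of \<open>card S\<close> is deleted for free or picked,
  and picking it can happen only \<open>O(sqrt n)\<close> times; once all degrees are small, a separator contains
  \<open>O(sqrt (card S))\<close> vertices, so that a budget of \<open>8 t sqrt (card S)\<close> pays for its members in \<open>I\<close>.
\<close>

section \<open>Induced paths, holes and balanced separators\<close>

text \<open>The obstacle is that the algorithm knows neither the optimum \<open>I\<close> nor a
  separator. So it computes none: \<open>val\<close> maximises over all ways to spend the budget,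
  and the analysis exhibits one good way. For this the budget must count choices along a single
  branch. Both parts of a split inherit the whole of \<open>k\<close>, so a level of separators is
  paid for once and not once per component; as sizes halve, few levels or a geometric sum of costs
  suffice. Vertices outside \<open>S\<close> may be picked because a separator vertex may already be
  gone when its neighbourhood is to be removed. Splits and free deletions lower only
  \<open>card S\<close>; a quadratic potential keeps them from multiplying the tree. Constants: a
  separator together with the members of \<open>I\<close> that it dominates costs at most
  \<open>2 t sqrt s\<close>, and \<open>8 t sqrt (s/2) \<le> 6 t sqrt s\<close>, whence the 8. In
  the approximation each of \<open>l\<close> levels loses at most the fraction \<open>t / Q\<close>,
  so \<open>Q = t * l * q\<close> with \<open>q\<close> about \<open>1 / \<epsilon>\<close> limits
  the total loss to \<open>1 / q\<close>; one level costs \<open>Q * l + t\<close>, which makes the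
  budget \<open>l * (Q * l + t) = t * (q * l^3 + l)\<close>.\<close>

locale sgraph =
  fixes E :: "'a \<Rightarrow> 'a \<Rightarrow> bool"
  assumes sym: "E u v \<Longrightarrow> E v u"
    and irrefl: "\<not> E v v"
begin

definition nbh :: "'a \<Rightarrow> 'a set" where
  "nbh v = {u. u = v \<or> E v u}"

definition nbhs :: "'a set \<Rightarrow> 'a set" where
  "nbhs X = (\<Union>v\<in>X. nbh v)"

definition reach :: "'a set \<Rightarrow> 'a \<Rightarrow> 'a set" where
  "reach S u = {x. (\<lambda>a b. a \<in> S \<and> b \<in> S \<and> E a b)\<^sup>*\<^sup>* u x}"

definition conn :: "'a set \<Rightarrow> bool" where
  "conn S \<longleftrightarrow> (\<forall>u\<in>S. S \<subseteq> reach S u)"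

definition indep :: "'a set \<Rightarrow> bool" where
  "indep I \<longleftrightarrow> (\<forall>u\<in>I. \<forall>v\<in>I. \<not> E u v)"

definition anti :: "'a set \<Rightarrow> 'a set \<Rightarrow> bool" where
  "anti A B \<longleftrightarrow> (\<forall>a\<in>A. \<forall>b\<in>B. \<not> E a b)"

definition ipath :: "'a list \<Rightarrow> bool" where
  "ipath xs \<longleftrightarrow> distinct xs \<and>
     (\<forall>i j. i < j \<and> j < length xs \<longrightarrow> (E (xs ! i) (xs ! j) \<longleftrightarrow> j = Suc i))"

text \<open>Degenerate lists of length below 3 also qualify. Holes are used only through the bound
  \<open>length xs < t\<close>, which such lists satisfy for \<open>t \<ge> 4\<close>.\<close>

definition hole :: "'a list \<Rightarrow> bool" where
  "hole xs \<longleftrightarrow> distinct xs \<and>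
     (\<forall>i j. i < j \<and> j < length xs \<longrightarrow>
        (E (xs ! i) (xs ! j) \<longleftrightarrow> j = Suc i \<or> i = 0 \<and> j = length xs - 1))"

section \<open>Reachability and connected sets\<close>

lemma anti_commute: "anti A B \<Longrightarrow> anti B A"
  using sym by (auto simp: anti_def)

lemma anti_mono: "anti A B \<Longrightarrow> A' \<subseteq> A \<Longrightarrow> B' \<subseteq> B \<Longrightarrow> anti A' B'"
  by (auto simp: anti_def)

lemma nbh_sym: "u \<in> nbh v \<longleftrightarrow> v \<in> nbh u"
  using sym by (auto simp: nbh_def)

lemma nbh_self: "v \<in> nbh v"
  by (simp add: nbh_def)

lemma reach_self: "u \<in> reach S u"
  by (simp add: reach_def)

lemma reach_subset: "u \<in> S \<Longrightarrow> reach S u \<subseteq> S"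
  unfolding reach_def by (auto elim: rtranclp.cases)

lemma reach_closed:
  assumes "u \<in> S" "x \<in> reach S u" "y \<in> S" "E x y"
  shows "y \<in> reach S u"
  using assms reach_subset[OF assms(1)] unfolding reach_def
  by (auto intro: rtranclp.rtrancl_into_rtrancl)

lemma reach_least:
  assumes "u \<in> A" "\<And>x y. x \<in> A \<Longrightarrow> y \<in> S \<Longrightarrow> E x y \<Longrightarrow> y \<in> A"
  shows "reach S u \<subseteq> A"
proof
  fix x assume "x \<in> reach S u"
  then have "(\<lambda>a b. a \<in> S \<and> b \<in> S \<and> E a b)\<^sup>*\<^sup>* u x" by (simp add: reach_def)
  then show "x \<in> A" by induction (use assms in auto)
qed

lemma reach_commute:
  assumes "x \<in> reach S u" shows "u \<in> reach S x"
proof -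
  have "symp (\<lambda>a b. a \<in> S \<and> b \<in> S \<and> E a b)\<^sup>*\<^sup>*"
    by (rule symp_rtranclp) (auto intro!: sympI sym)
  then show ?thesis using assms by (auto simp: reach_def dest: sympD)
qed

lemma reach_trans: "x \<in> reach S u \<Longrightarrow> y \<in> reach S x \<Longrightarrow> y \<in> reach S u"
  unfolding reach_def by auto

lemma conn_reach:
  assumes "u \<in> S" shows "conn (reach S u)"
proof -
  let ?R = "reach S u"
  have from_u: "?R \<subseteq> reach ?R u"
  proof (rule reach_least[OF reach_self])
    fix x y assume x: "x \<in> reach ?R u" and "y \<in> S" "E x y"
    moreover have xR: "x \<in> ?R" using x reach_subset[OF reach_self] by blast
    ultimately have "y \<in> ?R" using reach_closed[OF assms] by blast
    then show "y \<in> reach ?R u" using reach_closed[OF reach_self x] \<open>E x y\<close> by blast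
  qed
  show ?thesis unfolding conn_def
    using from_u reach_commute reach_trans by blast
qed

text \<open>Otherwise \<open>A\<close> would be closed under edges and contain everything reachable
  from its members.\<close>

lemma conn_cut:
  assumes "conn S" "A \<subseteq> S" "A \<noteq> {}" "A \<noteq> S"
  obtains a b where "a \<in> A" "b \<in> S - A" "E a b"
proof -
  obtain u where u: "u \<in> A" using assms by blast
  have "\<not> reach S u \<subseteq> A" using assms u unfolding conn_def by blast
  then have "\<not> (\<forall>x\<in>A. \<forall>y\<in>S. E x y \<longrightarrow> y \<in> A)" using reach_least[OF u, of S] by blast
  then show ?thesis using that by blast
qed

lemma conn_subset_reach:
  assumes "conn D" "D \<subseteq> S" "x \<in> D"
  shows "D \<subseteq> reach S x"
proof -
  have "reach D x \<subseteq> reach S x"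
    by (rule reach_least[OF reach_self]) (use assms reach_closed[of x S] in blast)
  then show ?thesis using assms unfolding conn_def by blast
qed

lemma reach_walk:
  assumes "x \<in> reach S u" "u \<in> S"
  shows "\<exists>xs. xs \<noteq> [] \<and> hd xs = u \<and> last xs = x \<and> set xs \<subseteq> S \<and> successively E xs"
proof -
  have "(\<lambda>a b. a \<in> S \<and> b \<in> S \<and> E a b)\<^sup>*\<^sup>* u x" using assms by (simp add: reach_def)
  then show ?thesis
  proof induction
    case base
    show ?case by (rule exI[of _ "[u]"]) (use assms in auto)
  next
    case (step y z)
    then obtain xs where "xs \<noteq> []" "hd xs = u" "last xs = y" "set xs \<subseteq> S" "successively E xs" by blast
    then show ?case
      by (intro exI[of _ "xs @ [z]"]) (use step in \<open>auto simp: successively_append_iff\<close>)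
  qed
qed

text \<open>A repeated vertex or a chord would allow a shortcut, contradicting minimality.\<close>

lemma shortest_walk_ipath:
  fixes Q :: "'a list \<Rightarrow> bool"
  assumes Q: "\<And>ys. Q ys \<longleftrightarrow> ys \<noteq> [] \<and> hd ys = a \<and> last ys = b \<and> set ys \<subseteq> T \<and> successively E ys"
    and xs: "Q xs" and least: "\<And>ys. Q ys \<Longrightarrow> length xs \<le> length ys"
  shows "ipath xs"
proof -
  \<comment> \<open>Dropping the positions from \<open>i\<close> to \<open>j - 1\<close> leaves a
    walk if position \<open>j\<close> may follow position \<open>i - 1\<close>, or is the start
    \<open>a\<close> in case \<open>i = 0\<close>. A chord is excluded with \<open>Suc i\<close> in
    place of \<open>i\<close>, a repetition with \<open>i\<close> itself.\<close>
  have short: False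
    if "i < j" "j < length xs" "ys = take i xs @ drop j xs"
      "i = 0 \<Longrightarrow> xs ! j = a" "i > 0 \<Longrightarrow> E (xs ! (i - 1)) (xs ! j)" for i j ys
  proof -
    have "drop j xs \<noteq> []" using that by simp
    moreover have "hd ys = a" using that xs Q[of xs] by (cases "i = 0") (auto simp: hd_drop_conv_nth hd_append)
    moreover have "set ys \<subseteq> T" using that xs Q[of xs] set_take_subset[of i xs] set_drop_subset[of j xs] by auto
    moreover have "successively E ys"
    proof -
      have "successively E (take i xs)" "successively E (drop j xs)"
        using xs Q[of xs] successively_append_iff[of E "take i xs" "drop i xs"]
          successively_append_iff[of E "take j xs" "drop j xs"] by auto
      moreover have "last (take i xs) = xs ! (i - 1)" if "i > 0"
        using that \<open>i < j\<close> \<open>j < length xs\<close> by (subst last_conv_nth) auto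
      ultimately show ?thesis using that by (cases "i = 0") (auto simp: successively_append_iff hd_drop_conv_nth)
    qed
    moreover have "last ys = b" using that xs Q[of xs] by auto
    ultimately have "Q ys" using Q that by auto
    then have "length xs \<le> length ys" by (rule least)
    then show False using that by simp
  qed
  have suc: "E (xs ! i) (xs ! Suc i)" if "Suc i < length xs" for i
    using xs Q[of xs] that successively_conv_nth[of E xs] by auto
  have "\<not> E (xs ! i) (xs ! j)" if "i < j" "j < length xs" "j \<noteq> Suc i" for i j
    using short[of "Suc i" j "take (Suc i) xs @ drop j xs"] that by auto
  moreover have "xs ! i \<noteq> xs ! j" if "i < j" "j < length xs" for i j
  proof
    assume eq: "xs ! i = xs ! j"
    have "xs ! 0 = a" using xs Q[of xs] by (auto simp: hd_conv_nth)
    then show False using short[of i j] that eq suc[of "i - 1"] by (cases i) auto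
  qed
  ultimately show ?thesis unfolding ipath_def distinct_conv_nth
    using suc by (metis nat_neq_iff order.strict_trans)
qed

text \<open>A shortest walk from \<open>a\<close> to \<open>b\<close> through \<open>C\<close> is
  induced. It has inner vertices because \<open>a\<close> and \<open>b\<close> are distinct and not
  adjacent, and these lie in \<open>C\<close> because no vertex is repeated.\<close>

lemma induced_path_through:
  assumes "conn C" "a \<notin> C" "b \<notin> C" "a \<noteq> b" "\<not> E a b" "c \<in> C" "E a c" "d \<in> C" "E d b"
  obtains qs where "qs \<noteq> []" "set qs \<subseteq> C" "ipath (a # qs @ [b])"
proof -
  define Q where "Q ys \<longleftrightarrow> ys \<noteq> [] \<and> hd ys = a \<and> last ys = b \<and> set ys \<subseteq> C \<union> {a, b} \<and> successively E ys" for ys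
  have "d \<in> reach C c" using assms unfolding conn_def by blast
  from reach_walk[OF this \<open>c \<in> C\<close>] obtain ws where
    ws: "ws \<noteq> []" "hd ws = c" "last ws = d" "set ws \<subseteq> C" "successively E ws" by blast
  have "Q (a # ws @ [b])" unfolding Q_def
    using ws assms by (auto simp: successively_append_iff successively_Cons)
  then obtain xs where xs: "Q xs" "\<And>ys. Q ys \<Longrightarrow> length xs \<le> length ys"
    using ex_has_least_nat[of Q "a # ws @ [b]" length] by blast
  have ip: "ipath xs" by (rule shortest_walk_ipath[OF Q_def xs])
  have "xs \<noteq> []" "hd xs = a" "last xs = b" "set xs \<subseteq> C \<union> {a, b}" "successively E xs"
    using xs unfolding Q_def by auto
  then obtain ys where ys: "xs = a # ys" by (cases xs) auto
  with \<open>last xs = b\<close> \<open>a \<noteq> b\<close> have "ys \<noteq> []" by auto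
  then obtain qs where qs: "ys = qs @ [b]" using ys \<open>last xs = b\<close> by (metis append_butlast_last_id last.simps)
  have "qs \<noteq> []" using ys qs \<open>successively E xs\<close> \<open>\<not> E a b\<close> by auto
  moreover have "set qs \<subseteq> C" using ip ys qs \<open>set xs \<subseteq> C \<union> {a, b}\<close> by (auto simp: ipath_def)
  ultimately show ?thesis using that ip ys qs by blast
qed

section \<open>Gluing induced paths into a hole\<close>

lemma ipathD:
  "ipath xs \<Longrightarrow> i < j \<Longrightarrow> j < length xs \<Longrightarrow> E (xs ! i) (xs ! j) \<longleftrightarrow> j = Suc i"
  by (simp add: ipath_def)

text \<open>The two paths share only \<open>z\<close>, and the single edge between \<open>A\<close>
  and \<open>B\<close> joins their free ends, which are the first and the last entry of the
  resulting list.\<close>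

lemma hole_glue:
  assumes A: "ipath (A @ [z])" and B: "ipath (z # B)" and ne: "A \<noteq> []" "B \<noteq> []"
    and disj: "set A \<inter> set B = {}"
    and adj: "\<And>a b. a \<in> set A \<Longrightarrow> b \<in> set B \<Longrightarrow> E a b \<longleftrightarrow> a = hd A \<and> b = last B"
  shows "hole (A @ z # B)"
  unfolding hole_def
proof (intro conjI allI impI)
  show "distinct (A @ z # B)" using A B disj by (auto simp: ipath_def)
  fix i j assume ij: "i < j \<and> j < length (A @ z # B)"
  let ?xs = "A @ z # B"
  consider "j \<le> length A" | "length A \<le> i" | "i < length A" "length A < j" by linarith
  then show "E (?xs ! i) (?xs ! j) \<longleftrightarrow> j = Suc i \<or> i = 0 \<and> j = length ?xs - 1"
  proof cases
    case 1
    have "?xs ! i = (A @ [z]) ! i" "?xs ! j = (A @ [z]) ! j" using 1 ij by (auto simp: nth_append)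
    then show ?thesis using A ij 1 ne unfolding ipath_def by (auto simp: less_Suc_eq_le)
  next
    case 2
    have "?xs ! i = (z # B) ! (i - length A)" "?xs ! j = (z # B) ! (j - length A)" using 2 ij by (auto simp: nth_append)
    moreover have "E ((z # B) ! (i - length A)) ((z # B) ! (j - length A)) \<longleftrightarrow> j - length A = Suc (i - length A)"
      using ij 2 by (intro ipathD[OF B]) auto
    ultimately show ?thesis using 2 ij ne by (auto simp: Suc_diff_le)
  next
    case 3
    have i: "?xs ! i = A ! i" "A ! i \<in> set A" using 3 by (auto simp: nth_append)
    have j: "?xs ! j = B ! (j - length A - 1)" "B ! (j - length A - 1) \<in> set B"
      using 3 ij by (auto simp: nth_append nth_Cons')
    have "A ! i = hd A \<longleftrightarrow> i = 0"
      using A 3 ne by (simp add: ipath_def hd_conv_nth nth_eq_iff_index_eq)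
    moreover have "B ! (j - length A - 1) = last B \<longleftrightarrow> j = length ?xs - 1"
      using B 3 ne ij by (auto simp add: ipath_def last_conv_nth nth_eq_iff_index_eq)
    ultimately show ?thesis using adj[OF i(2) j(2)] i j 3 by auto
  qed
qed

lemma ipath_append_single:
  assumes "ipath p" "p \<noteq> []" "b \<notin> set p" "E (last p) b" "\<And>v. v \<in> set (butlast p) \<Longrightarrow> \<not> E v b"
  shows "ipath (p @ [b])"
  unfolding ipath_def
proof (intro conjI allI impI)
  show "distinct (p @ [b])" using assms by (auto simp: ipath_def)
  fix i j assume ij: "i < j \<and> j < length (p @ [b])"
  show "E ((p @ [b]) ! i) ((p @ [b]) ! j) \<longleftrightarrow> j = Suc i"
  proof (cases "j < length p")
    case True
    then show ?thesis using assms(1) ij by (auto simp: ipath_def nth_append)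
  next
    case False
    then have j: "j = length p" using ij by auto
    show ?thesis
    proof (cases "Suc i = length p")
      case True
      then have "last p = p ! i" using assms(2) by (metis diff_Suc_1 last_conv_nth)
      then show ?thesis using assms(4) j True ij by (auto simp: nth_append)
    next
      case False
      then have "i < length (butlast p)" using ij j by auto
      then have "p ! i \<in> set (butlast p)" by (metis nth_butlast nth_mem)
      then show ?thesis using assms(5) j False ij by (auto simp: nth_append)
    qed
  qed
qed

lemma ipath_drop:
  assumes "ipath p" shows "ipath (drop j p)"
  using assms unfolding ipath_def by (auto simp: less_diff_conv)


text \<open>
  A Gyarfas path \<open>p\<close> is grown towards a big component \<open>C\<close> of what its earlier vertices do not
  dominate.  Its last \<open>t\<close> vertices already separate: a big set avoiding their neighbourhood would leave
  \<open>C\<close> through a neighbour \<open>y\<close> of a much earlier path vertex, and the path from there to its end closes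
  up with \<open>y\<close> and a shortest connection inside \<open>C\<close> to an induced cycle that is too long.
\<close>

lemma balanced_separator:
  assumes conn: "conn S" and fin: "finite S" and ne: "S \<noteq> {}" and card: "card S \<le> 2 * m + 1"
    and t: "1 \<le> t" and no_hole: "\<And>xs. hole xs \<Longrightarrow> length xs < t"
  obtains X where "X \<subseteq> S" "card X \<le> t" "\<And>D. D \<subseteq> S - nbhs X \<Longrightarrow> conn D \<Longrightarrow> card D \<le> m"
proof (rule ccontr)
  assume "\<not> thesis"
  with that have big: "\<exists>D\<subseteq>S - nbhs X. conn D \<and> m < card D" if "X \<subseteq> S" "card X \<le> t" for X
    using that by (meson not_le)
  \<comment> \<open>\<open>C\<close> is large and attached to the end of the path. The last clause
    says that every way out of \<open>C\<close> passes through the closed neighbourhood of an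
    earlier path vertex; the end itself is left out by \<open>butlast\<close>, since it still has
    neighbours in \<open>C\<close>.\<close>
  define good where "good p C \<longleftrightarrow> p \<noteq> [] \<and> ipath p \<and> set p \<subseteq> S \<and> C \<subseteq> S \<and> conn C \<and> m < card C \<and>
    last p \<notin> C \<and> (\<exists>c\<in>C. E (last p) c) \<and> C \<inter> nbhs (set (butlast p)) = {} \<and>
    (\<forall>y\<in>S - C. \<forall>c\<in>C. E y c \<longrightarrow> y \<in> nbhs (set (butlast p)))" for p C
  \<comment> \<open>\<open>S\<close> has no room for two disjoint sets of more than \<open>m\<close>
    vertices, so every large connected set meets the current \<open>C\<close>.\<close>
  have card2: "C \<inter> D \<noteq> {}" if "C \<subseteq> S" "D \<subseteq> S" "m < card C" "m < card D" for C D
  proof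
    assume "C \<inter> D = {}"
    then have "card (C \<union> D) = card C + card D" using that fin by (meson card_Un_disjoint finite_subset)
    moreover have "card (C \<union> D) \<le> card S" using that fin by (simp add: card_mono)
    ultimately show False using that card by linarith
  qed
  have step: "\<exists>v C'. good (p @ [v]) C'" if g: "good p C" for p C
  proof -
    define B where "B = set (butlast p)"
    have p0: "p \<noteq> []" and ip: "ipath p" and pS: "set p \<subseteq> S" and CS: "C \<subseteq> S" and cC: "conn C"
      and mC: "m < card C" and lC: "last p \<notin> C"
      and BC: "\<And>c. c \<in> C \<Longrightarrow> c \<notin> nbhs B"
      and clo: "\<And>y c. y \<in> S \<Longrightarrow> y \<notin> C \<Longrightarrow> c \<in> C \<Longrightarrow> E y c \<Longrightarrow> y \<in> nbhs B"
      using g unfolding good_def B_def by auto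
    obtain cl where cl: "cl \<in> C" "E (last p) cl" using g unfolding good_def by blast
    have setp: "set p = insert (last p) B"
      using p0 unfolding B_def by (metis append_butlast_last_id Un_insert_right list.set(1) list.set(2) set_append sup_bot.right_neutral)
    have nE: "\<not> E v c" "v \<noteq> c" if "v \<in> B" "c \<in> C" for v c
      using BC[OF that(2)] that(1) by (auto simp: nbhs_def nbh_def)
    define X where "X = set (drop (length p - t) p)"
    have lastX: "last p \<in> X"
    proof -
      have "length p - t < length p" using p0 t by simp
      then have "drop (length p - t) p \<noteq> []" "last (drop (length p - t) p) = last p" by auto
      then show ?thesis unfolding X_def by (metis last_in_set)
    qed
    have XS: "X \<subseteq> S" unfolding X_def using pS set_drop_subset[of "length p - t" p] by (rule order.trans[rotated])
    have "card X \<le> t" unfolding X_def by (rule order.trans[OF card_length]) simp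
    then obtain D where D: "D \<subseteq> S - nbhs X" "conn D" "m < card D" using big XS by blast
    show ?thesis
    proof (cases "D \<subseteq> C")
      case True
      \<comment> \<open>\<open>D\<close> stays inside \<open>C\<close>: pass to the component
        \<open>C'\<close> around \<open>D\<close> of what the end of the path leaves of
        \<open>C\<close>. As \<open>C\<close> is connected, some \<open>b\<close> in the rest of
        \<open>C\<close> is adjacent to \<open>C'\<close>. It must be a neighbour of the end and
        becomes the next path vertex.\<close>
      define C0 where "C0 = C - nbh (last p)"
      have DC0: "D \<subseteq> C0" using True D(1) lastX unfolding C0_def nbhs_def by blast
      obtain d where d: "d \<in> D" using D(3) by fastforce
      define C' where "C' = reach C0 d"
      have dC0: "d \<in> C0" using d DC0 by blast
      have C'C0: "C' \<subseteq> C0" unfolding C'_def using reach_subset[OF dC0] .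
      have C'C: "C' \<subseteq> C" using C'C0 unfolding C0_def by blast
      have DC': "D \<subseteq> C'" unfolding C'_def by (rule conn_subset_reach[OF D(2) DC0 d])
      have "cl \<notin> C'" using C'C0 cl unfolding C0_def nbh_def by blast
      then have "C' \<noteq> C" using cl by blast
      moreover have "C' \<noteq> {}" using d DC' by blast
      ultimately obtain a b where ab: "a \<in> C'" "b \<in> C - C'" "E a b"
        using conn_cut[OF cC C'C] by blast
      have "b \<notin> C0" using reach_closed[OF dC0, of a b] ab unfolding C'_def by blast
      then have "b \<in> nbh (last p)" using ab unfolding C0_def by blast
      moreover have "b \<noteq> last p" using ab lC by blast
      ultimately have bl: "E (last p) b" unfolding nbh_def by blast
      have "ipath (p @ [b])"
      proof (rule ipath_append_single[OF ip p0 _ bl])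
        show "b \<notin> set p" using nE(2) ab \<open>b \<noteq> last p\<close> by (auto simp: setp)
        show "\<not> E v b" if "v \<in> set (butlast p)" for v using nE(1)[of v b] ab that unfolding B_def by blast
      qed
      moreover have "C' \<inter> nbhs (set p) = {}"
        using C'C0 BC C'C unfolding setp C0_def by (auto simp: nbhs_def)
      moreover have "y \<in> nbhs (set p)" if y: "y \<in> S" "y \<notin> C'" "c \<in> C'" "E y c" for y c
      proof (cases "y \<in> C")
        case True
        have "y \<notin> C0" using y reach_closed[OF dC0, of c y] sym[OF y(4)] unfolding C'_def by blast
        then show ?thesis using True unfolding setp C0_def nbhs_def by blast
      next
        case False
        have "y \<in> nbhs B" using y(1) False _ y(4) by (rule clo) (use y C'C in blast)
        then show ?thesis unfolding setp nbhs_def by blast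
      qed
      moreover have "m < card C'"
        using D(3) card_mono[OF finite_subset[OF _ fin] DC'] C'C CS by (meson less_le_trans order.trans)
      moreover have "conn C'" unfolding C'_def by (rule conn_reach[OF dC0])
      ultimately have "good (p @ [b]) C'" unfolding good_def
        using ab(1,2) sym[OF ab(3)] C'C CS pS by auto
      then show ?thesis by blast
    next
      case False
      \<comment> \<open>\<open>D\<close> leaves \<open>C\<close>: being connected, it contains an
        edge from some \<open>c\<close> in \<open>C\<close> to some \<open>y\<close> outside, and
        \<open>y\<close> is dominated by an earlier path vertex.\<close>
      have "D \<inter> C \<noteq> {}" using card2[of D C] D CS mC by blast
      moreover have "D \<inter> C \<noteq> D" using False by blast
      ultimately obtain c y where "c \<in> D \<inter> C" "y \<in> D - (D \<inter> C)" and Ecy: "E c y"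
        using conn_cut[OF D(2), of "D \<inter> C"] by blast
      then have cC': "c \<in> C" and cD: "c \<in> D" and yD: "y \<in> D" and yC: "y \<notin> C" by auto
      have yS: "y \<in> S" and ynX: "y \<notin> nbhs X" using yD D by auto
      have yB: "y \<notin> B" using nE(1)[OF _ cC'] sym[OF Ecy] by blast
      have "y \<in> nbhs B" using clo[OF yS yC cC' sym[OF Ecy]] .
      then obtain v where v: "v \<in> B" "y \<in> nbh v" unfolding nbhs_def by blast
      then have "E v y" using yB unfolding nbh_def by auto
      \<comment> \<open>The last neighbour of \<open>y\<close> on the path is wanted: beyond it
        \<open>y\<close> sees no path vertex, so the cycle closed through \<open>y\<close> has no
        chord there.\<close>
      define J where "J = {j. j < length p \<and> E (p ! j) y}"
      have "v \<in> set p" using v(1) unfolding B_def by (rule in_set_butlastD)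
      then have "J \<noteq> {}" using \<open>E v y\<close> unfolding J_def by (auto simp: in_set_conv_nth)
      have "finite J" unfolding J_def by simp
      define j where "j = Max J"
      have jJ: "j < length p" "E (p ! j) y" using Max_in[OF \<open>finite J\<close> \<open>J \<noteq> {}\<close>] unfolding j_def J_def by auto
      have jmax: "i \<le> j" if "i < length p" "E (p ! i) y" for i
        unfolding j_def using that \<open>finite J\<close> by (intro Max_ge) (auto simp: J_def)
      have jt: "j < length p - t"
      proof (rule ccontr)
        assume "\<not> ?thesis"
        then have "p ! j \<in> X" using jJ unfolding X_def
          by (auto simp: in_set_conv_nth intro!: exI[of _ "j - (length p - t)"])
        then show False using ynX jJ unfolding nbhs_def nbh_def by auto
      qed
      have la: "last p \<noteq> y" "\<not> E (last p) y" using ynX lastX unfolding nbhs_def nbh_def by auto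
      obtain qs where qs: "qs \<noteq> []" "set qs \<subseteq> C" "ipath (last p # qs @ [y])"
        using induced_path_through[OF cC lC yC la cl cC' Ecy] .
      define A where "A = butlast (drop j p)"
      have dj: "drop j p = A @ [last p]" unfolding A_def using jJ(1)
        by (metis append_butlast_last_id drop_eq_Nil2 last_drop not_le)
      have lenA: "length A = length p - j - 1" unfolding A_def by simp
      have A0: "A \<noteq> []" using lenA jt t by auto
      have Ai: "A ! i = p ! (j + i)" if "i < length A" for i
      proof -
        have "A ! i = drop j p ! i" using dj that by (simp add: nth_append)
        also have "\<dots> = p ! (j + i)" using jJ(1) by simp
        finally show ?thesis .
      qed
      have "distinct (drop j p)" using ip unfolding ipath_def by simp
      then have dA: "distinct A" unfolding dj by simp
      have Asub: "set A \<subseteq> B"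
      proof -
        have "butlast p = take j p @ A" using dj by (metis append_take_drop_id butlast_append butlast_snoc snoc_eq_iff_butlast append_is_Nil_conv not_Cons_self2)
        then show ?thesis unfolding B_def by simp
      qed
      have "hole (A @ last p # qs @ [y])"
      proof (rule hole_glue)
        show "ipath (A @ [last p])" using ipath_drop[of p j] ip dj by simp
        show "ipath (last p # qs @ [y])" by fact
        show "set A \<inter> set (qs @ [y]) = {}" using Asub qs(2) yB nE(2) by fastforce
        fix a b assume a: "a \<in> set A" and b: "b \<in> set (qs @ [y])"
        obtain i where i: "i < length A" "a = A ! i" using a by (auto simp: in_set_conv_nth)
        have dq: "y \<notin> set qs" using qs(3) unfolding ipath_def by auto
        show "E a b \<longleftrightarrow> a = hd A \<and> b = last (qs @ [y])"
        proof (cases "b = y")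
          case True
          have "E a y \<longleftrightarrow> i = 0"
          proof
            assume "E a y"
            then have "j + i \<le> j" using i Ai lenA by (intro jmax) auto
            then show "i = 0" by simp
          next
            assume "i = 0" then show "E a y" using i Ai jJ by auto
          qed
          moreover have "a = hd A \<longleftrightarrow> i = 0" using i A0 dA by (simp add: hd_conv_nth nth_eq_iff_index_eq)
          ultimately show ?thesis using True by simp
        next
          case False
          then have "b \<in> C" using b qs by auto
          then have "\<not> E a b" using a Asub nE(1) by blast
          then show ?thesis using False by simp
        qed
      qed (use A0 in auto)
      \<comment> \<open>\<open>A\<close> alone has \<open>length p - j - 1 \<ge> t\<close> vertices,
        because \<open>y\<close> has no neighbour among the last \<open>t\<close> vertices of the
        path.\<close>
      then have "length (A @ last p # qs @ [y]) < t" by (rule no_hole)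
      then show ?thesis using lenA jt by simp
    qed
  qed
  have base: "\<exists>p C. good p C"
  proof -
    obtain v where v: "v \<in> S" using ne by blast
    obtain D where D: "D \<subseteq> S - nbh v" "conn D" "m < card D" using big[of "{v}"] v t by (auto simp: nbhs_def)
    obtain d where d: "d \<in> D" using D(3) by fastforce
    define C where "C = reach (S - nbh v) d"
    have dS: "d \<in> S - nbh v" using d D by blast
    have CS: "C \<subseteq> S - nbh v" unfolding C_def by (rule reach_subset[OF dS])
    have "D \<subseteq> C" unfolding C_def by (rule conn_subset_reach[OF D(2,1) d])
    have "C \<noteq> S" using CS v nbh_self by blast
    then obtain a b where ab: "a \<in> C" "b \<in> S - C" "E a b"
      using conn_cut[of S C] conn CS d \<open>D \<subseteq> C\<close> by blast
    have out: "y \<in> nbh v" if "y \<in> S - C" "c \<in> C" "E y c" for y c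
      using reach_closed[OF dS, of c y] that sym unfolding C_def by blast
    have bv: "E v b" using out[of b a] ab sym CS unfolding nbh_def by blast
    have "ipath [v, b]" using bv irrefl unfolding ipath_def by (auto simp: less_Suc_eq)
    moreover have "m < card C" using D(3) card_mono[OF finite_subset[OF CS] \<open>D \<subseteq> C\<close>] fin by simp
    ultimately have "good [v, b] C" unfolding good_def
      using v ab CS conn_reach[OF dS] sym out unfolding C_def[symmetric] nbhs_def by auto
    then show ?thesis by blast
  qed
  \<comment> \<open>A path that can always be extended would outgrow \<open>S\<close>.\<close>
  have "\<exists>p C. good p C \<and> k \<le> length p" for k
  proof (induction k)
    case 0 then show ?case using base by simp
  next
    case (Suc k)
    then obtain p C where "good p C" "k \<le> length p" by blast
    moreover obtain v C' where "good (p @ [v]) C'" using step[OF \<open>good p C\<close>] by blast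
    ultimately show ?case by (intro exI[of _ "p @ [v]"] exI[of _ C']) simp
  qed
  then obtain p C where "good p C" "Suc (card S) \<le> length p" by blast
  moreover have "length p \<le> card S" using \<open>good p C\<close> fin card_mono[of S "set p"]
    unfolding good_def ipath_def by (simp add: distinct_card)
  ultimately show False by simp
qed

text \<open>Only one component can have more than \<open>m\<close> vertices, and separating that one
  is enough: a connected set meeting it lies inside it, and one avoiding it is small by
  counting.\<close>

lemma balanced_separator_any:
  assumes fin: "finite S" and card: "card S \<le> 2 * m + 1"
    and t: "1 \<le> t" and no_hole: "\<And>xs. hole xs \<Longrightarrow> length xs < t"
  obtains X where "X \<subseteq> S" "card X \<le> t" "\<And>D. D \<subseteq> S - nbhs X \<Longrightarrow> conn D \<Longrightarrow> card D \<le> m"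
proof (cases "\<exists>D\<subseteq>S. conn D \<and> m < card D")
  case False
  then show ?thesis using that[of "{}"] by (auto simp: not_less)
next
  case True
  then obtain D0 where D0: "D0 \<subseteq> S" "conn D0" "m < card D0" by blast
  obtain d where d: "d \<in> D0" using D0(3) by fastforce
  define C where "C = reach S d"
  have dS: "d \<in> S" using d D0 by blast
  have CS: "C \<subseteq> S" unfolding C_def by (rule reach_subset[OF dS])
  have D0C: "D0 \<subseteq> C" unfolding C_def by (rule conn_subset_reach[OF D0(2,1) d])
  have finC: "finite C" by (rule finite_subset[OF CS fin])
  have mC: "m < card C" using D0(3) card_mono[OF finC D0C] by simp
  have cC: "conn C" unfolding C_def by (rule conn_reach[OF dS])
  have "card C \<le> 2 * m + 1" using card card_mono[OF fin CS] by simp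
  moreover have "C \<noteq> {}" using mC by auto
  ultimately obtain X where X: "X \<subseteq> C" "card X \<le> t"
    "\<And>D. D \<subseteq> C - nbhs X \<Longrightarrow> conn D \<Longrightarrow> card D \<le> m"
    using balanced_separator[OF cC finC _ _ t no_hole, of m] by metis
  show ?thesis
  proof (rule that[of X])
    fix D assume D: "D \<subseteq> S - nbhs X" "conn D"
    show "card D \<le> m"
    proof (cases "D \<inter> C = {}")
      case True
      have DS: "D \<subseteq> S" using D by blast
      have "card D + card C = card (D \<union> C)"
        using True finC finite_subset[OF DS fin] by (simp add: card_Un_disjoint)
      also have "\<dots> \<le> card S" using DS CS by (intro card_mono[OF fin]) blast
      finally show ?thesis using card mC by simp
    next
      case False
      then obtain x where x: "x \<in> D" "x \<in> C" by blast
      have "D \<subseteq> reach S x" using conn_subset_reach[OF D(2) _ x(1), of S] D(1) by blast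
      also have "\<dots> \<subseteq> C" using x(2) reach_trans unfolding C_def by blast
      finally show ?thesis using X(3)[of D] D by blast
    qed
  qed (use X CS in auto)
qed

end

section \<open>The value of the budgeted recursion\<close>

locale wgraph = sgraph E for E :: "nat \<Rightarrow> nat \<Rightarrow> bool" +
  fixes n :: nat and w :: "nat \<Rightarrow> nat"
begin

definition wt :: "nat set \<Rightarrow> nat" where
  "wt A = (\<Sum>v\<in>A. w v)"

lemma fin_verts: "S \<subseteq> {..<n} \<Longrightarrow> finite S"
  by (rule finite_subset[OF _ finite_lessThan])

definition deg :: "nat set \<Rightarrow> nat \<Rightarrow> nat" where
  "deg S v = card {x \<in> S. E v x}"

text \<open>\<open>mscan\<close> mirrors the scan for a vertex of maximum degree, including its tie-breaking.\<close>

primrec mscan :: "nat set \<Rightarrow> nat \<Rightarrow> nat \<times> nat" where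
  "mscan S 0 = (0, 0)"
| "mscan S (Suc v) =
     (if v \<in> S \<and> fst (mscan S v) \<le> deg S v then (deg S v, v) else mscan S v)"

definition mdeg :: "nat set \<Rightarrow> nat" where
  "mdeg S = snd (mscan S n)"

lemma mscan_max:
  "(\<forall>x\<in>S \<inter> {..<i}. deg S x \<le> fst (mscan S i)) \<and>
   (S \<inter> {..<i} \<noteq> {} \<longrightarrow> snd (mscan S i) \<in> S \<and> fst (mscan S i) = deg S (snd (mscan S i))) \<and>
   (S \<inter> {..<i} = {} \<longrightarrow> fst (mscan S i) = 0)"
proof (induction i)
  case (Suc i)
  show ?case
  proof (cases "i \<in> S")
    case True
    then have "S \<inter> {..<Suc i} = insert i (S \<inter> {..<i})" by (auto simp: less_Suc_eq)
    moreover have "\<forall>x\<in>S \<inter> {..<i}. deg S x \<le> deg S i" if "fst (mscan S i) \<le> deg S i"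
      using Suc that by (meson order.trans)
    ultimately show ?thesis using Suc True by (auto simp: not_le)
  next
    case False
    then have "S \<inter> {..<Suc i} = S \<inter> {..<i}" by (auto simp: less_Suc_eq)
    then show ?thesis using Suc False by auto
  qed
qed simp

lemma mdeg:
  assumes "S \<subseteq> {..<n}" "S \<noteq> {}"
  shows "mdeg S \<in> S" "x \<in> S \<Longrightarrow> deg S x \<le> deg S (mdeg S)"
  using mscan_max[of S n] assms unfolding mdeg_def by (auto simp: Int_absorb2)

abbreviation comp :: "nat set \<Rightarrow> nat set" where
  "comp S \<equiv> reach S (Max S)"

lemma Max_mem:
  assumes "S \<subseteq> {..<n}" "S \<noteq> {}"
  shows "Max S \<in> S"
  using assms Max_in[OF fin_verts] by blast

lemma comp_props:
  assumes "S \<subseteq> {..<n}" "S \<noteq> {}"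
  shows "Max S \<in> comp S" "comp S \<subseteq> S" "conn (comp S)" "anti (comp S) (S - comp S)"
  using reach_self reach_subset[OF Max_mem[OF assms]] conn_reach[OF Max_mem[OF assms]]
    reach_closed[OF Max_mem[OF assms]] by (auto simp: anti_def)

text \<open>Splitting has priority over branching. The component of \<open>Max S\<close> is a
  canonical choice that a simple scan can reproduce. The guard \<open>S \<subseteq> {..<n}\<close>
  supplies the finiteness on which termination rests.\<close>

function val :: "nat set \<Rightarrow> nat \<Rightarrow> nat" where
  "val S k = (if S = {} \<or> k = 0 \<or> \<not> S \<subseteq> {..<n} then 0
     else if comp S \<noteq> S then val (comp S) k + val (S - comp S) k
     else Max (insert (val (S - {mdeg S}) k)
       ((\<lambda>v. val (S - nbh v) (k - 1) + (if v \<in> S then w v else 0)) ` {..<n})))"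
  by auto
termination
proof (relation "inv_image (less_than <*lex*> less_than) (\<lambda>(S, k). (k, card S))", goal_cases)
  case (2 S k)
  then have "comp S \<subset> S" using comp_props(2)[of S] by auto
  moreover have "finite S" using 2 fin_verts by auto
  ultimately show ?case by (simp add: psubset_card_mono)
next
  case (3 S k)
  then have "S - comp S \<subset> S" using comp_props(1)[of S] Max_mem[of S] by auto
  moreover have "finite S" using 3 fin_verts by auto
  ultimately show ?case by (simp add: psubset_card_mono)
next
  case (4 S k)
  then have "S - {mdeg S} \<subset> S" using mdeg(1)[of S] by auto
  moreover have "finite S" using 4 fin_verts by auto
  ultimately show ?case by (simp add: psubset_card_mono)
qed auto

declare val.simps [simp del]

lemma val_leaf: "S = {} \<or> k = 0 \<Longrightarrow> val S k = 0"
  by (subst val.simps) auto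

lemma val_split:
  assumes "S \<subseteq> {..<n}" "S \<noteq> {}" "comp S \<noteq> S"
  shows "val S k = val (comp S) k + val (S - comp S) k"
  using assms by (cases "k = 0") (auto simp: val_leaf val.simps[of S k])

lemma val_branch_le:
  assumes "S \<subseteq> {..<n}" "S \<noteq> {}" "k > 0" "comp S = S"
    "val (S - {mdeg S}) k \<le> x"
    "\<And>v. v < n \<Longrightarrow> val (S - nbh v) (k - 1) + (if v \<in> S then w v else 0) \<le> x"
  shows "val S k \<le> x"
  using assms by (subst val.simps) auto

lemma val_exclude:
  assumes "S \<subseteq> {..<n}" "S \<noteq> {}" "comp S = S"
  shows "val (S - {mdeg S}) k \<le> val S k"
  using assms by (cases "k = 0") (auto simp: val_leaf val.simps[of S k])

lemma val_branch:
  assumes "S \<subseteq> {..<n}" "S \<noteq> {}" "comp S = S" "v < n"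
  shows "val (S - nbh v) k + (if v \<in> S then w v else 0) \<le> val S (Suc k)"
proof -
  let ?A = "(\<lambda>v. val (S - nbh v) k + (if v \<in> S then w v else 0)) ` {..<n}"
  have "val S (Suc k) = Max (insert (val (S - {mdeg S}) (Suc k)) ?A)"
    using assms by (subst val.simps) auto
  moreover have "val (S - nbh v) k + (if v \<in> S then w v else 0) \<le> Max (insert (val (S - {mdeg S}) (Suc k)) ?A)"
    using assms(4) by (intro Max_ge) auto
  ultimately show ?thesis by simp
qed

text \<open>The definition peels off components by descending maxima; this lemma frees all later
  arguments from that order. The component of \<open>Max (A \<union> B)\<close> is also a component
  of the side that holds it, so it can be removed from there and induction applies to the
  remainder.\<close>

lemma val_union_anti:
  assumes "A \<subseteq> {..<n}" "B \<subseteq> {..<n}" "A \<inter> B = {}" "anti A B"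
  shows "val (A \<union> B) k = val A k + val B k"
  using assms
proof (induction "card (A \<union> B)" arbitrary: A B rule: less_induct)
  case less
  show ?case
  proof (cases "A = {} \<or> B = {}")
    case True
    then show ?thesis by (auto simp: val_leaf)
  next
    case False
    \<comment> \<open>Stated for the side holding the maximum. The induction hypothesis is a premise
      so that the statement can also be used with \<open>A\<close> and \<open>B\<close>
      exchanged.\<close>
    have main: "val (A \<union> B) k = val A k + val B k"
      if A: "A \<subseteq> {..<n}" "B \<subseteq> {..<n}" "A \<inter> B = {}" "anti A B" "Max (A \<union> B) \<in> A" "B \<noteq> {}"
        and IH: "\<And>A' B'. card (A' \<union> B') < card (A \<union> B) \<Longrightarrow> A' \<subseteq> {..<n} \<Longrightarrow> B' \<subseteq> {..<n} \<Longrightarrow>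
          A' \<inter> B' = {} \<Longrightarrow> anti A' B' \<Longrightarrow> val (A' \<union> B') k = val A' k + val B' k" for A B
    proof -
      have fin: "finite A" "finite B" using A by (auto intro: fin_verts)
      have A0: "A \<noteq> {}" using A by blast
      have maxeq: "Max (A \<union> B) = Max A"
        by (rule Max_eqI[symmetric]) (use A fin in auto)
      define C where "C = comp (A \<union> B)"
      have CA: "C \<subseteq> A" unfolding C_def
        by (rule reach_least) (use A in \<open>auto simp: anti_def\<close>)
      have CeqA: "C = comp A"
      proof
        show "comp A \<subseteq> C" unfolding maxeq[symmetric]
          by (rule reach_least) (use A CA reach_closed[of "Max (A \<union> B)" "A \<union> B"] in \<open>auto simp: C_def intro: reach_self\<close>)
        show "C \<subseteq> comp A"
          by (rule conn_subset_reach) (use comp_props[of "A \<union> B"] CA A maxeq in \<open>auto simp: C_def\<close>)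
      qed
      have MC: "Max A \<in> C" unfolding C_def maxeq[symmetric] by (rule reach_self)
      have "val (A \<union> B) k = val C k + val (A \<union> B - C) k"
        unfolding C_def by (rule val_split) (use A CA in \<open>auto simp: C_def\<close>)
      also have "A \<union> B - C = (A - C) \<union> B" using CA A by blast
      also have "val ((A - C) \<union> B) k = val (A - C) k + val B k"
      proof (rule IH)
        have "(A - C) \<union> B \<subset> A \<union> B" using MC CA A by blast
        then show "card ((A - C) \<union> B) < card (A \<union> B)" using fin by (intro psubset_card_mono) auto
      qed (use A in \<open>auto simp: anti_def\<close>)
      also have "val C k + (val (A - C) k + val B k) = val A k + val B k"
      proof (cases "C = A")
        case True then show ?thesis by (simp add: val_leaf)
      next
        case False
        then show ?thesis using val_split[of A k] A A0 CeqA by auto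
      qed
      finally show ?thesis .
    qed
    have "Max (A \<union> B) \<in> A \<union> B" using Max_mem[of "A \<union> B"] less.prems False by blast
    then consider "Max (A \<union> B) \<in> A" | "Max (B \<union> A) \<in> B" by (auto simp: Un_commute)
    then show ?thesis
    proof cases
      case 1
      show ?thesis by (rule main) (use 1 less False in auto)
    next
      case 2
      have "val (B \<union> A) k = val B k + val A k"
      proof (rule main)
        show "anti B A" using less.prems anti_commute by blast
      qed (use 2 less False in \<open>auto simp: Un_commute Int_commute\<close>)
      then show ?thesis by (simp add: Un_commute)
    qed
  qed
qed

text \<open>\<open>val\<close> offers picks on connected sets only. On a disconnected set the same
  vertex is picked in both parts, each paying from its own copy of the budget; at most one part
  gains \<open>w v\<close>, and the remainders recombine by \<open>val_union_anti\<close>.\<close>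

lemma val_step:
  assumes "S \<subseteq> {..<n}" "v < n"
  shows "val (S - nbh v) k + (if v \<in> S then w v else 0) \<le> val S (Suc k)"
  using assms(1)
proof (induction "card S" arbitrary: S rule: less_induct)
  case less
  show ?case
  proof (cases "S = {} \<or> comp S = S")
    case True
    show ?thesis
    proof (cases "S = {}")
      case True
      then show ?thesis by (simp add: val_leaf)
    next
      case False
      with True show ?thesis using val_branch[of S v k] less.prems assms(2) by blast
    qed
  next
    case False
    let ?C = "comp S" let ?D = "S - comp S"
    have S0: "S \<noteq> {}" and CS: "?C \<noteq> S" using False by auto
    note c = comp_props[OF less.prems S0]
    have fin: "finite S" using less.prems by (auto intro: fin_verts)
    have "card ?C < card S" "card ?D < card S"
      using False c by (auto intro!: psubset_card_mono[OF fin])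
    then have IH: "val (?C - nbh v) k + (if v \<in> ?C then w v else 0) \<le> val ?C (Suc k)"
      "val (?D - nbh v) k + (if v \<in> ?D then w v else 0) \<le> val ?D (Suc k)"
      using less False c by (blast, blast)
    have "S - nbh v = (?C - nbh v) \<union> (?D - nbh v)" using c False by blast
    then have s1: "val (S - nbh v) k = val (?C - nbh v) k + val (?D - nbh v) k"
      using val_union_anti[of "?C - nbh v" "?D - nbh v" k, OF _ _ _ anti_mono[OF c(4)]] c(2) less.prems by auto
    have s2: "val S (Suc k) = val ?C (Suc k) + val ?D (Suc k)"
      by (rule val_split) (use less False in auto)
    have s3: "(if v \<in> S then w v else 0) = (if v \<in> ?C then w v else 0) + (if v \<in> ?D then w v else 0)"
      using c False by auto
    show ?thesis unfolding s1 s2 s3 using add_mono[OF IH] by (simp only: ac_simps)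
  qed
qed

text \<open>By independence a pick deletes no other member of \<open>J\<close>, so the members can
  be taken one after another at one unit each.\<close>

lemma val_take_set:
  assumes "S \<subseteq> {..<n}" "J \<subseteq> S" "indep J"
  shows "wt J + val (S - nbhs J) k \<le> val S (k + card J)"
proof -
  have "finite J" using assms fin_verts[of J] by blast
  then show ?thesis using assms
  proof (induction J arbitrary: S)
    case empty
    then show ?case by (simp add: wt_def nbhs_def)
  next
    case (insert v J)
    have "J \<subseteq> S - nbh v" using insert by (auto simp: indep_def nbh_def)
    moreover have "S - nbhs (insert v J) = (S - nbh v) - nbhs J" by (auto simp: nbhs_def)
    moreover have "indep J" using insert.prems by (auto simp: indep_def)
    ultimately have "wt J + val (S - nbhs (insert v J)) k \<le> val (S - nbh v) (k + card J)"
      using insert.IH[of "S - nbh v"] insert.prems by auto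
    moreover have "val (S - nbh v) (k + card J) + w v \<le> val S (Suc (k + card J))"
      using val_step[of S v "k + card J"] insert.prems by auto
    moreover have "wt (insert v J) = w v + wt J" using insert by (simp add: wt_def)
    ultimately show ?case using insert by simp
  qed
qed

text \<open>Any weight gained is discarded, and \<open>X\<close> ranges over all vertices: a
  separator can thus be removed after some of its own vertices have gone.\<close>

lemma val_delete_set:
  assumes "S \<subseteq> {..<n}" "X \<subseteq> {..<n}"
  shows "val (S - nbhs X) k \<le> val S (k + card X)"
proof -
  have "finite X" using assms fin_verts[of X] by blast
  then show ?thesis using assms
  proof (induction X arbitrary: S)
    case empty
    then show ?case by (simp add: nbhs_def)
  next
    case (insert v X)
    have "S - nbhs (insert v X) = (S - nbh v) - nbhs X" by (auto simp: nbhs_def)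
    moreover have "val (S - nbh v - nbhs X) k \<le> val (S - nbh v) (k + card X)"
      using insert by (intro insert.IH) auto
    moreover have "val (S - nbh v) (k + card X) \<le> val S (Suc (k + card X))"
      using val_step[of S v "k + card X"] insert.prems by auto
    ultimately show ?case using insert by simp
  qed
qed

text \<open>Splits are free, so an estimate for connected subsets at budget \<open>k\<close> carries
  over to \<open>S\<close> at the same budget. Connected subsets are what the separator lemma speaks
  about.\<close>

lemma val_by_components:
  fixes f :: "nat set \<Rightarrow> nat"
  assumes "S \<subseteq> {..<n}" and "f {} = 0"
    and add: "\<And>A B. A \<union> B \<subseteq> S \<Longrightarrow> A \<inter> B = {} \<Longrightarrow> f (A \<union> B) = f A + f B"
    and conn: "\<And>C. C \<subseteq> S \<Longrightarrow> conn C \<Longrightarrow> f C \<le> a * val C k"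
  shows "f S \<le> a * val S k"
  using assms(1) add conn
proof (induction "card S" arbitrary: S rule: less_induct)
  case less
  show ?case
  proof (cases "S = {} \<or> comp S = S")
    case True
    then have "S = {} \<or> conn S" using comp_props(3)[OF less.prems(1)] by metis
    then show ?thesis using less.prems(3)[of S] \<open>f {} = 0\<close> by auto
  next
    case False
    let ?C = "comp S" let ?D = "S - comp S"
    have S0: "S \<noteq> {}" and CS: "?C \<noteq> S" using False by auto
    note c = comp_props[OF less.prems(1) S0]
    have fin: "finite S" using less.prems by (auto intro: fin_verts)
    have "?D \<subset> S" using c(1,2) by blast
    then have D: "card ?D < card S" by (rule psubset_card_mono[OF fin])
    have "f ?D \<le> a * val ?D k"
    proof (rule less.hyps[OF D])
      show "?D \<subseteq> {..<n}" using less.prems(1) by blast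
      show "f (A \<union> B) = f A + f B" if "A \<union> B \<subseteq> ?D" "A \<inter> B = {}" for A B
        using that by (intro less.prems(2)) auto
      show "f C \<le> a * val C k" if "C \<subseteq> ?D" "conn C" for C
        using that by (intro less.prems(3)) auto
    qed
    moreover have "f ?C \<le> a * val ?C k" using less.prems(3) c(2,3) by blast
    moreover have "f (?C \<union> ?D) = f ?C + f ?D" using c(2) by (intro less.prems(2)) auto
    moreover have "?C \<union> ?D = S" using c(2) by auto
    ultimately show ?thesis using val_split[OF less.prems(1) S0 CS, of k] by (simp add: distrib_left)
  qed
qed

section \<open>Lower bounds for the value\<close>


lemma wt_union: "finite A \<Longrightarrow> finite B \<Longrightarrow> A \<inter> B = {} \<Longrightarrow> wt (A \<union> B) = wt A + wt B"
  by (simp add: wt_def sum.union_disjoint)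

lemma wt_subadditive: "finite A \<Longrightarrow> finite B \<Longrightarrow> wt (A \<union> B) \<le> wt A + wt B"
  by (simp add: wt_def sum_Un_nat)

lemma wt_UN_le: "finite X \<Longrightarrow> (\<And>v. finite (A v)) \<Longrightarrow> wt (\<Union>v\<in>X. A v) \<le> (\<Sum>v\<in>X. wt (A v))"
proof (induction X rule: finite_induct)
  case (insert v X)
  have "wt (\<Union>v\<in>insert v X. A v) \<le> wt (A v) + wt (\<Union>v\<in>X. A v)"
    using wt_subadditive[of "A v" "\<Union>v\<in>X. A v"] insert by simp
  then show ?case using insert by simp
qed (simp add: wt_def)

lemma wt_mono: "finite B \<Longrightarrow> A \<subseteq> B \<Longrightarrow> wt A \<le> wt B"
  by (simp add: wt_def sum_mono2)

lemma wt_empty [simp]: "wt {} = 0"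
  by (simp add: wt_def)

lemma wt_by_components:
  assumes S: "S \<subseteq> {..<n}" and conn: "\<And>C. C \<subseteq> S \<Longrightarrow> conn C \<Longrightarrow> g * wt (I \<inter> C) \<le> a * val C k"
  shows "g * wt (I \<inter> S) \<le> a * val S k"
proof (rule val_by_components[OF S, where f = "\<lambda>C. g * wt (I \<inter> C)"])
  fix A B assume AB: "A \<union> B \<subseteq> S" "A \<inter> B = {}"
  then have "finite A" "finite B" using S fin_verts by (meson le_sup_iff order.trans)+
  moreover have "I \<inter> (A \<union> B) = (I \<inter> A) \<union> (I \<inter> B)" "(I \<inter> A) \<inter> (I \<inter> B) = {}" using AB by auto
  ultimately show "g * wt (I \<inter> (A \<union> B)) = g * wt (I \<inter> A) + g * wt (I \<inter> B)"
    by (simp add: wt_union distrib_left)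
qed (use conn in auto)

section \<open>The lower bound for the exact algorithm\<close>

lemma deg_nbh:
  assumes "finite S" "v \<in> S"
  shows "card (nbh v \<inter> S) = Suc (deg S v)"
proof -
  have "nbh v \<inter> S = insert v {x \<in> S. E v x}" using assms by (auto simp: nbh_def)
  then show ?thesis using assms irrefl by (simp add: deg_def)
qed

lemma card_nbhs_le:
  assumes "finite X" "\<And>v. v \<in> X \<Longrightarrow> real (card (nbh v \<inter> S)) \<le> r"
  shows "real (card (nbhs X \<inter> S)) \<le> real (card X) * r"
proof -
  have "nbhs X \<inter> S = (\<Union>v\<in>X. nbh v \<inter> S)" by (auto simp: nbhs_def)
  then have "card (nbhs X \<inter> S) \<le> (\<Sum>v\<in>X. card (nbh v \<inter> S))" 
    using card_UN_le[OF assms(1), of "\<lambda>v. nbh v \<inter> S"] by (simp only:)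
  then have "real (card (nbhs X \<inter> S)) \<le> (\<Sum>v\<in>X. real (card (nbh v \<inter> S)))" by (simp only: of_nat_sum[symmetric] of_nat_le_iff)
  also have "\<dots> \<le> (\<Sum>v\<in>X. r)" by (rule sum_mono) (use assms in auto)
  finally show ?thesis by simp
qed

text \<open>Removing the neighbourhoods of taken members of \<open>I\<close> costs no other member,
  because \<open>I\<close> has no edges; what \<open>I\<close> has inside \<open>N\<close> is
  collected before \<open>N\<close> is deleted.\<close>

lemma remove_taken:
  assumes "I \<subseteq> S" "indep I"
  shows "I \<inter> (S - nbhs (I \<inter> N) - N) = I - N"
  using assms by (auto simp: nbhs_def nbh_def indep_def)

text \<open>At the rate of \<open>8 * t\<close> units per unit of \<open>sqrt s\<close>, the
  decrease by 1/2 releases \<open>4 * t\<close> units, which pays for picking a vertex of high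
  degree.\<close>

lemma sqrt_diff_sqrt:
  assumes "1 \<le> s" "r \<le> s - sqrt s"
  shows "sqrt r \<le> sqrt s - 1/2"
proof (rule real_le_lsqrt)
  have "1 \<le> sqrt s" using assms by simp
  then show "0 \<le> sqrt s - 1/2" by linarith
  have "(sqrt s - 1/2)\<^sup>2 = s - sqrt s + 1/4" using assms by (simp add: power2_diff power_divide)
  then show "r \<le> (sqrt s - 1/2)\<^sup>2" using assms by simp
qed

text \<open>\<open>3/4\<close> is a rational upper estimate of \<open>1 / sqrt 2\<close>. Hence a
  quarter of the budget may be spent whenever the size is halved.\<close>

lemma sqrt_half_le: "0 \<le> s \<Longrightarrow> sqrt (s / 2) \<le> 3/4 * sqrt s"
  by (rule real_le_lsqrt) (simp_all add: power_mult_distrib power2_eq_square)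

lemma val_exact:
  assumes t: "1 \<le> t" and no_hole: "\<And>xs. hole xs \<Longrightarrow> length xs < t"
    and S: "S \<subseteq> {..<n}" and I: "I \<subseteq> S" "indep I" and k: "8 * real t * sqrt (card S) \<le> real k"
  shows "wt I \<le> val S k"
  using S I k
proof (induction "card S" arbitrary: S I k rule: less_induct)
  case less
  have fin: "finite S" by (rule fin_verts) fact
  have finI: "finite I" using less.prems fin finite_subset by blast
  have mono: "8 * real t * sqrt (card S') \<le> real k" if "card S' \<le> card S" for S' :: "nat set"
    using that less.prems(4) by (smt (verit) mult_left_mono of_nat_0_le_iff of_nat_mono real_sqrt_le_iff zero_le_mult_iff)
  have sub: "indep I'" if "I' \<subseteq> I" for I' using that less.prems(3) unfolding indep_def by blast
  consider "S = {}" | "S \<noteq> {}" "comp S \<noteq> S" | "S \<noteq> {}" "comp S = S" by blast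
  then show ?case
  proof cases
    case 1
    then show ?thesis using less.prems by simp
  next
    case 2
    note c = comp_props[OF less.prems(1) 2(1)]
    have "comp S \<subset> S" "S - comp S \<subset> S" using c(1,2) 2 by auto
    note l = this[THEN psubset_card_mono[OF fin]]
    have "wt (I \<inter> comp S) \<le> val (comp S) k"
      using l(1) c(2) less.prems by (intro less.hyps mono sub) auto
    moreover have "wt (I - comp S) \<le> val (S - comp S) k"
      using l(2) c(2) less.prems by (intro less.hyps mono sub) auto
    moreover have "wt I = wt (I \<inter> comp S) + wt (I - comp S)"
      using finI by (subst wt_union[symmetric]) (auto intro: arg_cong[of _ _ wt])
    ultimately show ?thesis using val_split[OF less.prems(1) 2, of k] by simp
  next
    case 3
    define s where "s = real (card S)"
    have s1: "1 \<le> s" unfolding s_def using 3 fin by (simp add: Suc_leI card_gt_0_iff)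
    have sq1: "1 \<le> sqrt s" using s1 by simp
    have k8: "8 * real t * sqrt s \<le> real k" using less.prems unfolding s_def by simp
    show ?thesis
    proof (cases "\<exists>v\<in>S. sqrt s \<le> card (nbh v \<inter> S)")
      case True
      define v where "v = mdeg S"
      have v: "v \<in> S" unfolding v_def using mdeg(1) less.prems 3 by blast
      have big: "sqrt s \<le> card (nbh v \<inter> S)"
      proof -
        obtain u where u: "u \<in> S" "sqrt s \<le> card (nbh u \<inter> S)" using True by blast
        have "card (nbh u \<inter> S) \<le> card (nbh v \<inter> S)"
          using mdeg(2)[OF less.prems(1) 3(1) u(1)] deg_nbh[OF fin u(1)] deg_nbh[OF fin v] by (simp add: v_def)
        then show ?thesis using u(2) by linarith
      qed
      show ?thesis
      proof (cases "v \<in> I")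
        case True
        have "8 * 1 * 1 \<le> 8 * real t * sqrt s" using t sq1 by (intro mult_mono) auto
        then obtain k' where k': "k = Suc k'" using k8 by (cases k) auto
        have "S - nbh v \<subset> S" using v nbh_self by blast
        then have l: "card (S - nbh v) < card S" by (rule psubset_card_mono[OF fin])
        have "card (S - nbh v) = card S - card (nbh v \<inter> S)"
          using fin by (simp add: card_Diff_subset_Int Int_commute)
        moreover have "card (nbh v \<inter> S) \<le> card S" using fin by (simp add: card_mono)
        ultimately have "real (card (S - nbh v)) \<le> s - sqrt s" using big unfolding s_def by simp
        from sqrt_diff_sqrt[OF s1 this]
        have "8 * real t * sqrt (card (S - nbh v)) \<le> 8 * real t * (sqrt s - 1/2)" by (intro mult_left_mono) auto
        also have "\<dots> \<le> real k'" using k8 k' t by (simp add: algebra_simps)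
        finally have kk: "8 * real t * sqrt (card (S - nbh v)) \<le> real k'" .
        have "I - {v} \<subseteq> S - nbh v" using less.prems True by (auto simp: indep_def nbh_def)
        then have "wt (I - {v}) \<le> val (S - nbh v) k'"
          using l less.prems kk by (intro less.hyps sub) auto
        moreover have "wt I = w v + wt (I - {v})" using True finI unfolding wt_def by (rule sum.remove[rotated])
        moreover have "val (S - nbh v) k' + w v \<le> val S k"
          using val_step[of S v k'] v less.prems k' by auto
        ultimately show ?thesis by simp
      next
        case False
        have "S - {v} \<subset> S" using v by blast
        then have l: "card (S - {v}) < card S" by (rule psubset_card_mono[OF fin])
        have "wt I \<le> val (S - {v}) k" using l less.prems False by (intro less.hyps mono) auto
        also have "\<dots> \<le> val S k" unfolding v_def by (rule val_exclude) (use less.prems 3 in auto)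
        finally show ?thesis .
      qed
    next
      case False
      have "card S \<le> 2 * (card S div 2) + 1" by presburger
      then obtain X where X: "X \<subseteq> S" "card X \<le> t"
        "\<And>D. D \<subseteq> S - nbhs X \<Longrightarrow> conn D \<Longrightarrow> card D \<le> card S div 2"
        using balanced_separator_any[OF fin _ t no_hole] by metis
      \<comment> \<open>The members of \<open>I\<close> dominated by \<open>X\<close> are taken
        first, so that deleting \<open>nbhs X\<close> afterwards loses nothing. Each of the two
        steps costs at most \<open>t * sqrt s\<close>: taking \<open>J\<close> because closed
        neighbourhoods are small, deleting because \<open>sqrt s\<close> is at least 1.\<close>
      define J where "J = I \<inter> nbhs X"
      define S3 where "S3 = S - nbhs J - nbhs X"
      have finX: "finite X" using X fin finite_subset by blast
      have "real (card (nbhs X \<inter> S)) \<le> real (card X) * sqrt s"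
      proof (rule card_nbhs_le[OF finX])
        fix v assume "v \<in> X"
        then have "\<not> sqrt s \<le> card (nbh v \<inter> S)" using False X(1) by blast
        then show "real (card (nbh v \<inter> S)) \<le> sqrt s" by linarith
      qed
      also have "\<dots> \<le> real t * sqrt s" using X s1 by (intro mult_right_mono) auto
      finally have NX: "real (card (nbhs X \<inter> S)) \<le> real t * sqrt s" .
      have "card J \<le> card (nbhs X \<inter> S)" unfolding J_def using fin less.prems by (intro card_mono) auto
      then have J: "real (card J) \<le> real t * sqrt s" using NX by linarith
      have "real (card X) \<le> real t * 1" using X by simp
      also have "\<dots> \<le> real t * sqrt s" using sq1 by (intro mult_left_mono) auto
      finally have cX: "real (card X) \<le> real t * sqrt s" .
      have "0 \<le> real t * sqrt s" using s1 by simp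
      then have "real (card J + card X) \<le> real k" using J cX k8 by simp
      then have "card J + card X \<le> k" by (simp only: of_nat_le_iff)
      then obtain k' where k': "k = k' + card X + card J"
        using le_Suc_ex[of "card J + card X" k] by (auto simp: ac_simps)
      \<comment> \<open>\<open>6 = 8 * 3/4\<close>, which is what sets of half the size require by
        \<open>sqrt_half_le\<close>.\<close>
      have k6: "6 * real t * sqrt s \<le> real k'" using J cX k8 unfolding k' by simp
      have S3: "S3 \<subseteq> {..<n}" unfolding S3_def using less.prems by blast
      have "1 * wt (I \<inter> S3) \<le> 1 * val S3 k'"
      proof (rule wt_by_components[OF S3])
        fix C assume C: "C \<subseteq> S3" "conn C"
        have half: "card C \<le> card S div 2" using C X(3) unfolding S3_def by blast
        then have l: "card C < card S" using 3 fin by (simp add: card_gt_0_iff div_less_dividend order.strict_trans1)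
        have "real (card C) \<le> s / 2" using half unfolding s_def by linarith
        then have "sqrt (card C) \<le> sqrt (s / 2)" by simp
        also have "\<dots> \<le> 3/4 * sqrt s" using s1 by (intro sqrt_half_le) simp
        finally have "8 * real t * sqrt (card C) \<le> 8 * real t * (3/4 * sqrt s)" by (intro mult_left_mono) auto
        then have "8 * real t * sqrt (card C) \<le> real k'" using k6 by simp
        then have "wt (I \<inter> C) \<le> val C k'" using l C S3 by (intro less.hyps sub) auto
        then show "1 * wt (I \<inter> C) \<le> 1 * val C k'" by simp
      qed
      moreover have "I \<inter> S3 = I - nbhs X" unfolding S3_def J_def by (rule remove_taken) (use less.prems in auto)
      moreover have "val S3 k' \<le> val (S - nbhs J) (k' + card X)"
        unfolding S3_def by (rule val_delete_set) (use X less.prems in auto)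
      moreover have "wt J + val (S - nbhs J) (k' + card X) \<le> val S k"
        unfolding k' by (rule val_take_set) (use less.prems sub in \<open>auto simp: J_def\<close>)
      moreover have "wt I = wt J + wt (I - nbhs X)"
        unfolding J_def using finI by (subst wt_union[symmetric]) (auto intro: arg_cong[of _ _ wt])
      ultimately show ?thesis by simp
    qed
  qed
qed


text \<open>
  Averaging: a vertex of \<open>I\<close> drawn with probability proportional to its weight hits each heavy
  neighbourhood with probability more than \<open>1 / Q\<close>.
\<close>

lemma heavy_hitter:
  fixes Q :: nat
  assumes "finite H" "H \<noteq> {}" "finite I" and heavy: "\<And>v. v \<in> H \<Longrightarrow> wt I < Q * wt (nbh v \<inter> I)"
  obtains u where "u \<in> I" "card H \<le> Q * card {v \<in> H. u \<in> nbh v}"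
proof (rule ccontr)
  assume "\<not> thesis"
  with that have c: "Q * card {v \<in> H. u \<in> nbh v} \<le> card H" if "u \<in> I" for u
    using that by (meson nat_le_linear)
  \<comment> \<open>Double counting of the pairs of a heavy vertex \<open>v\<close> and a member
    \<open>u\<close> of \<open>I\<close> in its neighbourhood, each weighted with
    \<open>Q * w u\<close>.\<close>
  have "(\<Sum>v\<in>H. wt I) < (\<Sum>v\<in>H. Q * wt (nbh v \<inter> I))"
    by (rule sum_strict_mono) (use assms in auto)
  also have "\<dots> = (\<Sum>v\<in>H. \<Sum>u\<in>I. if u \<in> nbh v then Q * w u else 0)"
    by (rule sum.cong[OF refl]) (use assms in \<open>simp add: wt_def sum_distrib_left sum.inter_restrict Int_commute
        if_distrib[of "(*) Q"] cong: if_cong\<close>)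
  also have "\<dots> = (\<Sum>u\<in>I. \<Sum>v\<in>H. if u \<in> nbh v then Q * w u else 0)"
    by (rule sum.swap)
  also have "\<dots> = (\<Sum>u\<in>I. w u * (Q * card {v \<in> H. u \<in> nbh v}))"
    by (rule sum.cong[OF refl]) (use assms in \<open>simp add: sum.inter_filter[symmetric] mult_ac\<close>)
  also have "\<dots> \<le> (\<Sum>u\<in>I. w u * card H)"
    by (intro sum_mono mult_left_mono c) auto
  also have "\<dots> = (\<Sum>v\<in>H. wt I)" by (simp add: wt_def sum_distrib_left mult.commute)
  finally show False by simp
qed

text \<open>\<open>Q\<close> rounds with factor \<open>1 - 1 / Q\<close> give at most
  \<open>exp (- 1) \<le> 1/2\<close>, and \<open>L\<close> such blocks bring a count below
  \<open>2 ^ L\<close> under 1.\<close>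

lemma net_step_bound:
  fixes Q :: nat
  assumes "1 \<le> Q" "1 \<le> L" "c < 2 ^ L"
  shows "(1 - 1 / real Q) ^ (Q * L) * real c < 1"
proof -
  have "1 - 1 / real Q \<le> exp (- (1 / real Q))" using exp_ge_add_one_self[of "- (1 / real Q)"] by simp
  then have "(1 - 1 / real Q) ^ Q \<le> exp (- (1 / real Q)) ^ Q" using assms by (intro power_mono) auto
  also have "\<dots> = exp (- 1)" using assms by (simp add: exp_of_nat_mult[symmetric])
  also have "\<dots> \<le> 1 / 2"
    using exp_ge_add_one_self[of 1] by (simp add: exp_minus divide_simps)
  finally have "(1 - 1 / real Q) ^ Q \<le> 1 / 2" .
  then have "((1 - 1 / real Q) ^ Q) ^ L \<le> (1 / 2) ^ L" using assms by (intro power_mono) auto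
  then have "(1 - 1 / real Q) ^ (Q * L) * real c \<le> (1 / 2) ^ L * real c"
    by (intro mult_right_mono) (auto simp: power_mult)
  also have "real c < 2 ^ L" using assms(3) by (metis of_nat_less_iff of_nat_numeral of_nat_power)
  then have "(1 / 2) ^ L * real c < (1 / 2) ^ L * 2 ^ L" by (rule mult_strict_left_mono) simp
  also have "\<dots> = (1::real)" by (simp flip: power_mult_distrib)
  finally show ?thesis .
qed

text \<open>Greedy hitting set: while heavy neighbourhoods remain, \<open>heavy_hitter\<close>
  provides a member of \<open>I\<close> in at least a \<open>1 / Q\<close> share of them. Heaviness
  refers to the fixed number \<open>wt I\<close>, so no new heavy vertices arise and their number
  shrinks geometrically until it is below 1.\<close>

lemma light_net:
  fixes Q :: nat
  assumes Q: "1 \<le> Q" and L: "1 \<le> L" "card S < 2 ^ L" and fin: "finite S" "finite I"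
  obtains J where "J \<subseteq> I" "card J \<le> Q * L" "\<And>v. v \<in> S - nbhs J \<Longrightarrow> Q * wt (nbh v \<inter> I) \<le> wt I"
proof -
  define H where "H J = {v \<in> S - nbhs J. wt I < Q * wt (nbh v \<inter> I)}" for J
  have finH: "finite (H J)" for J unfolding H_def using fin by simp
  have "\<exists>J\<subseteq>I. card J \<le> i \<and> real (card (H J)) \<le> (1 - 1 / real Q) ^ i * real (card S)" for i
  proof (induction i)
    case 0
    have "card (H {}) \<le> card S" unfolding H_def using fin by (intro card_mono) auto
    then show ?case by (intro exI[of _ "{}"]) auto
  next
    case (Suc i)
    then obtain J where J: "J \<subseteq> I" "card J \<le> i" "real (card (H J)) \<le> (1 - 1 / real Q) ^ i * real (card S)" by blast
    show ?case
    proof (cases "H J = {}")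
      case True
      then show ?thesis using J Q by (intro exI[of _ J]) auto
    next
      case False
      obtain u where u: "u \<in> I" "card (H J) \<le> Q * card {v \<in> H J. u \<in> nbh v}"
        by (rule heavy_hitter[OF finH False fin(2), of Q]) (auto simp: H_def)
      \<comment> \<open>Closed neighbourhoods are symmetric: a heavy \<open>v\<close> that sees
        \<open>u\<close> disappears together with \<open>nbh u\<close>.\<close>
      have "H (insert u J) \<subseteq> H J - {v \<in> H J. u \<in> nbh v}"
        unfolding H_def nbhs_def using nbh_sym by auto
      then have "card (H (insert u J)) \<le> card (H J - {v \<in> H J. u \<in> nbh v})"
        using finH by (intro card_mono) auto
      also have "\<dots> = card (H J) - card {v \<in> H J. u \<in> nbh v}"
        using finH by (intro card_Diff_subset) (auto intro: finite_subset)
      finally have "real (card (H (insert u J))) \<le> real (card (H J)) - real (card {v \<in> H J. u \<in> nbh v})"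
        using card_mono[OF finH, of "{v \<in> H J. u \<in> nbh v}" J] by auto
      also have "real (card (H J)) \<le> real Q * real (card {v \<in> H J. u \<in> nbh v})"
        using u(2) by (metis of_nat_le_iff of_nat_mult)
      then have "real (card (H J)) - real (card {v \<in> H J. u \<in> nbh v}) \<le> (1 - 1 / real Q) * real (card (H J))"
        using Q by (simp add: divide_simps) (simp add: algebra_simps)
      also have "\<dots> \<le> (1 - 1 / real Q) * ((1 - 1 / real Q) ^ i * real (card S))"
        using Q J(3) by (intro mult_left_mono) auto
      finally have "real (card (H (insert u J))) \<le> (1 - 1 / real Q) ^ Suc i * real (card S)" by simp
      moreover have "card (insert u J) \<le> Suc i" using J(2) by (intro card_insert_le_m1) auto
      ultimately show ?thesis using J(1) u(1) by (intro exI[of _ "insert u J"]) auto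
    qed
  qed
  then obtain J where J: "J \<subseteq> I" "card J \<le> Q * L"
    "real (card (H J)) \<le> (1 - 1 / real Q) ^ (Q * L) * real (card S)" by blast
  have "real (card (H J)) < 1" using J(3) net_step_bound[OF Q L] by linarith
  then have "H J = {}" using finH by simp
  then show ?thesis using that J unfolding H_def by (auto simp: not_less)
qed

text \<open>The subtraction \<open>Q - d * t\<close> is truncated, so the statement is void once \<open>d * t\<close> exceeds \<open>Q\<close>.\<close>

lemma val_approx:
  fixes Q :: nat
  assumes t: "1 \<le> t" and no_hole: "\<And>xs. hole xs \<Longrightarrow> length xs < t"
    and Q: "1 \<le> Q" and L: "1 \<le> L" "n < 2 ^ L"
    and S: "S \<subseteq> {..<n}" "card S < 2 ^ d" and I: "I \<subseteq> S" "indep I" and k: "d * (Q * L + t) \<le> k"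
  shows "(Q - d * t) * wt I \<le> Q * val S k"
  using S I k
proof (induction d arbitrary: S I k)
  case 0
  then show ?case using fin_verts[of S] by simp
next
  case (Suc d)
  have fin: "finite S" by (rule fin_verts) fact
  have finI: "finite I" using Suc.prems fin finite_subset by blast
  have sub: "indep I'" if "I' \<subseteq> I" for I' using that Suc.prems(4) unfolding indep_def by blast
  have "card S \<le> card {..<n}" by (rule card_mono) (use Suc.prems in auto)
  then have "card S < 2 ^ L" using L by simp
  then obtain J where
    J: "J \<subseteq> I" "card J \<le> Q * L" "\<And>v. v \<in> S - nbhs J \<Longrightarrow> Q * wt (nbh v \<inter> I) \<le> wt I"
    by (rule light_net[OF Q L(1) _ fin finI]) blast
  define S1 where "S1 = S - nbhs J"
  have S1: "S1 \<subseteq> S" "finite S1" unfolding S1_def using fin by auto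
  have "(1::nat) \<le> 2 ^ d" by simp
  moreover have "card S1 \<le> card S" using S1 fin by (simp add: card_mono)
  \<comment> \<open>The separator is applied with \<open>m = 2 ^ d - 1\<close>, so that sizes below
    \<open>2 ^ Suc d\<close> drop below \<open>2 ^ d\<close>.\<close>
  ultimately have "card S1 \<le> 2 * (2 ^ d - 1) + 1" using Suc.prems(2) by simp
  then obtain X where X: "X \<subseteq> S1" "card X \<le> t"
    "\<And>D. D \<subseteq> S1 - nbhs X \<Longrightarrow> conn D \<Longrightarrow> card D \<le> 2 ^ d - 1"
    using balanced_separator_any[OF S1(2) _ t no_hole] by metis
  have finX: "finite X" using X S1 finite_subset by blast
  define S2 where "S2 = S1 - nbhs X"
  have S2: "S2 \<subseteq> {..<n}" unfolding S2_def S1_def using Suc.prems by blast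
  have "card J + card X + d * (Q * L + t) \<le> k" using J(2) X(2) Suc.prems(5) by simp
  then obtain k' where k': "k = k' + card X + card J" "d * (Q * L + t) \<le> k'"
    by (intro that[of "k - card X - card J"]) auto
  define g where "g = Q - d * t"
  have "g * wt (I \<inter> S2) \<le> Q * val S2 k'"
  proof (rule wt_by_components[OF S2])
    fix C assume C: "C \<subseteq> S2" "conn C"
    have "card C \<le> 2 ^ d - 1" using C X(3) unfolding S2_def by blast
    then have "card C < 2 ^ d" using \<open>(1::nat) \<le> 2 ^ d\<close> by linarith
    then show "g * wt (I \<inter> C) \<le> Q * val C k'" unfolding g_def
      using C S2 k'(2) sub by (intro Suc.IH) auto
  qed
  also have "val S2 k' \<le> val S1 (k' + card X)"
    unfolding S2_def by (rule val_delete_set) (use X S1 Suc.prems in auto)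
  finally have g2: "g * wt (I \<inter> S2) \<le> Q * val S1 (k' + card X)" by simp
  have vJ: "wt J + val S1 (k' + card X) \<le> val S k"
    unfolding k' S1_def by (rule val_take_set) (use Suc.prems J sub in auto)
  \<comment> \<open>The at most \<open>t\<close> separator vertices avoid \<open>nbhs J\<close>, so
    the neighbourhood of each holds at most a \<open>1 / Q\<close> share of the weight of
    \<open>I\<close>.\<close>
  have lossX: "Q * wt (I \<inter> nbhs X) \<le> t * wt I"
  proof -
    have "I \<inter> nbhs X = (\<Union>v\<in>X. nbh v \<inter> I)" by (auto simp: nbhs_def)
    then have "wt (I \<inter> nbhs X) \<le> (\<Sum>v\<in>X. wt (nbh v \<inter> I))"
      using wt_UN_le[OF finX, of "\<lambda>v. nbh v \<inter> I"] finI by (simp only: finite_Int simp_thms True_implies_equals)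
    then have "Q * wt (I \<inter> nbhs X) \<le> (\<Sum>v\<in>X. Q * wt (nbh v \<inter> I))"
      unfolding sum_distrib_left[symmetric] by (rule mult_le_mono2)
    also have "\<dots> \<le> (\<Sum>v\<in>X. wt I)" by (rule sum_mono) (use J(3) X(1) in \<open>auto simp: S1_def\<close>)
    also have "\<dots> = card X * wt I" by simp
    also have "\<dots> \<le> t * wt I" using X(2) by (rule mult_right_mono) simp
    finally show ?thesis .
  qed
  \<comment> \<open>By independence, \<open>nbhs J\<close> contains no member of \<open>I\<close>
    apart from \<open>J\<close> itself.\<close>
  have I_eq: "I = J \<union> (I \<inter> S2) \<union> (I \<inter> nbhs X)"
    using Suc.prems(3,4) J(1) unfolding S2_def S1_def nbhs_def nbh_def indep_def by auto
  have "finite J" using finI J(1) by (rule finite_subset[rotated])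
  then have "wt (J \<union> (I \<inter> S2) \<union> (I \<inter> nbhs X)) \<le> wt J + wt (I \<inter> S2) + wt (I \<inter> nbhs X)"
    using finI by (intro order.trans[OF wt_subadditive] add_right_mono wt_subadditive) auto
  then have "g * wt I \<le> g * (wt J + wt (I \<inter> S2) + wt (I \<inter> nbhs X))"
    unfolding I_eq[symmetric] by (rule mult_le_mono2)
  then have "g * wt I \<le> g * wt J + g * wt (I \<inter> S2) + g * wt (I \<inter> nbhs X)"
    by (simp only: distrib_left)
  also have "g * wt J \<le> Q * wt J" unfolding g_def by (rule mult_right_mono) auto
  also have "g * wt (I \<inter> nbhs X) \<le> Q * wt (I \<inter> nbhs X)" unfolding g_def by (rule mult_right_mono) auto
  also note lossX
  also note g2
  finally have "g * wt I \<le> Q * (wt J + val S1 (k' + card X)) + t * wt I" by (simp add: distrib_left)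
  also have "\<dots> \<le> Q * val S k + t * wt I" using vJ by (intro add_right_mono mult_le_mono2)
  \<comment> \<open>The loss of this level turns the factor \<open>Q - d * t\<close> into
    \<open>Q - Suc d * t\<close>.\<close>
  finally have "g * wt I - t * wt I \<le> Q * val S k" by linarith
  then show ?case unfolding g_def by (simp add: diff_mult_distrib algebra_simps)
qed

end

section \<open>The recursion tree as a list\<close>

text \<open>
  A node consists of a vertex set, a budget, the position of its parent and a tag.  Tag 0 marks one of
  the two parts of a split set, whose results are united; the children with other tags are alternatives,
  and tag \<open>v + 2\<close> says that \<open>v\<close> has been picked on the way to the child.
\<close>

type_synonym node = "nat set \<times> nat \<times> nat \<times> nat"

abbreviation vset :: "node \<Rightarrow> nat set" where "vset c \<equiv> fst c"
abbreviation budget :: "node \<Rightarrow> nat" where "budget c \<equiv> fst (snd c)"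
abbreviation parent :: "node \<Rightarrow> nat" where "parent c \<equiv> fst (snd (snd c))"
abbreviation tag :: "node \<Rightarrow> nat" where "tag c \<equiv> snd (snd (snd c))"

definition extra :: "nat \<Rightarrow> nat set" where
  "extra p = (if p < 2 then {} else {p - 2})"

context wgraph begin

text \<open>The unfolding of \<open>val S k\<close>, listed in the order in which the program writes
  the children.\<close>

definition kids :: "nat \<Rightarrow> nat set \<Rightarrow> nat \<Rightarrow> node list" where
  "kids i S k =
     (if S = {} \<or> k = 0 then []
      else if comp S \<noteq> S then [(comp S, k, i, 0), (S - comp S, k, i, 0)]
      else map (\<lambda>v. (S - nbh v, k - 1, i, if v \<in> S then v + 2 else 1)) [0..<n] @
        [(S - {mdeg S}, k, i, 1)])"

definition kids_of :: "node list \<Rightarrow> nat \<Rightarrow> node list" where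
  "kids_of ns i = kids i (vset (ns ! i)) (budget (ns ! i))"

text \<open>
  Potential of a node: it bounds the number of nodes below it.  The quadratic factor pays for splits
  and for free deletions, which do not lower the budget.
\<close>

definition size_bound :: "node \<Rightarrow> nat" where
  "size_bound c = (n ^ 3 + n + 1) ^ budget c * ((card (vset c))\<^sup>2 + 1)"

lemma kids_vset: "S \<subseteq> {..<n} \<Longrightarrow> c \<in> set (kids i S k) \<Longrightarrow> vset c \<subseteq> S"
  using comp_props(2)[of S] by (auto simp: kids_def split: if_splits)

lemma kids_parent: "c \<in> set (kids i S k) \<Longrightarrow> parent c = i"
  by (auto simp: kids_def split: if_splits)

lemma kids_tag0:
  assumes "S \<subseteq> {..<n}" "c \<in> set (kids i S k)" "tag c = 0"
  shows "S \<noteq> {}" "0 < k" "comp S \<noteq> S" "vset c = comp S \<or> vset c = S - comp S" "budget c = k"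
  using assms by (auto simp: kids_def split: if_splits)

lemma kids_tag1:
  assumes "S \<subseteq> {..<n}" "c \<in> set (kids i S k)" "tag c \<noteq> 0"
  shows "S \<noteq> {}" "0 < k" "comp S = S"
    and "indep R \<Longrightarrow> R \<subseteq> vset c \<Longrightarrow> indep (R \<union> extra (tag c)) \<and> R \<union> extra (tag c) \<subseteq> S \<and> R \<inter> extra (tag c) = {}"
proof -
  show 1: "S \<noteq> {}" "0 < k" "comp S = S" using assms by (auto simp: kids_def split: if_splits)
  assume R: "indep R" "R \<subseteq> vset c"
  have "c \<in> set (map (\<lambda>v. (S - nbh v, k - 1, i, if v \<in> S then v + 2 else 1)) [0..<n] @ [(S - {mdeg S}, k, i, 1)])"
    using assms(2) 1 by (simp add: kids_def)
  then consider v where "v \<in> S" "c = (S - nbh v, k - 1, i, v + 2)" | "extra (tag c) = {}" "vset c \<subseteq> S"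
    by (auto simp: extra_def split: if_splits)
  then show "indep (R \<union> extra (tag c)) \<and> R \<union> extra (tag c) \<subseteq> S \<and> R \<inter> extra (tag c) = {}"
  proof cases
    case (1 v)
    then have "extra (tag c) = {v}" "R \<subseteq> S - nbh v" using R by (auto simp: extra_def)
    moreover have "\<not> E u v \<and> \<not> E v u" if "u \<in> R" for u
      using that \<open>R \<subseteq> S - nbh v\<close> sym by (auto simp: nbh_def)
    ultimately show ?thesis using R(1) 1(1) irrefl nbh_self by (auto simp: indep_def)
  next
    case 2
    then show ?thesis using R by auto
  qed
qed

text \<open>A node either unites the results of its children or selects the best of them, never a
  mixture.\<close>

lemma kids_same_tag:
  assumes "S \<subseteq> {..<n}" "c \<in> set (kids i S k)" "c' \<in> set (kids i S k)"
  shows "tag c = 0 \<longleftrightarrow> tag c' = 0"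
  using assms kids_tag0(3) kids_tag1(3) by metis

text \<open>The cross term \<open>2 * a * b * p\<close> is at least \<open>2 * p\<close>; it pays
  for the second summand \<open>p * 1\<close> and for the node itself.\<close>

lemma split_bound:
  assumes "1 \<le> (a::nat)" "1 \<le> b" "1 \<le> p"
  shows "1 + (p * (a\<^sup>2 + 1) + p * (b\<^sup>2 + 1)) \<le> p * ((a + b)\<^sup>2 + 1)"
proof -
  have "1 \<le> a * b" using assms mult_le_mono[of 1 a 1 b] by simp
  then have "p * 1 \<le> p * (a * b)" by (rule mult_le_mono2)
  then have "1 + p \<le> p * (a * b) + p * (a * b)" using assms(3) by linarith
  then show ?thesis by (simp add: power2_eq_square algebra_simps)
qed

text \<open>The base of the power is \<open>1 + n * (n^2 + 1)\<close>, so one copy of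
  \<open>(n ^ 3 + n + 1) ^ k\<close> pays for the node and for \<open>n\<close> children of budget
  \<open>k - 1\<close> and any size. A free deletion sets such a copy aside, since it lowers the
  square by at least 1.\<close>

lemma kids_size:
  assumes S: "S \<subseteq> {..<n}"
  shows "1 + sum_list (map size_bound (kids i S k)) \<le> size_bound (S, k, j, p)"
proof -
  have fin: "finite S" by (rule fin_verts) fact
  have cn: "card S \<le> n" using card_mono[OF _ S] by simp
  let ?M = "n ^ 3 + n + 1"
  consider "S = {} \<or> k = 0" | "S \<noteq> {}" "k > 0" "comp S \<noteq> S" | "S \<noteq> {}" "k > 0" "comp S = S" by blast
  then show ?thesis
  proof cases
    case 1
    then show ?thesis by (auto simp: kids_def size_bound_def)
  next
    case 2
    note c = comp_props[OF S 2(1)]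
    have "card S = card (comp S) + card (S - comp S)"
      using card_Un_disjoint[of "comp S" "S - comp S"] c(2) fin finite_subset[OF c(2) fin]
      by (simp add: Un_absorb1)
    moreover have "comp S \<noteq> {}" using c(1) by blast
    then have "1 \<le> card (comp S)" using finite_subset[OF c(2) fin] by (simp add: Suc_leI card_gt_0_iff)
    moreover have "S - comp S \<noteq> {}" using c(2) 2(3) by blast
    then have "1 \<le> card (S - comp S)" using fin by (simp add: Suc_leI card_gt_0_iff)
    moreover have "1 \<le> ?M ^ k" by simp
    ultimately show ?thesis using 2 split_bound[of "card (comp S)" "card (S - comp S)" "?M ^ k"]
      by (simp add: kids_def size_bound_def)
  next
    case 3
    then obtain k' where k': "k = Suc k'" by (cases k) auto
    obtain s where s: "card S = Suc s" using 3 fin by (metis card_0_eq not0_implies_Suc)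
    have sn: "Suc s \<le> n" using cn s by simp
    have m: "mdeg S \<in> S" using mdeg(1)[OF S] 3 by blast
    have "size_bound (S - nbh v, k', i, q) \<le> ?M ^ k' * (n\<^sup>2 + 1)" for v q
    proof -
      have "card (S - nbh v) \<le> n" using card_mono[OF fin, of "S - nbh v"] cn by auto
      then show ?thesis unfolding size_bound_def by (auto intro: power_mono)
    qed
    then have "sum_list (map size_bound (map (\<lambda>v. (S - nbh v, k - 1, i, if v \<in> S then v + 2 else 1)) [0..<n]))
        \<le> n * (?M ^ k' * (n\<^sup>2 + 1))"
      using sum_list_mono[of "[0..<n]" "\<lambda>v. size_bound (S - nbh v, k - 1, i, if v \<in> S then v + 2 else 1)" "\<lambda>_. ?M ^ k' * (n\<^sup>2 + 1)"]
      by (simp add: k' comp_def sum_list_triv)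
    moreover have "size_bound (S - {mdeg S}, k, i, 1) = ?M ^ k * (s\<^sup>2 + 1)"
      using m fin s by (simp add: size_bound_def)
    ultimately have "1 + sum_list (map size_bound (kids i S k)) \<le> 1 + (n * (?M ^ k' * (n\<^sup>2 + 1)) + ?M ^ k * (s\<^sup>2 + 1))"
      using 3 by (simp add: kids_def)
    also have "\<dots> \<le> ?M ^ k' * (1 + n * (n\<^sup>2 + 1)) + ?M ^ k * (s\<^sup>2 + 1)"
      by (simp add: algebra_simps)
    also have "1 + n * (n\<^sup>2 + 1) = ?M" by (simp add: power2_eq_square power3_eq_cube algebra_simps)
    also have "?M ^ k' * ?M + ?M ^ k * (s\<^sup>2 + 1) = ?M ^ k * (s\<^sup>2 + 2)"
      unfolding k' by (simp add: algebra_simps)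
    also have "\<dots> \<le> ?M ^ k * ((Suc s)\<^sup>2 + 1)" by (intro mult_le_mono) (auto simp: power2_eq_square)
    also have "\<dots> = size_bound (S, k, j, p)" by (simp add: size_bound_def s)
    finally show ?thesis .
  qed
qed

text \<open>State of a breadth-first construction: the nodes before position \<open>h\<close> are
  expanded, the others wait in a queue. The last conjunct bounds the work, as \<open>h\<close> plus
  the potentials of the waiting nodes stays below the potential of the root. The root formally is
  its own parent, hence the restrictions to \<open>0 < j\<close>.\<close>

definition tree :: "nat \<Rightarrow> node list \<Rightarrow> nat \<Rightarrow> bool" where
  "tree k0 ns h \<longleftrightarrow> h \<le> length ns \<and> ns \<noteq> [] \<and> ns ! 0 = ({..<n}, k0, 0, 1) \<and>
     (\<forall>j<length ns. vset (ns ! j) \<subseteq> {..<n}) \<and>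
     (\<forall>j. 0 < j \<and> j < length ns \<longrightarrow>
        parent (ns ! j) < j \<and> parent (ns ! j) < h \<and> ns ! j \<in> set (kids_of ns (parent (ns ! j)))) \<and>
     (\<forall>i<h. \<forall>c\<in>set (kids_of ns i). \<exists>j. i < j \<and> j < length ns \<and> ns ! j = c) \<and>
     (\<forall>j j'. 0 < j \<and> j < j' \<and> j' < length ns \<and> tag (ns ! j) = 0 \<and> tag (ns ! j') = 0 \<and>
        parent (ns ! j) = parent (ns ! j') \<longrightarrow> vset (ns ! j) \<inter> vset (ns ! j') = {}) \<and>
     h + sum_list (map size_bound (drop h ns)) \<le> size_bound ({..<n}, k0, 0, 1)"

lemma treeD:
  assumes "tree k0 ns h"
  shows "h \<le> length ns" "ns \<noteq> []" "ns ! 0 = ({..<n}, k0, 0, 1)"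
    and "\<And>j. j < length ns \<Longrightarrow> vset (ns ! j) \<subseteq> {..<n}"
    and "\<And>j. 0 < j \<Longrightarrow> j < length ns \<Longrightarrow> parent (ns ! j) < j"
    and "\<And>j. 0 < j \<Longrightarrow> j < length ns \<Longrightarrow> parent (ns ! j) < h"
    and "\<And>j. 0 < j \<Longrightarrow> j < length ns \<Longrightarrow> ns ! j \<in> set (kids_of ns (parent (ns ! j)))"
    and "\<And>i c. i < h \<Longrightarrow> c \<in> set (kids_of ns i) \<Longrightarrow> \<exists>j. i < j \<and> j < length ns \<and> ns ! j = c"
    and "\<And>j j'. 0 < j \<Longrightarrow> j < j' \<Longrightarrow> j' < length ns \<Longrightarrow> tag (ns ! j) = 0 \<Longrightarrow> tag (ns ! j') = 0 \<Longrightarrow>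
        parent (ns ! j) = parent (ns ! j') \<Longrightarrow> vset (ns ! j) \<inter> vset (ns ! j') = {}"
    and "h + sum_list (map size_bound (drop h ns)) \<le> size_bound ({..<n}, k0, 0, 1)"
  using assms unfolding tree_def by simp_all

lemma tree_init: "tree k0 [({..<n}, k0, 0, 1)] 0"
  by (auto simp: tree_def)

lemma kids_siblings:
  assumes "a < b" "b < length (kids i S k)" "tag (kids i S k ! a) = 0"
  shows "vset (kids i S k ! a) \<inter> vset (kids i S k ! b) = {}"
proof -
  have "kids i S k = [(comp S, k, i, 0), (S - comp S, k, i, 0)]"
  proof (rule ccontr)
    assume "\<not> ?thesis"
    then have "\<forall>c\<in>set (kids i S k). tag c \<noteq> 0" using assms by (auto simp: kids_def split: if_splits)
    then show False using assms by (meson nth_mem order.strict_trans)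
  qed
  then show ?thesis using assms by (auto simp: less_Suc_eq)
qed

lemma tree_step:
  assumes T: "tree k0 ns h" and h: "h < length ns"
  shows "tree k0 (ns @ kids_of ns h) (Suc h)"
proof -
  let ?K = "kids_of ns h" let ?ns = "ns @ kids_of ns h"
  have Sh: "vset (ns ! h) \<subseteq> {..<n}" by (rule treeD(4)[OF T h])
  have old: "?ns ! j = ns ! j" if "j < length ns" for j using that by (simp add: nth_append)
  have new: "?ns ! j = ?K ! (j - length ns)" "?ns ! j \<in> set ?K" "parent (?ns ! j) = h" "vset (?ns ! j) \<subseteq> vset (ns ! h)"
    if "\<not> j < length ns" "j < length ?ns" for j
  proof -
    show 1: "?ns ! j = ?K ! (j - length ns)" using that by (simp add: nth_append)
    show 2: "?ns ! j \<in> set ?K" unfolding 1 using that by (intro nth_mem) auto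
    show "parent (?ns ! j) = h" using kids_parent 2 unfolding kids_of_def by blast
    show "vset (?ns ! j) \<subseteq> vset (ns ! h)" using kids_vset[OF Sh] 2 unfolding kids_of_def by blast
  qed
  have kids_old: "kids_of ?ns i = kids_of ns i" if "i < length ns" for i
    using that by (simp add: kids_of_def nth_append)
  have t1: "\<forall>j<length ?ns. vset (?ns ! j) \<subseteq> {..<n}"
  proof (intro allI impI)
    fix j assume j: "j < length ?ns"
    show "vset (?ns ! j) \<subseteq> {..<n}"
    proof (cases "j < length ns")
      case True then show ?thesis using treeD(4)[OF T] by (simp add: old)
    next
      case False show ?thesis using new(4)[OF False j] Sh by (rule order.trans)
    qed
  qed
  have t2: "parent (?ns ! j) < j \<and> parent (?ns ! j) < Suc h \<and> ?ns ! j \<in> set (kids_of ?ns (parent (?ns ! j)))"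
    if j: "0 < j" "j < length ?ns" for j
  proof (cases "j < length ns")
    case True
    then have "parent (ns ! j) < j \<and> parent (ns ! j) < h \<and> ns ! j \<in> set (kids_of ns (parent (ns ! j)))"
      using treeD(5-7)[OF T j(1) True] by blast
    then show ?thesis using True h by (simp add: old kids_old)
  next
    case False
    then show ?thesis using new(2,3)[OF False j(2)] h by (simp add: kids_old)
  qed
  have t3: "\<exists>j. i < j \<and> j < length ?ns \<and> ?ns ! j = c" if i: "i < Suc h" and c: "c \<in> set (kids_of ?ns i)" for i c
  proof (cases "i < h")
    case True
    then have "c \<in> set (kids_of ns i)" using c h by (simp add: kids_old)
    then obtain j where "i < j" "j < length ns" "ns ! j = c" using treeD(8)[OF T True] by blast
    then show ?thesis by (intro exI[of _ j]) (auto simp: old)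
  next
    case False
    then have "i = h" using i by simp
    then have "c \<in> set ?K" using c h by (simp add: kids_old)
    then obtain l where "l < length ?K" "?K ! l = c" by (auto simp: in_set_conv_nth)
    then show ?thesis using h \<open>i = h\<close> by (intro exI[of _ "length ns + l"]) auto
  qed
  have t4: "vset (?ns ! j) \<inter> vset (?ns ! j') = {}"
    if j: "0 < j" "j < j'" "j' < length ?ns" "tag (?ns ! j) = 0" "tag (?ns ! j') = 0" "parent (?ns ! j) = parent (?ns ! j')" for j j'
  proof (cases "j' < length ns")
    case True
    then show ?thesis using treeD(9)[OF T j(1,2) True] j by (simp add: old)
  next
    case False
    note nj' = new[OF False j(3)]
    \<comment> \<open>Old nodes have parents before \<open>h\<close>, so siblings of a new node are
      new.\<close>
    have "\<not> j < length ns"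
    proof
      assume l: "j < length ns"
      then have "parent (ns ! j) < h" using treeD(6)[OF T j(1)] by blast
      then show False using j(6) nj'(3) l by (simp add: old)
    qed
    then have nj: "?ns ! j = ?K ! (j - length ns)" using j by (simp add: nth_append)
    show ?thesis unfolding nj nj'(1) unfolding kids_of_def
      by (rule kids_siblings) (use j nj \<open>\<not> j < length ns\<close> in \<open>auto simp: kids_of_def\<close>)
  qed
  \<comment> \<open>Node \<open>h\<close> leaves the queue; its potential is exchanged for one unit
    of work and the potentials of its children.\<close>
  have "drop h ns = ns ! h # drop (Suc h) ns" using h by (simp add: Cons_nth_drop_Suc)
  then have "h + (size_bound (ns ! h) + sum_list (map size_bound (drop (Suc h) ns))) \<le> size_bound ({..<n}, k0, 0, 1)"
    using treeD(10)[OF T] by simp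
  moreover have "1 + sum_list (map size_bound ?K) \<le> size_bound (ns ! h)"
    using kids_size[OF Sh, of h "budget (ns ! h)" "parent (ns ! h)" "tag (ns ! h)"] unfolding kids_of_def by simp
  ultimately have t5: "Suc h + sum_list (map size_bound (drop (Suc h) ?ns)) \<le> size_bound ({..<n}, k0, 0, 1)"
    using h by simp
  have "?ns ! 0 = ({..<n}, k0, 0, 1)" using treeD(2,3)[OF T] by (simp add: nth_append)
  moreover have "Suc h \<le> length ?ns" "?ns \<noteq> []" using h by auto
  ultimately show ?thesis unfolding tree_def using t1 t2 t3 t4 t5 by blast
qed

lemma tree_length:
  assumes "tree k0 ns h"
  shows "h \<le> size_bound ({..<n}, k0, 0, 1)"
  using treeD(10)[OF assms] by linarith

text \<open>What a reported child guarantees at its parent. For a part of a split it is a share of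
  \<open>A\<close> inside that part, which survives further unions; for an alternative it is a lower
  bound on the best weight \<open>x\<close> so far.\<close>

definition credited :: "node \<Rightarrow> nat set \<Rightarrow> nat \<Rightarrow> bool" where
  "credited c A x \<longleftrightarrow>
     (if tag c = 0 then val (vset c) (budget c) \<le> wt (A \<inter> vset c)
      else val (vset c) (budget c) + wt (extra (tag c)) \<le> x)"

text \<open>Invariant of the bottom-up evaluation after the nodes from position \<open>j\<close> on have reported to their parents.\<close>

definition results :: "node list \<Rightarrow> nat \<Rightarrow> (nat \<Rightarrow> nat set) \<Rightarrow> (nat \<Rightarrow> nat) \<Rightarrow> bool" where
  "results ns j R W \<longleftrightarrow> (\<forall>i<length ns. R i \<subseteq> vset (ns ! i) \<and> indep (R i) \<and> W i = wt (R i) \<and>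
     (\<forall>c. j \<le> c \<and> 0 < c \<and> c < length ns \<and> parent (ns ! c) = i \<longrightarrow>
        credited (ns ! c) (R i) (W i)) \<and>
     (\<forall>c. 0 < c \<and> c < j \<and> c < length ns \<and> parent (ns ! c) = i \<and> tag (ns ! c) = 0 \<longrightarrow>
        R i \<inter> vset (ns ! c) = {}))"

lemma resultsD:
  assumes "results ns j R W" "i < length ns"
  shows "R i \<subseteq> vset (ns ! i)" "indep (R i)" "W i = wt (R i)"
    and "\<And>c. j \<le> c \<Longrightarrow> 0 < c \<Longrightarrow> c < length ns \<Longrightarrow> parent (ns ! c) = i \<Longrightarrow>
        credited (ns ! c) (R i) (W i)"
    and "\<And>c. 0 < c \<Longrightarrow> c < j \<Longrightarrow> c < length ns \<Longrightarrow> parent (ns ! c) = i \<Longrightarrow> tag (ns ! c) = 0 \<Longrightarrow>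
        R i \<inter> vset (ns ! c) = {}"
  using assms unfolding results_def by blast+

lemma resultsI:
  assumes "\<And>i. i < length ns \<Longrightarrow> R i \<subseteq> vset (ns ! i)" "\<And>i. i < length ns \<Longrightarrow> indep (R i)"
    "\<And>i. i < length ns \<Longrightarrow> W i = wt (R i)"
    and "\<And>i c. i < length ns \<Longrightarrow> j \<le> c \<Longrightarrow> 0 < c \<Longrightarrow> c < length ns \<Longrightarrow> parent (ns ! c) = i \<Longrightarrow>
        credited (ns ! c) (R i) (W i)"
    and "\<And>i c. i < length ns \<Longrightarrow> 0 < c \<Longrightarrow> c < j \<Longrightarrow> c < length ns \<Longrightarrow> parent (ns ! c) = i \<Longrightarrow> tag (ns ! c) = 0 \<Longrightarrow>
        R i \<inter> vset (ns ! c) = {}"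
  shows "results ns j R W"
  unfolding results_def using assms by blast

lemma results_init: "results ns (length ns) (\<lambda>_. {}) (\<lambda>_. 0)"
  by (auto simp: results_def indep_def)

text \<open>Children stand after their parent, so \<open>j \<le> Suc i\<close> means that all
  children of \<open>i\<close> have reported; their credits match the cases of the recursion for
  \<open>val\<close>.\<close>

lemma results_val:
  assumes T: "tree k0 ns (length ns)" and res: "results ns j R W" and i: "i < length ns" "j \<le> Suc i"
  shows "val (vset (ns ! i)) (budget (ns ! i)) \<le> W i"
proof -
  let ?S = "vset (ns ! i)" let ?k = "budget (ns ! i)"
  have S: "?S \<subseteq> {..<n}" using treeD(4)[OF T] i by blast
  have Ri: "R i \<subseteq> ?S" "W i = wt (R i)" using resultsD[OF res i(1)] by auto
  have kid: "credited c (R i) (W i)" if c: "c \<in> set (kids i ?S ?k)" for c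
  proof -
    obtain l where l: "i < l" "l < length ns" and c_eq: "ns ! l = c"
      using treeD(8)[OF T i(1)] c unfolding kids_of_def by blast
    have "j \<le> l" "0 < l" using l i by auto
    moreover have "parent (ns ! l) = i" using kids_parent[OF c] c_eq by simp
    ultimately show ?thesis using resultsD(4)[OF res i(1), of l] l(2) unfolding c_eq by blast
  qed
  consider "?S = {} \<or> ?k = 0" | "?S \<noteq> {}" "?k > 0" "comp ?S \<noteq> ?S" | "?S \<noteq> {}" "?k > 0" "comp ?S = ?S" by blast
  then show ?thesis
  proof cases
    case 1
    then show ?thesis by (simp add: val_leaf)
  next
    case 2
    have finR: "finite (R i)" using Ri S fin_verts finite_subset by blast
    have "val (comp ?S) ?k \<le> wt (R i \<inter> comp ?S)" "val (?S - comp ?S) ?k \<le> wt (R i \<inter> (?S - comp ?S))"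
      using kid[of "(comp ?S, ?k, i, 0)"] kid[of "(?S - comp ?S, ?k, i, 0)"] 2 by (auto simp: kids_def credited_def)
    moreover have "wt (R i) = wt (R i \<inter> comp ?S) + wt (R i \<inter> (?S - comp ?S))"
      using finR Ri(1) comp_props(2)[OF S 2(1)] by (subst wt_union[symmetric]) (auto intro: arg_cong[of _ _ wt])
    ultimately show ?thesis using val_split[OF S 2(1,3), of ?k] Ri(2) by linarith
  next
    case 3
    show ?thesis
    proof (rule val_branch_le[OF S 3])
      have "(?S - {mdeg ?S}, ?k, i, 1) \<in> set (kids i ?S ?k)" using 3 by (simp add: kids_def)
      from kid[OF this] show "val (?S - {mdeg ?S}) ?k \<le> W i" by (simp add: credited_def)
      fix v assume v: "v < n"
      have "(?S - nbh v, ?k - 1, i, if v \<in> ?S then v + 2 else 1) \<in> set (kids i ?S ?k)"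
        using 3 v by (auto simp: kids_def)
      from kid[OF this] show "val (?S - nbh v) (?k - 1) + (if v \<in> ?S then w v else 0) \<le> W i"
        by (auto simp: credited_def extra_def wt_def split: if_splits)
    qed
  qed
qed

definition report :: "node list \<Rightarrow> nat \<Rightarrow> (nat \<Rightarrow> nat set) \<times> (nat \<Rightarrow> nat) \<Rightarrow> (nat \<Rightarrow> nat set) \<times> (nat \<Rightarrow> nat)" where
  "report ns j = (\<lambda>(R, W). let p = parent (ns ! j); x = tag (ns ! j) in
     if x = 0 then (R(p := R p \<union> R j), W(p := W p + W j))
     else if W p < W j + wt (extra x) then (R(p := R j \<union> extra x), W(p := W j + wt (extra x)))
     else (R, W))"

text \<open>In backward order the result of \<open>j\<close> is final when it reports. Two parts of
  a split have no edges between them, and the parent holds nothing inside an unreported part, so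
  unions stay independent and weights add up.\<close>

lemma results_step:
  assumes T: "tree k0 ns (length ns)" and res: "results ns (Suc j) R W" and j: "0 < j" "j < length ns"
    and rep: "report ns j (R, W) = (R', W')"
  shows "results ns j R' W'"
proof -
  define c0 where "c0 = ns ! j"
  define p where "p = parent c0"
  let ?S = "vset (ns ! p)"
  have p: "p < j" "p < length ns" and c0: "c0 \<in> set (kids p ?S (budget (ns ! p)))"
    using treeD(5,7)[OF T j] j(2) unfolding kids_of_def p_def c0_def by auto
  have S: "?S \<subseteq> {..<n}" using treeD(4)[OF T p(2)] .
  have sub: "vset c0 \<subseteq> ?S" by (rule kids_vset[OF S c0])
  have vj: "val (vset c0) (budget c0) \<le> W j"
    using results_val[OF T res j(2)] unfolding c0_def by simp
  have base: "R i \<subseteq> vset (ns ! i)" "indep (R i)" "W i = wt (R i)" "finite (R i)" if "i < length ns" for i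
  proof -
    show 1: "R i \<subseteq> vset (ns ! i)" "indep (R i)" "W i = wt (R i)" using resultsD[OF res that] by blast+
    have "vset (ns ! i) \<subseteq> {..<n}" by (rule treeD(4)[OF T that])
    then show "finite (R i)" using 1(1) fin_verts by blast
  qed
  have reported: "credited (ns ! c) (R i) (W i)"
    if "i < length ns" "j < c" "c < length ns" "parent (ns ! c) = i" for i c
    using resultsD(4)[OF res that(1) _ _ that(3,4)] that(2) by simp
  have todo: "R i \<inter> vset (ns ! c) = {}"
    if "i < length ns" "0 < c" "c \<le> j" "parent (ns ! c) = i" "tag (ns ! c) = 0" for i c
    using resultsD(5)[OF res that(1,2) _ _ that(4,5)] that(3) j(2) by simp
  have kid: "ns ! c \<in> set (kids p ?S (budget (ns ! p)))" if "0 < c" "c < length ns" "parent (ns ! c) = p" for c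
    using treeD(7)[OF T that(1,2)] unfolding kids_of_def that(3) .
  have other: "R' i = R i" "W' i = W i" if "i \<noteq> p" for i
    using rep that unfolding report_def p_def c0_def Let_def by (auto split: if_splits)
  have P: "R' p \<subseteq> ?S \<and> indep (R' p) \<and> W' p = wt (R' p) \<and> W p \<le> W' p \<and>
     (tag c0 = 0 \<longrightarrow> R p \<subseteq> R' p \<and> val (vset c0) (budget c0) \<le> wt (R' p \<inter> vset c0) \<and> R' p = R p \<union> R j) \<and>
     (tag c0 \<noteq> 0 \<longrightarrow> val (vset c0) (budget c0) + wt (extra (tag c0)) \<le> W' p)"
  proof (cases "tag c0 = 0")
    case True
    have e: "R' p = R p \<union> R j" "W' p = W p + W j"
      using rep True unfolding report_def p_def c0_def Let_def by auto
    have disj: "R p \<inter> vset c0 = {}" unfolding c0_def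
      by (rule todo) (use p j True in \<open>auto simp: p_def c0_def\<close>)
    have Rj: "R j \<subseteq> vset c0" using base(1)[OF j(2)] unfolding c0_def .
    have "anti (vset c0) (?S - vset c0)"
    proof -
      note k = kids_tag0[OF S c0 True]
      note a = comp_props[OF S k(1)]
      have "?S - (?S - comp ?S) = comp ?S" using a(2) by blast
      then show ?thesis using k(4) a(4) anti_commute by metis
    qed
    then have "anti (R j) (R p)" by (rule anti_mono) (use Rj disj base(1)[OF p(2)] in auto)
    then have "indep (R' p)" unfolding e using base(2)[OF p(2)] base(2)[OF j(2)] anti_commute
      unfolding indep_def anti_def by blast
    moreover have "wt (R p \<union> R j) = wt (R p) + wt (R j)"
      by (rule wt_union) (use base(4) p j Rj disj in auto)
    moreover have "R' p \<subseteq> ?S" unfolding e using base(1)[OF p(2)] Rj sub by blast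
    moreover have "R' p \<inter> vset c0 = R j" unfolding e using Rj disj by blast
    ultimately show ?thesis using True e vj base(3)[OF p(2)] base(3)[OF j(2)] by simp
  next
    case False
    note k = kids_tag1[OF S c0 False]
    have R: "indep (R j \<union> extra (tag c0)) \<and> R j \<union> extra (tag c0) \<subseteq> ?S \<and> R j \<inter> extra (tag c0) = {}"
      by (rule k(4)) (use base j in \<open>auto simp: c0_def\<close>)
    have "finite (extra (tag c0))" by (simp add: extra_def)
    then have u: "wt (R j \<union> extra (tag c0)) = W j + wt (extra (tag c0))"
      using R base(3,4)[OF j(2)] by (simp add: wt_union)
    have e: "R' p = (if W p < W j + wt (extra (tag c0)) then R j \<union> extra (tag c0) else R p)"
      "W' p = (if W p < W j + wt (extra (tag c0)) then W j + wt (extra (tag c0)) else W p)"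
      using rep False unfolding report_def p_def c0_def Let_def by (auto split: if_splits)
    show ?thesis using False R u vj base[OF p(2)] unfolding e by auto
  qed
  have "R' p \<subseteq> {..<n}" using P S by (meson order.trans)
  then have fin': "finite (R' p)" by (rule fin_verts)
  have processed: "credited (ns ! c) (R' p) (W' p)"
    if c: "j \<le> c" "c < length ns" "parent (ns ! c) = p" for c
  proof (cases "c = j")
    case True
    then show ?thesis using P unfolding c0_def credited_def by auto
  next
    case False
    then have jc: "j < c" using c by simp
    note d = reported[OF p(2) jc c(2,3)]
    \<comment> \<open>As the siblings are of the same kind, earlier credits persist: a union only
      grows, and a best weight only increases.\<close>
    have st: "tag (ns ! c) = 0 \<longleftrightarrow> tag c0 = 0"
      by (rule kids_same_tag[OF S kid c0]) (use c j in auto)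
    show ?thesis
    proof (cases "tag c0 = 0")
      case True
      then have "R p \<subseteq> R' p" using P by blast
      then have "wt (R p \<inter> vset (ns ! c)) \<le> wt (R' p \<inter> vset (ns ! c))"
        using fin' by (intro wt_mono) auto
      then show ?thesis using d st True by (auto simp: credited_def)
    next
      case False
      then show ?thesis using d st P by (auto simp: credited_def)
    qed
  qed
  have unprocessed: "R' p \<inter> vset (ns ! c) = {}"
    if c: "0 < c" "c < j" "c < length ns" "parent (ns ! c) = p" "tag (ns ! c) = 0" for c
  proof -
    have st: "tag (ns ! c) = 0 \<longleftrightarrow> tag c0 = 0"
      by (rule kids_same_tag[OF S kid c0]) (use c in auto)
    then have t0: "tag c0 = 0" using c by simp
    have "vset (ns ! c) \<inter> vset (ns ! j) = {}"
      using treeD(9)[OF T c(1,2) j(2) c(5)] t0 c(4) unfolding p_def c0_def by blast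
    then have "R j \<inter> vset (ns ! c) = {}" using base(1)[OF j(2)] by blast
    moreover have "R p \<inter> vset (ns ! c) = {}" using todo[OF p(2) c(1) _ c(4,5)] c(2) by simp
    ultimately show ?thesis using P t0 by blast
  qed
  show ?thesis
  proof (rule resultsI)
    fix i assume i: "i < length ns"
    show "R' i \<subseteq> vset (ns ! i)" "indep (R' i)" "W' i = wt (R' i)"
      using P base(1-3)[OF i] other[of i] by (cases "i = p"; simp)+
    fix c assume c: "0 < c" "c < length ns" "parent (ns ! c) = i"
    show "credited (ns ! c) (R' i) (W' i)" if "j \<le> c"
    proof (cases "i = p")
      case True
      show ?thesis using processed[OF that c(2)] c(3) unfolding True by blast
    next
      case False
      have "j \<noteq> c" using False c(3) unfolding p_def c0_def by blast
      then show ?thesis unfolding other[OF False] using reported[OF i _ c(2,3)] that by simp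
    qed
    show "R' i \<inter> vset (ns ! c) = {}" if "c < j" "tag (ns ! c) = 0"
    proof (cases "i = p")
      case True
      show ?thesis using unprocessed[OF c(1) that(1) c(2) _ that(2)] c(3) unfolding True by blast
    next
      case False
      show ?thesis unfolding other[OF False] using todo[OF i c(1) _ c(3) that(2)] that(1) by simp
    qed
  qed
qed

end

section \<open>Cost and correctness of programs\<close>

text \<open>
  An upper bound for the running time when no loop makes more than \<open>N\<close> iterations at a time.  It is
  polynomial in \<open>N\<close>, and \<open>N\<close> will be exponential in the budget, so a single crude \<open>N\<close> for all loops
  changes only the constant in the exponent.
\<close>

primrec loop_cost :: "nat \<Rightarrow> prog \<Rightarrow> nat" where
  "loop_cost N Skip = 1"
| "loop_cost N (Store a e f) = 1 + ncost e + ncost f"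
| "loop_cost N (RStore r e) = 1 + rcost e"
| "loop_cost N (Seq P Q) = loop_cost N P + loop_cost N Q"
| "loop_cost N (Cond b P Q) = bcost b + loop_cost N P + loop_cost N Q"
| "loop_cost N (Loop b P) = bcost b + N * (bcost b + loop_cost N P)"

definition poly_bounded :: "(nat \<Rightarrow> nat) \<Rightarrow> bool" where
  "poly_bounded f \<longleftrightarrow> (\<exists>A d. \<forall>N. f N \<le> A * (N + 1) ^ d)"

lemma poly_bounded_const: "poly_bounded (\<lambda>_. c)"
  unfolding poly_bounded_def by (intro exI[of _ c] exI[of _ 0]) simp

lemma poly_bounded_id: "poly_bounded (\<lambda>N. N)"
  unfolding poly_bounded_def by (intro exI[of _ 1]) simp

lemma poly_bounded_mult:
  assumes "poly_bounded f" "poly_bounded g" shows "poly_bounded (\<lambda>N. f N * g N)"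
proof -
  obtain A d B e where "\<And>N. f N \<le> A * (N + 1) ^ d" "\<And>N. g N \<le> B * (N + 1) ^ e"
    using assms unfolding poly_bounded_def by blast
  then have "f N * g N \<le> (A * (N + 1) ^ d) * (B * (N + 1) ^ e)" for N by (rule mult_le_mono)
  then have "f N * g N \<le> (A * B) * (N + 1) ^ (d + e)" for N by (simp add: power_add mult_ac)
  then show ?thesis unfolding poly_bounded_def by blast
qed

lemma poly_bounded_add:
  assumes "poly_bounded f" "poly_bounded g" shows "poly_bounded (\<lambda>N. f N + g N)"
proof -
  obtain A d B e where AB: "\<And>N. f N \<le> A * (N + 1) ^ d" "\<And>N. g N \<le> B * (N + 1) ^ e"
    using assms unfolding poly_bounded_def by blast
  have "f N + g N \<le> A * (N + 1) ^ (d + e) + B * (N + 1) ^ (d + e)" for N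
    by (intro add_mono order.trans[OF AB(1)] order.trans[OF AB(2)] mult_le_mono2 power_increasing) auto
  then show ?thesis unfolding poly_bounded_def distrib_right[symmetric] by blast
qed

lemma poly_bounded_loop_cost: "poly_bounded (\<lambda>N. loop_cost N P)"
  by (induction P) (simp_all only: loop_cost.simps,
    (intro poly_bounded_add poly_bounded_mult poly_bounded_const poly_bounded_id; assumption)+)

text \<open>Termination, cost and postcondition in one judgement. The cost bound is read off the
  program text, so a proof only has to control numbers of iterations.\<close>

definition runs :: "nat \<Rightarrow> prog \<Rightarrow> memory \<Rightarrow> (memory \<Rightarrow> bool) \<Rightarrow> bool" where
  "runs N P m Q \<longleftrightarrow> (\<exists>T m'. exec P m T m' \<and> T \<le> loop_cost N P \<and> Q m')"

definition upd :: "nat \<Rightarrow> nat \<Rightarrow> nat \<Rightarrow> memory \<Rightarrow> memory" where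
  "upd a i v m = ((fst m)(a := (fst m a)(i := v)), snd m)"

lemma fst_upd [simp]: "fst (upd a i v m) b = (if b = a then (fst m a)(i := v) else fst m b)"
  by (simp add: upd_def)

lemma snd_upd [simp]: "snd (upd a i v m) = snd m"
  by (simp add: upd_def)

lemma runs_mono: "runs N P m Q \<Longrightarrow> (\<And>m'. Q m' \<Longrightarrow> R m') \<Longrightarrow> runs N P m R"
  unfolding runs_def by blast

lemma runs_Skip: "Q m \<Longrightarrow> runs N Skip m Q"
  unfolding runs_def by (intro exI[of _ 1] exI[of _ m] conjI exec.Skip) auto

lemma runs_Store: "Q (upd a (nval e m) (nval f m) m) \<Longrightarrow> runs N (Store a e f) m Q"
  unfolding runs_def upd_def using exec.Store[of a e f m] by auto

lemma runs_RStore: "Q (fst m, (snd m)(r := rval e m)) \<Longrightarrow> runs N (RStore r e) m Q"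
  unfolding runs_def using exec.RStore[of r e m] by auto

lemma runs_Seq: "runs N P m (\<lambda>m'. runs N P' m' Q) \<Longrightarrow> runs N (Seq P P') m Q"
  unfolding runs_def by (fastforce intro: exec.Seq add_mono)

lemma runs_Cond:
  assumes "bval b m \<Longrightarrow> runs N P m Q" "\<not> bval b m \<Longrightarrow> runs N P' m Q"
  shows "runs N (Cond b P P') m Q"
proof (cases "bval b m")
  case True
  then obtain T m' where "exec P m T m'" "T \<le> loop_cost N P" "Q m'" using assms unfolding runs_def by blast
  then show ?thesis unfolding runs_def using exec.CondT[OF True, of P T m' P'] by (intro exI conjI) auto
next
  case False
  then obtain T m' where "exec P' m T m'" "T \<le> loop_cost N P'" "Q m'" using assms unfolding runs_def by blast
  then show ?thesis unfolding runs_def using exec.CondF[OF False, of P' T m' P] by (intro exI conjI) auto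
qed

text \<open>\<open>Inv\<close> carries the iteration count, from which \<open>i < N\<close> must
  follow; the difference \<open>N - i\<close> then measures both termination and remaining
  cost.\<close>

lemma runs_Loop:
  assumes "Inv 0 m"
    and step: "\<And>i m. Inv i m \<Longrightarrow> bval b m \<Longrightarrow> i < N \<and> runs N P m (Inv (Suc i))"
    and "\<And>i m. Inv i m \<Longrightarrow> \<not> bval b m \<Longrightarrow> Q m"
  shows "runs N (Loop b P) m Q"
proof -
  have "\<exists>T m'. exec (Loop b P) m T m' \<and> T \<le> bcost b + (N - i) * (bcost b + loop_cost N P) \<and> Q m'"
    if "Inv i m" for i m
    using that
  proof (induction "N - i" arbitrary: i m rule: less_induct)
    case less
    show ?case
    proof (cases "bval b m")
      case False
      then show ?thesis using exec.LoopF[OF False, of P] assms(3) less.prems by fastforce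
    next
      case True
      from step[OF less.prems True] obtain S m1 where
        i: "i < N" and S: "exec P m S m1" "S \<le> loop_cost N P" "Inv (Suc i) m1" unfolding runs_def by blast
      have "N - Suc i < N - i" using i by simp
      from less.hyps[OF this S(3)] obtain T m2 where
        T: "exec (Loop b P) m1 T m2" "T \<le> bcost b + (N - Suc i) * (bcost b + loop_cost N P)" "Q m2" by blast
      have "N - i = Suc (N - Suc i)" using i by simp
      then have "bcost b + S + T \<le> bcost b + (N - i) * (bcost b + loop_cost N P)" using S(2) T(2) by simp
      then show ?thesis using exec.LoopT[OF True S(1) T(1)] T(3) by blast
    qed
  qed
  from this[OF assms(1)] show ?thesis unfolding runs_def by simp
qed

abbreviation V :: "nat \<Rightarrow> nexp" where "V a \<equiv> Load a (Const 0)"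
abbreviation Assign :: "nat \<Rightarrow> nexp \<Rightarrow> prog" where "Assign a e \<equiv> Store a (Const 0) e"

definition For :: "nat \<Rightarrow> prog \<Rightarrow> prog" where
  "For x P = Seq (Assign x (Const 0))
     (Loop (Less (V x) (V 0)) (Seq P (Assign x (Add (V x) (Const 1)))))"

lemma runs_For:
  assumes n: "fst m 0 0 = n" "n \<le> N" "x \<noteq> 0"
    and init: "Inv 0 (upd x 0 0 m)"
    and step: "\<And>i m. i < n \<Longrightarrow> Inv i m \<Longrightarrow> fst m 0 0 = n \<Longrightarrow> fst m x 0 = i \<Longrightarrow>
      runs N P m (\<lambda>m'. fst m' 0 0 = n \<and> fst m' x 0 = i \<and> Inv (Suc i) (upd x 0 (Suc i) m'))"
    and post: "\<And>m. Inv n m \<Longrightarrow> Q m"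
  shows "runs N (For x P) m Q"
  unfolding For_def
proof (rule runs_Seq, rule runs_Store,
    rule runs_Loop[where Inv = "\<lambda>i m. i \<le> n \<and> fst m 0 0 = n \<and> fst m x 0 = i \<and> Inv i m"])
  show "0 \<le> n \<and> fst (upd x (nval (Const 0) m) (nval (Const 0) m) m) 0 0 = n \<and>
      fst (upd x (nval (Const 0) m) (nval (Const 0) m) m) x 0 = 0 \<and> Inv 0 (upd x (nval (Const 0) m) (nval (Const 0) m) m)"
    using n init by simp
next
  fix i m assume I: "i \<le> n \<and> fst m 0 0 = n \<and> fst m x 0 = i \<and> Inv i m" and "bval (Less (V x) (V 0)) m"
  then have i: "i < n" by simp
  have "runs N (Seq P (Assign x (Add (V x) (Const 1)))) m
      (\<lambda>m. Suc i \<le> n \<and> fst m 0 0 = n \<and> fst m x 0 = Suc i \<and> Inv (Suc i) m)"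
    by (rule runs_Seq, rule runs_mono[OF step[OF i]]) (use I i n in \<open>auto intro!: runs_Store\<close>)
  then show "i < N \<and> runs N (Seq P (Assign x (Add (V x) (Const 1)))) m
      (\<lambda>m. Suc i \<le> n \<and> fst m 0 0 = n \<and> fst m x 0 = Suc i \<and> Inv (Suc i) m)" using i n by simp
next
  fix i m assume "i \<le> n \<and> fst m 0 0 = n \<and> fst m x 0 = i \<and> Inv i m" "\<not> bval (Less (V x) (V 0)) m"
  moreover from this have "i = n" by simp
  ultimately show "Q m" using post by blast
qed

text \<open>Frame condition: only the arrays in \<open>M\<close> may differ. Real registers are not
  compared, since they are read only while \<open>1 / \<epsilon>\<close> is rounded.\<close>

definition agree :: "nat set \<Rightarrow> memory \<Rightarrow> memory \<Rightarrow> bool" where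
  "agree M m m' \<longleftrightarrow> (\<forall>a. a \<notin> M \<longrightarrow> fst m' a = fst m a)"

lemma agree_refl [simp]: "agree M m m"
  by (simp add: agree_def)

lemma agree_upd [simp]: "a \<in> M \<Longrightarrow> agree M m (upd a i v m') \<longleftrightarrow> agree M m m'"
  by (auto simp: agree_def)

lemma agreeD: "agree M m m' \<Longrightarrow> a \<notin> M \<Longrightarrow> fst m' a = fst m a"
  by (simp add: agree_def)

lemma agree_trans: "agree M m m' \<Longrightarrow> agree M' m' m'' \<Longrightarrow> M \<subseteq> M'' \<Longrightarrow> M' \<subseteq> M'' \<Longrightarrow> agree M'' m m''"
  unfolding agree_def by (metis subsetD)

section \<open>Expanding a node\<close>

text \<open>
  Memory layout: scalars are cells with index 0.  The \<open>i\<close>-th node of the tree owns the addresses from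
  \<open>i * (n + 1)\<close> on, which also serve as its name; array 4 holds the indicator function of its set,
  arrays 5, 6 and 7 its budget, parent and tag, arrays 10 and 11 its result and the weight of the result.
  Scalar 8 is the current node, scalar 9 the first free address, and scalar 18 the row of the adjacency
  matrix that belongs to the outer loop variable, since there is no multiplication.  Arrays from 12 on
  are scratch space.
\<close>

definition Emit :: "nexp \<Rightarrow> nexp \<Rightarrow> nexp \<Rightarrow> prog" where
  "Emit e k p = Seq (For 20 (Store 4 (Add (V 9) (V 20)) e))
     (Seq (Store 5 (V 9) k) (Seq (Store 6 (V 9) (V 8)) (Seq (Store 7 (V 9) p)
     (Assign 9 (Add (V 9) (Add (V 0) (Const 1)))))))"

definition In_cur :: "nexp \<Rightarrow> nexp" where
  "In_cur x = Load 4 (Add (V 8) x)"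

text \<open>The value \<open>n\<close>, which is not a vertex, signals the empty set.\<close>

definition Find_top :: prog where
  "Find_top = Seq (Assign 13 (V 0))
     (For 20 (Cond (Less (Const 0) (In_cur (V 20))) (Assign 13 (V 20)) Skip))"

definition Spread_row :: prog where
  "Spread_row = For 16 (Cond (Conj (Less (Const 0) (Load 12 (V 15)))
       (Conj (Less (Const 0) (In_cur (V 16))) (Less (Const 0) (Load 2 (Add (V 18) (V 16))))))
     (Store 12 (V 16) (Const 1)) Skip)"

definition Spread :: prog where
  "Spread = Seq (Assign 18 (Const 0)) (For 15 (Seq Spread_row (Assign 18 (Add (V 18) (V 0)))))"

definition Component :: prog where
  "Component = Seq (For 20 (Store 12 (V 20) (Const 0))) (Seq (Store 12 (V 13) (Const 1)) (For 17 Spread))"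

definition Check_split :: prog where
  "Check_split = Seq (Assign 14 (Const 0))
     (For 20 (Cond (Conj (Less (Const 0) (In_cur (V 20))) (Less (Load 12 (V 20)) (Const 1)))
       (Assign 14 (Const 1)) Skip))"

definition Split :: prog where
  "Split = Seq (Emit (Load 12 (V 20)) (Load 5 (V 8)) (Const 0))
     (Emit (Sub (In_cur (V 20)) (Load 12 (V 20))) (Load 5 (V 8)) (Const 0))"

text \<open>At most one of the truncated differences is positive, and both vanish exactly for equal
  arguments.\<close>

definition Eq01 :: "nexp \<Rightarrow> nexp \<Rightarrow> nexp" where
  "Eq01 x y = Sub (Const 1) (Add (Sub x y) (Sub y x))"

lemma nval_Eq01 [simp]: "nval (Eq01 x y) m = of_bool (nval x m = nval y m)"
  by (auto simp: Eq01_def)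

text \<open>Truncated subtraction of 0/1 values acts as set difference, which yields the indicator
  of \<open>S - nbh v\<close> without a test.\<close>

definition Branch :: prog where
  "Branch = Seq (Assign 18 (Const 0)) (For 19
     (Seq (Cond (Less (Const 0) (In_cur (V 19))) (Assign 24 (Add (V 19) (Const 2))) (Assign 24 (Const 1)))
     (Seq (Emit (Sub (Sub (In_cur (V 20)) (Load 2 (Add (V 18) (V 20)))) (Eq01 (V 20) (V 19)))
            (Sub (Load 5 (V 8)) (Const 1)) (V 24))
     (Assign 18 (Add (V 18) (V 0))))))"

definition Count_deg :: prog where
  "Count_deg = Seq (Assign 21 (Const 0))
     (For 20 (Cond (Conj (Less (Const 0) (In_cur (V 20))) (Less (Const 0) (Load 2 (Add (V 18) (V 20)))))
       (Assign 21 (Add (V 21) (Const 1))) Skip))"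

definition Max_deg :: prog where
  "Max_deg = Seq (Assign 18 (Const 0)) (Seq (Assign 22 (Const 0)) (Seq (Assign 23 (Const 0))
     (For 19 (Seq (Cond (Less (Const 0) (In_cur (V 19)))
         (Seq Count_deg (Cond (Less (V 21) (V 22)) Skip (Seq (Assign 22 (V 21)) (Assign 23 (V 19))))) Skip)
       (Assign 18 (Add (V 18) (V 0)))))))"

definition Exclude :: prog where
  "Exclude = Emit (Sub (In_cur (V 20)) (Eq01 (V 20) (V 23))) (Load 5 (V 8)) (Const 1)"

definition Expand :: prog where
  "Expand = Seq Find_top (Seq
     (Cond (Conj (Less (V 13) (V 0)) (Less (Const 0) (Load 5 (V 8))))
       (Seq Component (Seq Check_split
         (Cond (Less (Const 0) (V 14)) Split (Seq Branch (Seq Max_deg Exclude)))))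
       Skip)
     (Assign 8 (Add (V 8) (Add (V 0) (Const 1)))))"

context wgraph begin

definition static :: "memory \<Rightarrow> bool" where
  "static m \<longleftrightarrow> fst m 0 0 = n \<and> (\<forall>i<n. fst m 1 i = w i) \<and>
     (\<forall>i<n. \<forall>j<n. fst m 2 (i * n + j) = of_bool (E i j))"

definition nodes :: "node list \<Rightarrow> memory \<Rightarrow> bool" where
  "nodes ns m \<longleftrightarrow> fst m 9 0 = length ns * Suc n \<and> (\<forall>i<length ns.
     (\<forall>v<n. fst m 4 (i * Suc n + v) = of_bool (v \<in> vset (ns ! i))) \<and>
     fst m 5 (i * Suc n) = budget (ns ! i) \<and>
     fst m 6 (i * Suc n) = parent (ns ! i) * Suc n \<and>
     fst m 7 (i * Suc n) = tag (ns ! i))"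

lemma static_agree: "static m \<Longrightarrow> agree M m m' \<Longrightarrow> 0 \<notin> M \<Longrightarrow> 1 \<notin> M \<Longrightarrow> 2 \<notin> M \<Longrightarrow> static m'"
  by (simp add: static_def agree_def)

lemma nodes_agree:
  "nodes ns m \<Longrightarrow> agree M m m' \<Longrightarrow> 4 \<notin> M \<Longrightarrow> 5 \<notin> M \<Longrightarrow> 6 \<notin> M \<Longrightarrow> 7 \<notin> M \<Longrightarrow> 9 \<notin> M \<Longrightarrow> nodes ns m'"
  by (simp add: nodes_def agree_def)

lemma index_less: "h < l \<Longrightarrow> x < Suc n \<Longrightarrow> h * Suc n + x < l * Suc n"
proof -
  assume "h < l" "x < Suc n"
  then have "h * Suc n + x < Suc h * Suc n" by simp
  also have "\<dots> \<le> l * Suc n" using \<open>h < l\<close> by (intro mult_le_mono1) simp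
  finally show ?thesis .
qed

text \<open>The expressions are evaluated amid the writing, so their hypotheses quantify over the
  memories possible at that moment: \<open>e\<close> may rely on array 4 only below the first free
  address, and \<open>p\<close> is read after arrays 5 and 6 have changed.\<close>

lemma runs_Emit:
  assumes N: "n \<le> N" and m: "fst m 0 0 = n" "nodes ns m" "fst m 8 0 = parent c * Suc n"
    and e: "\<And>m' x. x < n \<Longrightarrow> agree {4, 20} m m' \<Longrightarrow> (\<And>j. j < length ns * Suc n \<Longrightarrow> fst m' 4 j = fst m 4 j) \<Longrightarrow>
      fst m' 20 0 = x \<Longrightarrow> nval e m' = of_bool (x \<in> vset c)"
    and k: "\<And>m'. agree {4, 20} m m' \<Longrightarrow> nval k m' = budget c"
    and p: "\<And>m'. agree {4, 5, 6, 20} m m' \<Longrightarrow> nval p m' = tag c"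
  shows "runs N (Emit e k p) m (\<lambda>m'. nodes (ns @ [c]) m' \<and> agree {4, 5, 6, 7, 9, 20} m m')"
  unfolding Emit_def
proof (rule runs_Seq, rule runs_For[where Inv = "\<lambda>i m'. agree {4, 20} m m' \<and>
      (\<forall>j<length ns * Suc n. fst m' 4 j = fst m 4 j) \<and>
      (\<forall>v<i. fst m' 4 (length ns * Suc n + v) = of_bool (v \<in> vset c))", OF m(1) N], goal_cases)
  case 1
  show ?case by simp
next
  case 2
  show ?case by simp
next
  case (3 i m')
  have F: "fst m' 9 0 = length ns * Suc n" using 3(2) m(2) agreeD[of "{4, 20}" m m' 9] by (simp add: nodes_def)
  have v: "nval e m' = of_bool (i \<in> vset c)" using 3 by (intro e) auto
  show ?case
    by (rule runs_Store) (use 3 F v in \<open>auto simp: less_Suc_eq\<close>)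
next
  case (4 m')
  let ?F = "length ns * Suc n"
  have F: "fst m' 9 0 = ?F" "fst m' 8 0 = parent c * Suc n" "fst m' 0 0 = n"
    using 4 m agreeD[of "{4, 20}" m m'] by (simp_all add: nodes_def)
  have kv: "nval k m' = budget c" using 4 by (intro k) auto
  define m1 where "m1 = upd 6 ?F (parent c * Suc n) (upd 5 ?F (budget c) m')"
  have "agree {4, 5, 6, 20} m m1" unfolding m1_def using 4 by (auto simp: agree_def)
  then have pv: "nval p m1 = tag c" by (rule p)
  define m2 where "m2 = upd 9 0 (?F + Suc n) (upd 7 ?F (tag c) m1)"
  have "nodes (ns @ [c]) m2"
    unfolding nodes_def
  proof (intro conjI allI impI)
    show "fst m2 9 0 = length (ns @ [c]) * Suc n" by (simp add: m2_def)
    fix i assume i: "i < length (ns @ [c])"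
    have old: "i * Suc n + v < ?F" if "i < length ns" "v < Suc n" for v using index_less that by blast
    have ag: "fst m' a = fst m a" if "a \<in> {5, 6, 7}" for a using 4 that agreeD[of "{4, 20}" m m' a] by auto
    show "fst m2 4 (i * Suc n + v) = of_bool (v \<in> vset ((ns @ [c]) ! i))" if "v < n" for v
      using i that 4 m(2) old[of v] by (cases "i < length ns") (auto simp: m2_def m1_def nodes_def nth_append less_Suc_eq)
    have ne: "i * Suc n \<noteq> ?F" if "i < length ns" using old[OF that, of 0] by simp
    have il: "i = length ns" if "\<not> i < length ns" using i that by simp
    show "fst m2 5 (i * Suc n) = budget ((ns @ [c]) ! i)"
      "fst m2 6 (i * Suc n) = parent ((ns @ [c]) ! i) * Suc n"
      "fst m2 7 (i * Suc n) = tag ((ns @ [c]) ! i)"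
      using m(2) ne il by (cases "i < length ns"; simp add: m2_def m1_def nodes_def nth_append ag del: mult_Suc_right)+
  qed
  moreover have "agree {4, 5, 6, 7, 9, 20} m m2"
    using 4 by (auto simp: m2_def m1_def agree_def)
  ultimately have fin: "nodes (ns @ [c]) m2 \<and> agree {4, 5, 6, 7, 9, 20} m m2" by blast
  show ?case
    apply (rule runs_Seq, rule runs_Store, rule runs_Seq, rule runs_Store, rule runs_Seq, rule runs_Store, rule runs_Store)
    using fin pv unfolding m2_def m1_def by (simp add: F kv del: mult_Suc_right)
qed


text \<open>The part of \<open>static\<close> and \<open>nodes\<close> that a scan of one node
  reads; it keeps the node list out of the lemmas about scans.\<close>

definition cur :: "nat set \<Rightarrow> memory \<Rightarrow> bool" where
  "cur S m \<longleftrightarrow> fst m 0 0 = n \<and> (\<forall>i<n. \<forall>j<n. fst m 2 (i * n + j) = of_bool (E i j)) \<and>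
     (\<forall>v<n. fst m 4 (fst m 8 0 + v) = of_bool (v \<in> S))"

lemma cur_agree: "cur S m \<Longrightarrow> agree M m m' \<Longrightarrow> 0 \<notin> M \<Longrightarrow> 2 \<notin> M \<Longrightarrow> 4 \<notin> M \<Longrightarrow> 8 \<notin> M \<Longrightarrow> cur S m'"
  by (simp add: cur_def agree_def)

lemma nodes_cur:
  assumes "static m" "nodes ns m" "fst m 8 0 = h * Suc n" "h < length ns"
  shows "cur (vset (ns ! h)) m"
  using assms by (simp add: cur_def static_def nodes_def)

lemma cur_in [simp]: "cur S m \<Longrightarrow> nval x m < n \<Longrightarrow> nval (In_cur x) m = of_bool (nval x m \<in> S)"
  by (simp add: cur_def In_cur_def)

lemma runs_Find_top:
  assumes N: "n \<le> N" and m: "cur S m" "S \<subseteq> {..<n}"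
  shows "runs N Find_top m (\<lambda>m'. agree {13, 20} m m' \<and> fst m' 13 0 = (if S = {} then n else Max S))"
  unfolding Find_top_def
proof (rule runs_Seq, rule runs_Store, rule runs_For[where n = n and Inv = "\<lambda>i m'. agree {13, 20} m m' \<and>
    fst m' 13 0 = (if S \<inter> {..<i} = {} then n else Max (S \<inter> {..<i}))"], goal_cases)
  case (5 i m')
  have c: "cur S m'" using cur_agree[OF m(1) conjunct1[OF 5(2)]] by simp
  have top: "S \<inter> {..<Suc i} = (if i \<in> S then insert i (S \<inter> {..<i}) else S \<inter> {..<i})"
    by (auto simp: less_Suc_eq)
  have "Max (insert i (S \<inter> {..<i})) = i" by (rule Max_eqI) auto
  then show ?case
    by (intro runs_Cond runs_Store runs_Skip) (use 5 c in \<open>auto simp: top\<close>)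
next
  case (6 m')
  moreover have "S \<inter> {..<n} = S" using m by blast
  ultimately show ?case by simp
qed (use N m in \<open>auto simp: cur_def\<close>)

definition marked :: "nat set \<Rightarrow> memory \<Rightarrow> bool" where
  "marked A m \<longleftrightarrow> (\<forall>v<n. fst m 12 v = of_bool (v \<in> A))"

lemma marked_agree: "marked A m \<Longrightarrow> agree M m m' \<Longrightarrow> 12 \<notin> M \<Longrightarrow> marked A m'"
  by (simp add: marked_def agree_def)

lemma runs_Spread_row:
  assumes N: "n \<le> N" and m: "cur S m" "S \<subseteq> {..<n}" "marked A m" "A \<subseteq> reach S u" "u \<in> S"
    and a: "fst m 15 0 = a" "a < n" "fst m 18 0 = a * n"
  shows "runs N Spread_row m (\<lambda>m'. agree {12, 16} m m' \<and> (\<exists>A'. marked A' m' \<and> A \<subseteq> A' \<and> A' \<subseteq> reach S u \<and>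
    (a \<in> A \<longrightarrow> (\<forall>b\<in>S. E a b \<longrightarrow> b \<in> A'))))"
  unfolding Spread_row_def
proof (rule runs_For[where n = n and Inv = "\<lambda>i m'. agree {12, 16} m m' \<and> (\<exists>A'. marked A' m' \<and> A \<subseteq> A' \<and> A' \<subseteq> reach S u \<and>
    (a \<in> A \<longrightarrow> (\<forall>b\<in>S. b < i \<longrightarrow> E a b \<longrightarrow> b \<in> A')))"], goal_cases)
  case (5 i m')
  then obtain A' where A': "marked A' m'" "A \<subseteq> A'" "A' \<subseteq> reach S u" "a \<in> A \<longrightarrow> (\<forall>b\<in>S. b < i \<longrightarrow> E a b \<longrightarrow> b \<in> A')" by blast
  have c: "cur S m'" using cur_agree[OF m(1) conjunct1[OF 5(2)]] by simp
  have e: "fst m' 15 0 = a" "fst m' 18 0 = a * n" using 5 a agreeD[of "{12,16}" m m'] by auto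
  let ?b = "bval (Conj (Less (Const 0) (Load 12 (V 15)))
       (Conj (Less (Const 0) (In_cur (V 16))) (Less (Const 0) (Load 2 (Add (V 18) (V 16)))))) m'"
  have b: "?b \<longleftrightarrow> a \<in> A' \<and> i \<in> S \<and> E a i"
    using c 5(1,4) e a(2) A'(1) by (auto simp: marked_def cur_def In_cur_def)
  show ?case
  proof (rule runs_Cond, goal_cases)
    case 1
    then have ai: "a \<in> A'" "i \<in> S" "E a i" using b by auto
    then have "i \<in> reach S u" using reach_closed[OF m(5), of a i] A'(3) by blast
    moreover have "marked (insert i A') (upd 16 0 (Suc i) (upd 12 i 1 m'))" using A'(1) by (simp add: marked_def)
    ultimately show ?case
      by (intro runs_Store) (use 5 A' in \<open>auto simp: less_Suc_eq intro!: exI[of _ "insert i A'"]\<close>)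
  next
    case 2
    then have "\<not> (a \<in> A' \<and> i \<in> S \<and> E a i)" using b by blast
    moreover have "marked A' (upd 16 0 (Suc i) m')" using A'(1) by (simp add: marked_def)
    ultimately show ?case
      by (intro runs_Skip) (use 5 A' in \<open>auto simp: less_Suc_eq intro!: exI[of _ A']\<close>)
  qed
next
  case 4
  have "marked A (upd 16 0 0 m)" using m by (simp add: marked_def)
  then show ?case using m by auto
next
  case (6 m')
  then show ?case using m(2) by blast
qed (use N m in \<open>auto simp: cur_def\<close>)

text \<open>New marks may spread further within the same sweep, so the result is only bracketed: at
  least all neighbours of the old marks, at most the component.\<close>

lemma runs_Spread:
  assumes N: "n \<le> N" and m: "cur S m" "S \<subseteq> {..<n}" "marked A m" "A \<subseteq> reach S u" "u \<in> S"
  shows "runs N Spread m (\<lambda>m'. agree {12, 15, 16, 18} m m' \<and> (\<exists>A'. marked A' m' \<and> A \<subseteq> A' \<and> A' \<subseteq> reach S u \<and>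
    (\<forall>a\<in>A. \<forall>b\<in>S. E a b \<longrightarrow> b \<in> A')))"
  unfolding Spread_def
proof (rule runs_Seq, rule runs_Store, rule runs_For[where n = n and Inv = "\<lambda>i m'. agree {12, 15, 16, 18} m m' \<and>
    fst m' 18 0 = i * n \<and> (\<exists>A'. marked A' m' \<and> A \<subseteq> A' \<and> A' \<subseteq> reach S u \<and>
    (\<forall>a\<in>A. a < i \<longrightarrow> (\<forall>b\<in>S. E a b \<longrightarrow> b \<in> A')))"], goal_cases)
  case 4
  have "marked A (upd 15 0 0 (upd 18 0 0 m))" using m by (simp add: marked_def)
  then show ?case using m by auto
next
  case (5 i m')
  then obtain A' where A': "marked A' m'" "A \<subseteq> A'" "A' \<subseteq> reach S u" "\<forall>a\<in>A. a < i \<longrightarrow> (\<forall>b\<in>S. E a b \<longrightarrow> b \<in> A')" by blast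
  have c: "cur S m'" using cur_agree[OF m(1) conjunct1[OF 5(2)]] by simp
  show ?case
  proof (rule runs_Seq, rule runs_mono[OF runs_Spread_row[OF N c m(2) A'(1,3) m(5) 5(4,1)]], goal_cases)
    case 1
    then show ?case using 5 by simp
  next
    case (2 m'')
    then obtain A'' where A'': "marked A'' m''" "A' \<subseteq> A''" "A'' \<subseteq> reach S u" "i \<in> A' \<longrightarrow> (\<forall>b\<in>S. E i b \<longrightarrow> b \<in> A'')" by blast
    have e: "fst m'' 18 0 = i * n" "fst m'' 15 0 = i" "fst m'' 0 0 = n"
      using 2 5 agreeD[of "{12, 16}" m' m''] by auto
    have ag: "agree {12, 15, 16, 18} m m''" by (rule agree_trans[OF conjunct1[OF 5(2)] conjunct1[OF 2]]) auto
    have mk: "marked A'' (upd 15 0 (Suc i) (upd 18 0 (i * n + n) m''))" using A'' by (simp add: marked_def)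
    have "\<forall>a\<in>A. a < Suc i \<longrightarrow> (\<forall>b\<in>S. E a b \<longrightarrow> b \<in> A'')"
      using A'' A' by (auto simp: less_Suc_eq)
    moreover have "A \<subseteq> A''" using A' A'' by blast
    ultimately show ?case
      by (intro runs_Store) (use e ag mk A'' in \<open>auto simp: add.commute\<close>)
  qed
next
  case (6 m')
  have "A \<subseteq> {..<n}" using m reach_subset by blast
  then show ?case using 6 by blast
qed (use N m in \<open>auto simp: cur_def\<close>)

text \<open>A sweep over a marked set that is not yet closed adds a vertex, so \<open>n\<close>
  sweeps suffice. A closed set of marks that contains \<open>u\<close> and stays inside the
  component is the whole component.\<close>

lemma runs_Component:
  assumes N: "n \<le> N" and m: "cur S m" "S \<subseteq> {..<n}" "u \<in> S" "fst m 13 0 = u"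
  shows "runs N Component m (\<lambda>m'. agree {12, 15, 16, 17, 18, 20} m m' \<and> marked (reach S u) m')"
  unfolding Component_def
proof (rule runs_Seq, rule runs_For[where n = n and Inv = "\<lambda>i m'. agree {12, 20} m m' \<and> (\<forall>v<i. fst m' 12 v = 0)"], goal_cases)
  case (5 i m')
  then show ?case by (intro runs_Store) (auto simp: less_Suc_eq)
next
  case (6 m1)
  define m2 where "m2 = upd 12 u 1 m1"
  have ag2: "agree {12, 20} m m2" using 6 by (simp add: m2_def)
  have c2: "cur S m2" using cur_agree[OF m(1) ag2] by simp
  have mk2: "marked {u} m2" using 6 by (simp add: m2_def marked_def)
  have u13: "fst m1 13 0 = u" using 6 m agreeD[of "{12, 20}" m m1 13] by simp
  have fin: "finite S" using m fin_verts by blast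
  define closed where "closed A \<longleftrightarrow> (\<forall>a\<in>A. \<forall>b\<in>S. E a b \<longrightarrow> b \<in> A)" for A
  have closed_reach: "A = reach S u" if "closed A" "u \<in> A" "A \<subseteq> reach S u" for A
    using that reach_least[of u A S] unfolding closed_def by blast
  have "runs N (For 17 Spread) m2 (\<lambda>m'. agree {12, 15, 16, 17, 18} m2 m' \<and> marked (reach S u) m')"
  proof (rule runs_For[where n = n and Inv = "\<lambda>i m'. agree {12, 15, 16, 17, 18} m2 m' \<and>
      (\<exists>A. marked A m' \<and> u \<in> A \<and> A \<subseteq> reach S u \<and> (closed A \<or> i < card A))"], goal_cases)
    case 4
    have "marked {u} (upd 17 0 0 m2)" using mk2 by (simp add: marked_def)
    then show ?case using reach_self by (auto intro!: exI[of _ "{u}"])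
  next
    case (5 i m')
    then obtain A where A: "marked A m'" "u \<in> A" "A \<subseteq> reach S u" "closed A \<or> i < card A" by blast
    have c: "cur S m'" using cur_agree[OF c2 conjunct1[OF 5(2)]] by simp
    show ?case
    proof (rule runs_mono[OF runs_Spread[OF N c m(2) A(1,3) m(3)]], goal_cases)
      case (1 m'')
      then obtain A' where A': "marked A' m''" "A \<subseteq> A'" "A' \<subseteq> reach S u" "\<forall>a\<in>A. \<forall>b\<in>S. E a b \<longrightarrow> b \<in> A'" by blast
      have e: "fst m'' 0 0 = n" "fst m'' 17 0 = i" using 1 5 agreeD[of "{12, 15, 16, 18}" m' m''] by auto
      have ag: "agree {12, 15, 16, 17, 18} m2 m''" by (rule agree_trans[OF conjunct1[OF 5(2)] conjunct1[OF 1]]) auto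
      have mk: "marked A' (upd 17 0 (Suc i) m'')" using A' by (simp add: marked_def)
      have "closed A' \<or> Suc i < card A'"
      proof (cases "closed A")
        case True
        then have "A = reach S u" using A closed_reach by blast
        then have "A' = A" using A' by blast
        then show ?thesis using True by blast
      next
        case False
        then obtain b where "b \<in> A'" "b \<notin> A" using A' unfolding closed_def by blast
        then have "A \<subset> A'" using A' by blast
        moreover have "finite A'" by (rule finite_subset[OF order.trans[OF A'(3) reach_subset[OF m(3)]] fin])
        ultimately have "card A < card A'" using psubset_card_mono[of A' A] by simp
        then show ?thesis using A(4) False by linarith
      qed
      moreover have "u \<in> A'" using A'(2) A(2) by blast
      moreover have "agree {12, 15, 16, 17, 18} m2 (upd 17 0 (Suc i) m'')" using ag by simp
      ultimately show ?case using e mk A'(3) by blast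
    qed
  next
    case (6 m')
    then obtain A where A: "marked A m'" "u \<in> A" "A \<subseteq> reach S u" "closed A \<or> n < card A" by blast
    have "A \<subseteq> {..<n}" using A(3) reach_subset[OF m(3)] m(2) by blast
    then have "card A \<le> n" using card_mono[of "{..<n}" A] by simp
    then have "closed A" using A(4) by linarith
    then have "A = reach S u" using A(2,3) by (rule closed_reach)
    then show ?case using A(1) 6 by blast
  qed (use N c2 in \<open>auto simp: cur_def\<close>)
  then have "runs N (For 17 Spread) m2 (\<lambda>m'. agree {12, 15, 16, 17, 18, 20} m m' \<and> marked (reach S u) m')"
    by (rule runs_mono) (auto intro: agree_trans[OF ag2])
  then show ?case
    by (intro runs_Seq runs_Store) (simp add: u13 m2_def)
qed (use N m in \<open>auto simp: cur_def\<close>)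

lemma runs_Check_split:
  assumes N: "n \<le> N" and m: "cur S m" "S \<subseteq> {..<n}" "marked C m" "C \<subseteq> S"
  shows "runs N Check_split m (\<lambda>m'. agree {14, 20} m m' \<and> (0 < fst m' 14 0 \<longleftrightarrow> C \<noteq> S))"
  unfolding Check_split_def
proof (rule runs_Seq, rule runs_Store, rule runs_For[where n = n and Inv = "\<lambda>i m'. agree {14, 20} m m' \<and>
    (0 < fst m' 14 0 \<longleftrightarrow> (\<exists>x<i. x \<in> S \<and> x \<notin> C))"], goal_cases)
  case (5 i m')
  have c: "cur S m'" using cur_agree[OF m(1) conjunct1[OF 5(2)]] by simp
  have mk: "marked C m'" using marked_agree[OF m(3) conjunct1[OF 5(2)]] by simp
  show ?case
    by (intro runs_Cond runs_Store runs_Skip) (use 5 c mk in \<open>auto simp: less_Suc_eq marked_def\<close>)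
next
  case (6 m')
  then show ?case using m(2,4) by blast
qed (use N m in \<open>auto simp: cur_def\<close>)

lemma runs_Count_deg:
  assumes N: "n \<le> N" and m: "cur S m" "S \<subseteq> {..<n}" "v < n" "fst m 18 0 = v * n"
  shows "runs N Count_deg m (\<lambda>m'. agree {20, 21} m m' \<and> fst m' 21 0 = deg S v)"
  unfolding Count_deg_def
proof (rule runs_Seq, rule runs_Store, rule runs_For[where n = n and Inv = "\<lambda>i m'. agree {20, 21} m m' \<and>
    fst m' 21 0 = card {x \<in> S. E v x \<and> x < i}"], goal_cases)
  case (5 i m')
  have c: "cur S m'" using cur_agree[OF m(1) conjunct1[OF 5(2)]] by simp
  have e: "fst m' 18 0 = v * n" using 5 m agreeD[of "{20, 21}" m m' 18] by simp
  have "{x \<in> S. E v x \<and> x < Suc i} = (if i \<in> S \<and> E v i then insert i {x \<in> S. E v x \<and> x < i} else {x \<in> S. E v x \<and> x < i})"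
    by (auto simp: less_Suc_eq)
  then have cd: "card {x \<in> S. E v x \<and> x < Suc i} = card {x \<in> S. E v x \<and> x < i} + of_bool (i \<in> S \<and> E v i)"
    by (simp add: card_insert_if)
  have ad: "fst m' 2 (v * n + i) = of_bool (E v i)" using c 5(1) m(3) by (simp add: cur_def)
  show ?case
    by (intro runs_Cond runs_Store runs_Skip) (use 5 c e ad cd in auto)
next
  case (6 m')
  moreover have "{x \<in> S. E v x \<and> x < n} = {x \<in> S. E v x}" using m(2) by auto
  ultimately show ?case by (simp add: deg_def)
qed (use N m in \<open>auto simp: cur_def\<close>)

lemma runs_Max_deg:
  assumes N: "n \<le> N" and m: "cur S m" "S \<subseteq> {..<n}"
  shows "runs N Max_deg m (\<lambda>m'. agree {18, 19, 20, 21, 22, 23} m m' \<and> fst m' 23 0 = mdeg S)"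
  unfolding Max_deg_def
proof (rule runs_Seq, rule runs_Store, rule runs_Seq, rule runs_Store, rule runs_Seq, rule runs_Store,
    rule runs_For[where n = n and Inv = "\<lambda>i m'. agree {18, 19, 20, 21, 22, 23} m m' \<and>
    fst m' 18 0 = i * n \<and> fst m' 22 0 = fst (mscan S i) \<and> fst m' 23 0 = snd (mscan S i)"], goal_cases)
  case (5 i m')
  have c: "cur S m'" using cur_agree[OF m(1) conjunct1[OF 5(2)]] by simp
  let ?C = "Cond (Less (Const 0) (In_cur (V 19)))
         (Seq Count_deg (Cond (Less (V 21) (V 22)) Skip (Seq (Assign 22 (V 21)) (Assign 23 (V 19))))) Skip"
  have "runs N ?C m' (\<lambda>m''. agree {20, 21, 22, 23} m' m'' \<and>
    fst m'' 22 0 = fst (mscan S (Suc i)) \<and> fst m'' 23 0 = snd (mscan S (Suc i)))"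
  proof (rule runs_Cond, goal_cases)
    case 1
    then have iS: "i \<in> S" using c 5 by (simp split: if_splits)
    show ?case
    proof (rule runs_Seq, rule runs_mono[OF runs_Count_deg[OF N c m(2) 5(1)]], goal_cases)
      case 1
      then show ?case using 5 by simp
    next
      case (2 m'')
      have e: "fst m'' 22 0 = fst (mscan S i)" "fst m'' 23 0 = snd (mscan S i)" "fst m'' 19 0 = i"
        using 2 5 agreeD[of "{20, 21}" m' m''] by auto
      have "agree {20, 21, 22, 23} m' m''" using 2 by (auto simp: agree_def)
      then show ?case
        by (intro runs_Cond runs_Seq runs_Store runs_Skip) (use 2 e iS in auto)
    qed
  next
    case 2
    then have "i \<notin> S" using c 5 by (simp split: if_splits)
    then show ?case by (intro runs_Skip) (use 5 in auto)
  qed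
  then show ?case
  proof (rule runs_Seq[OF runs_mono], goal_cases)
    case (1 m'')
    have e: "fst m'' 18 0 = i * n" "fst m'' 19 0 = i" "fst m'' 0 0 = n"
      using 1 5 agreeD[of "{20, 21, 22, 23}" m' m''] by auto
    have "agree {18, 19, 20, 21, 22, 23} m m''" by (rule agree_trans[OF conjunct1[OF 5(2)] conjunct1[OF 1]]) auto
    then show ?case by (intro runs_Store) (use 1 e in \<open>auto simp del: mscan.simps\<close>)
  qed
qed (use N m in \<open>auto simp: cur_def mdeg_def\<close>)


section \<open>Writing the children of the current node\<close>

definition at_node :: "node list \<Rightarrow> nat \<Rightarrow> memory \<Rightarrow> bool" where
  "at_node ns h m \<longleftrightarrow> static m \<and> nodes ns m \<and> fst m 8 0 = h * Suc n \<and> h < length ns"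

lemma at_node_cur: "at_node ns h m \<Longrightarrow> cur (vset (ns ! h)) m"
  using nodes_cur by (simp add: at_node_def)

lemma at_node_budget: "at_node ns h m \<Longrightarrow> fst m 5 (fst m 8 0) = budget (ns ! h)"
  by (simp add: at_node_def nodes_def)

lemma at_node_agree:
  assumes "at_node ns h m" "agree M m m'" "\<forall>a\<in>{0, 1, 2, 4, 5, 6, 7, 8, 9}. a \<notin> M"
  shows "at_node ns h m'"
  using assms static_agree[of m M m'] nodes_agree[of ns m M m'] agreeD[of M m m' 8]
  by (simp add: at_node_def)

lemma at_node_emitted:
  assumes "at_node ns h m" "nodes (ns @ cs) m'" "agree M m m'" "\<forall>a\<in>{0, 1, 2, 8}. a \<notin> M"
  shows "at_node (ns @ cs) h m'"
  using assms static_agree[of m M m'] agreeD[of M m m' 8] by (simp add: at_node_def)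

text \<open>The block of the current node lies below the first free address and remains readable
  while the child is written, so \<open>e\<close> may be analysed under \<open>cur\<close>.\<close>

lemma runs_Emit_child:
  assumes N: "n \<le> N" and m: "at_node ns h m" and c: "parent c = h"
    and e: "\<And>m' x. x < n \<Longrightarrow> agree {4, 20} m m' \<Longrightarrow> cur (vset (ns ! h)) m' \<Longrightarrow>
      fst m' 20 0 = x \<Longrightarrow> nval e m' = of_bool (x \<in> vset c)"
    and k: "\<And>m'. agree {4, 20} m m' \<Longrightarrow> nval k m' = budget c"
    and p: "\<And>m'. agree {4, 5, 6, 20} m m' \<Longrightarrow> nval p m' = tag c"
  shows "runs N (Emit e k p) m (\<lambda>m'. at_node (ns @ [c]) h m' \<and> agree {4, 5, 6, 7, 9, 20} m m')"
proof (rule runs_mono[OF runs_Emit[where ns = ns and m = m and c = c, OF N _ _ _ _ k p]], goal_cases)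
  case (4 m' x)
  have "cur (vset (ns ! h)) m'" unfolding cur_def
  proof (intro conjI allI impI)
    have a: "fst m' 0 = fst m 0" "fst m' 2 = fst m 2" "fst m' 8 = fst m 8" using agreeD[OF 4(2)] by simp_all
    show "fst m' 0 0 = n" using a m by (simp add: at_node_def static_def)
    show "fst m' 2 (i * n + j) = of_bool (E i j)" if "i < n" "j < n" for i j
      using that a m by (simp add: at_node_def static_def)
    show "fst m' 4 (fst m' 8 0 + v) = of_bool (v \<in> vset (ns ! h))" if "v < n" for v
    proof -
      have "h * Suc n + v < length ns * Suc n" by (rule index_less) (use that m in \<open>auto simp: at_node_def\<close>)
      then have "fst m' 4 (h * Suc n + v) = fst m 4 (h * Suc n + v)" by (rule 4(3))
      then show ?thesis using a that m by (simp add: at_node_def nodes_def del: mult_Suc_right)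
    qed
  qed
  then show ?case using 4 by (intro e) auto
next
  case (7 m')
  then show ?case using at_node_emitted[OF m, of "[c]" m' "{4, 5, 6, 7, 9, 20}"] by simp
qed (use m c in \<open>auto simp: at_node_def static_def\<close>)

lemma runs_Split:
  assumes N: "n \<le> N" and m: "at_node ns h m" "vset (ns ! h) \<subseteq> {..<n}" "marked C m" "C \<subseteq> vset (ns ! h)"
  defines "c1 \<equiv> (C, budget (ns ! h), h, 0)" and "c2 \<equiv> (vset (ns ! h) - C, budget (ns ! h), h, 0)"
  shows "runs N Split m (\<lambda>m'. at_node (ns @ [c1, c2]) h m' \<and> agree {4, 5, 6, 7, 9, 20} m m')"
  unfolding Split_def
proof (rule runs_Seq, rule runs_mono[OF runs_Emit_child[OF N m(1), where c = c1]], goal_cases)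
  case (2 m' x)
  then show ?case using marked_agree[OF m(3) 2(2)] by (simp add: c1_def marked_def)
next
  case (3 m')
  then show ?case using at_node_budget[OF m(1)] agreeD[OF 3] by (simp add: c1_def)
next
  case (5 m1)
  have h: "h < length ns" using m by (simp add: at_node_def)
  have m1: "at_node (ns @ [c1]) h m1" "(ns @ [c1]) ! h = ns ! h" using 5 h by (auto simp: nth_append)
  show ?case
  proof (rule runs_mono[OF runs_Emit_child[OF N m1(1), where c = c2]], goal_cases)
    case (2 m' x)
    have "agree {4, 5, 6, 7, 9, 20} m m'" by (rule agree_trans[OF conjunct2[OF 5] 2(2)]) auto
    from marked_agree[OF m(3) this] have "marked C m'" by simp
    then show ?case using 2 m1(2) by (auto simp: c2_def marked_def)
  next
    case (3 m')
    then show ?case using at_node_budget[OF m1(1)] agreeD[OF 3] m1(2) by (simp add: c2_def)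
  next
    case (5 m2)
    have "agree {4, 5, 6, 7, 9, 20} m m2" by (rule agree_trans[OF conjunct2[OF \<open>at_node (ns @ [c1]) h m1 \<and> _\<close>] conjunct2[OF 5]]) auto
    then show ?case using 5 by simp
  qed (auto simp: c2_def)
qed (auto simp: c1_def)

lemma runs_Branch:
  assumes N: "n \<le> N" and m: "at_node ns h m" "vset (ns ! h) \<subseteq> {..<n}"
  defines "S \<equiv> vset (ns ! h)" and "k \<equiv> budget (ns ! h)"
  defines "f \<equiv> (\<lambda>v. (S - nbh v, k - 1, h, if v \<in> S then v + 2 else 1))"
  shows "runs N Branch m (\<lambda>m'. at_node (ns @ map f [0..<n]) h m' \<and> agree {4, 5, 6, 7, 9, 18, 19, 20, 24} m m')"
  unfolding Branch_def
proof (rule runs_Seq, rule runs_Store, rule runs_For[where n = n and Inv = "\<lambda>i m'.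
    agree {4, 5, 6, 7, 9, 18, 19, 20, 24} m m' \<and> fst m' 18 0 = i * n \<and> at_node (ns @ map f [0..<i]) h m'"], goal_cases)
  case 1
  then show ?case using m by (simp add: at_node_def static_def)
next
  case 4
  have "at_node ns h (upd 19 0 0 (upd 18 0 0 m))"
    by (rule at_node_agree[OF m(1), of "{18, 19}"]) auto
  then show ?case by simp
next
  case (5 i m1)
  let ?ns = "ns @ map f [0..<i]"
  have h: "h < length ns" using m by (simp add: at_node_def)
  then have hi: "?ns ! h = ns ! h" by (simp add: nth_append)
  have c1: "cur S m1" using 5 at_node_cur[of ?ns h m1] hi by (simp add: S_def)
  have "runs N (Cond (Less (Const 0) (In_cur (V 19))) (Assign 24 (Add (V 19) (Const 2))) (Assign 24 (Const 1))) m1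
      (\<lambda>m2. agree {24} m1 m2 \<and> fst m2 24 0 = tag (f i))"
    by (intro runs_Cond runs_Store) (use 5 c1 in \<open>auto simp: f_def split: if_splits\<close>)
  then show ?case
  proof (rule runs_Seq[OF runs_mono], goal_cases)
    case (1 m2)
    have a2: "at_node ?ns h m2" using at_node_agree[of ?ns h m1 "{24}" m2] 5 1 by simp
    have e2: "fst m2 19 0 = i" "fst m2 18 0 = i * n" "fst m2 24 0 = tag (f i)"
      using 5 1 agreeD[OF conjunct1[OF 1]] by auto
    show ?case
    proof (rule runs_Seq, rule runs_mono[OF runs_Emit_child[OF N a2, where c = "f i"]], goal_cases)
      case 1
      show ?case by (simp add: f_def)
    next
      case (2 m3 x)
      have c3: "cur S m3" using 2 hi by (simp add: S_def)
      have e3: "fst m3 19 0 = i" "fst m3 18 0 = i * n" using agreeD[OF 2(2)] e2 by simp_all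
      have "fst m3 2 (i * n + x) = of_bool (E i x)" using c3 2(1) 5(1) by (simp add: cur_def)
      then show ?case using c3 e3 2 by (auto simp: f_def nbh_def)
    next
      case (3 m3)
      then show ?case using at_node_budget[OF a2] agreeD[OF 3] hi by (simp add: f_def k_def)
    next
      case (4 m3)
      then show ?case using agreeD[OF 4] e2 by simp
    next
      case (5 m3)
      note st = \<open>i < n\<close> \<open>agree {4, 5, 6, 7, 9, 18, 19, 20, 24} m m1 \<and> _\<close>
      have e3: "fst m3 19 0 = i" "fst m3 18 0 = i * n" using agreeD[OF conjunct2[OF 5]] e2 by simp_all
      have ag2: "agree {4, 5, 6, 7, 9, 18, 19, 20, 24} m m2"
        by (rule agree_trans[OF conjunct1[OF st(2)] conjunct1[OF 1]]) auto
      have ag3: "agree {4, 5, 6, 7, 9, 18, 19, 20, 24} m m3"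
        by (rule agree_trans[OF ag2 conjunct2[OF 5]]) auto
      have n3: "fst m3 0 0 = n" using 5 by (simp add: at_node_def static_def)
      have "at_node (ns @ map f [0..<Suc i]) h (upd 19 0 (Suc i) (upd 18 0 (Suc i * n) m3))"
        by (rule at_node_agree[of _ _ m3 "{18, 19}"]) (use 5 in auto)
      then show ?case
        by (intro runs_Store) (use e3 ag3 n3 in \<open>simp add: add.commute\<close>)
    qed
  qed
next
  case (6 m')
  then show ?case by simp
qed (use N in auto)

lemma runs_Exclude:
  assumes N: "n \<le> N" and m: "at_node ns h m" "fst m 23 0 = v" "v < n"
  shows "runs N Exclude m (\<lambda>m'. at_node (ns @ [(vset (ns ! h) - {v}, budget (ns ! h), h, 1)]) h m' \<and>
    agree {4, 5, 6, 7, 9, 20} m m')"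
  unfolding Exclude_def
proof (rule runs_Emit_child[OF N m(1)], goal_cases)
  case (2 m' x)
  have "fst m' 23 0 = v" using agreeD[OF 2(2), of 23] m by simp
  then show ?case using 2 by auto
next
  case (3 m')
  then show ?case using at_node_budget[OF m(1)] agreeD[OF 3] by simp
qed auto

text \<open>The frame spares arrays 3, 10 and 11, whose zeros serve as the initial results and the
  empty output.\<close>

lemma runs_Expand:
  assumes N: "n \<le> N" and m: "at_node ns h m" "vset (ns ! h) \<subseteq> {..<n}"
  shows "runs N Expand m (\<lambda>m'. static m' \<and> nodes (ns @ kids_of ns h) m' \<and> fst m' 8 0 = Suc h * Suc n \<and>
    agree ({4..9} \<union> {12..24}) m m')"
proof -
  let ?M = "{4..9} \<union> {12..24} :: nat set"
  define S where "S = vset (ns ! h)"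
  define k where "k = budget (ns ! h)"
  have S: "S \<subseteq> {..<n}" and h: "h < length ns" using m by (auto simp: S_def at_node_def)
  let ?Q = "\<lambda>m'. at_node (ns @ kids_of ns h) h m' \<and> agree ?M m m'"
  let ?D = "Cond (Less (Const 0) (V 14)) Split (Seq Branch (Seq Max_deg Exclude))"
  let ?C = "Conj (Less (V 13) (V 0)) (Less (Const 0) (Load 5 (V 8)))"
  let ?B = "Cond ?C (Seq Component (Seq Check_split ?D)) Skip"
  have body: "runs N ?B m1 ?Q"
    if m1: "agree {13, 20} m m1" "fst m1 13 0 = (if S = {} then n else Max S)" for m1
  proof -
    have a1: "at_node ns h m1" using at_node_agree[OF m(1) m1(1)] by simp
    have b1: "fst m1 5 (fst m1 8 0) = k" "fst m1 0 0 = n"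
      using at_node_budget[OF a1] a1 by (auto simp: k_def at_node_def static_def)
    have ag1: "agree ?M m m1" by (rule agree_trans[OF m1(1) agree_refl]) auto
    show ?thesis
    proof (rule runs_Cond)
      assume "\<not> bval ?C m1"
      then have "S = {} \<or> k = 0" using b1 m1(2) Max_mem[OF S] S by (auto split: if_splits)
      then have "kids_of ns h = []" by (auto simp: kids_of_def kids_def S_def k_def)
      then show "runs N Skip m1 ?Q"
        using a1 ag1 by (intro runs_Skip) simp
    next
      assume "bval ?C m1"
      then have S0: "S \<noteq> {}" and k0: "k > 0" using b1 m1(2) by (auto split: if_splits)
      have u: "Max S \<in> S" "fst m1 13 0 = Max S" using Max_mem[OF S S0] m1(2) S0 by auto
      have cur1: "cur S m1" using at_node_cur[OF a1] by (simp add: S_def)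
      note c = comp_props[OF S S0]
      show "runs N (Seq Component (Seq Check_split ?D)) m1 ?Q"
      proof (rule runs_Seq, rule runs_mono[OF runs_Component[OF N cur1 S u]])
        fix m2 assume m2: "agree {12, 15, 16, 17, 18, 20} m1 m2 \<and> marked (comp S) m2"
        have a2: "at_node ns h m2" using at_node_agree[OF a1 conjunct1[OF m2]] by simp
        have ag2: "agree ?M m m2" by (rule agree_trans[OF ag1 conjunct1[OF m2]]) auto
        have cur2: "cur S m2" using at_node_cur[OF a2] by (simp add: S_def)
        show "runs N (Seq Check_split ?D) m2 ?Q"
        proof (rule runs_Seq, rule runs_mono[OF runs_Check_split[OF N cur2 S conjunct2[OF m2] c(2)]])
          fix m3 assume m3: "agree {14, 20} m2 m3 \<and> (0 < fst m3 14 0 \<longleftrightarrow> comp S \<noteq> S)"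
          have a3: "at_node ns h m3" using at_node_agree[OF a2 conjunct1[OF m3]] by simp
          have ag3: "agree ?M m m3" by (rule agree_trans[OF ag2 conjunct1[OF m3]]) auto
          have mk3: "marked (comp S) m3" using marked_agree[OF conjunct2[OF m2] conjunct1[OF m3]] by simp
          show "runs N ?D m3 ?Q"
          proof (rule runs_Cond)
            assume "bval (Less (Const 0) (V 14)) m3"
            then have "comp S \<noteq> S" using m3 by simp
            then have kd: "kids_of ns h = [(comp S, k, h, 0), (S - comp S, k, h, 0)]"
              using S0 k0 by (simp add: kids_of_def kids_def S_def k_def)
            show "runs N Split m3 ?Q"
            proof (rule runs_mono[OF runs_Split[OF N a3 m(2) mk3]])
              show "comp S \<subseteq> vset (ns ! h)" using c(2) by (simp add: S_def)
              fix m4 assume m4: "at_node (ns @ [(comp S, budget (ns ! h), h, 0), (vset (ns ! h) - comp S, budget (ns ! h), h, 0)]) h m4 \<and>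
                agree {4, 5, 6, 7, 9, 20} m3 m4"
              have "agree ?M m m4" by (rule agree_trans[OF ag3 conjunct2[OF m4]]) auto
              then show "at_node (ns @ kids_of ns h) h m4 \<and> agree ?M m m4" using m4 unfolding kd S_def k_def by blast
            qed
          next
            assume "\<not> bval (Less (Const 0) (V 14)) m3"
            then have cS: "comp S = S" using m3 by simp
            define cs where "cs = map (\<lambda>v. (S - nbh v, k - 1, h, if v \<in> S then v + 2 else 1)) [0..<n]"
            have kd: "kids_of ns h = cs @ [(S - {mdeg S}, k, h, 1)]"
              using S0 k0 cS by (simp add: kids_of_def kids_def cs_def S_def k_def)
            show "runs N (Seq Branch (Seq Max_deg Exclude)) m3 ?Q"
            proof (rule runs_Seq, rule runs_mono[OF runs_Branch[OF N a3 m(2)]])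
              fix m4 assume "at_node (ns @ map (\<lambda>v. (vset (ns ! h) - nbh v, budget (ns ! h) - 1, h,
                  if v \<in> vset (ns ! h) then v + 2 else 1)) [0..<n]) h m4 \<and>
                agree {4, 5, 6, 7, 9, 18, 19, 20, 24} m3 m4"
              then have m4: "at_node (ns @ cs) h m4" "agree {4, 5, 6, 7, 9, 18, 19, 20, 24} m3 m4"
                unfolding cs_def S_def k_def by auto
              have ag4: "agree ?M m m4" by (rule agree_trans[OF ag3 m4(2)]) auto
              have hh: "(ns @ cs) ! h = ns ! h" using h by (simp add: nth_append)
              have cur4: "cur S m4" using at_node_cur[OF m4(1)] by (simp add: S_def hh)
              show "runs N (Seq Max_deg Exclude) m4 ?Q"
              proof (rule runs_Seq, rule runs_mono[OF runs_Max_deg[OF N cur4 S]])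
                fix m5 assume m5: "agree {18, 19, 20, 21, 22, 23} m4 m5 \<and> fst m5 23 0 = mdeg S"
                have a5: "at_node (ns @ cs) h m5" using at_node_agree[OF m4(1) conjunct1[OF m5]] by simp
                have ag5: "agree ?M m m5" by (rule agree_trans[OF ag4 conjunct1[OF m5]]) auto
                have "mdeg S < n" using mdeg(1)[OF S S0] S by blast
                from runs_Exclude[OF N a5 conjunct2[OF m5] this]
                show "runs N Exclude m5 ?Q"
                proof (rule runs_mono)
                  fix m6 assume m6: "at_node ((ns @ cs) @ [(vset ((ns @ cs) ! h) - {mdeg S}, budget ((ns @ cs) ! h), h, 1)]) h m6 \<and>
                    agree {4, 5, 6, 7, 9, 20} m5 m6"
                  have "agree ?M m m6" by (rule agree_trans[OF ag5 conjunct2[OF m6]]) auto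
                  then show "at_node (ns @ kids_of ns h) h m6 \<and> agree ?M m m6"
                    using m6 unfolding kd hh S_def k_def by simp
                qed
              qed
            qed
          qed
        qed
      qed
    qed
  qed
  show ?thesis unfolding Expand_def
  proof (rule runs_Seq, rule runs_mono[OF runs_Find_top[OF N _ S]])
    show "cur S m" using at_node_cur[OF m(1)] by (simp add: S_def)
    fix m1 assume m1: "agree {13, 20} m m1 \<and> fst m1 13 0 = (if S = {} then n else Max S)"
    show "runs N (Seq ?B (Assign 8 (Add (V 8) (Add (V 0) (Const 1))))) m1
      (\<lambda>m'. static m' \<and> nodes (ns @ kids_of ns h) m' \<and> fst m' 8 0 = Suc h * Suc n \<and> agree ?M m m')"
    proof (rule runs_Seq, rule runs_mono[OF body], rule conjunct1[OF m1], rule conjunct2[OF m1], rule runs_Store)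
      fix m2 assume m2: "at_node (ns @ kids_of ns h) h m2 \<and> agree ?M m m2"
      then have e: "fst m2 8 0 = h * Suc n" "fst m2 0 0 = n" by (auto simp: at_node_def static_def)
      define m3 where "m3 = upd 8 0 (Suc h * Suc n) m2"
      have "agree {8} m2 m3" by (simp add: m3_def)
      then have "static m3 \<and> nodes (ns @ kids_of ns h) m3"
        using m2 static_agree[of m2 "{8}" m3] nodes_agree[of _ m2 "{8}" m3] by (simp add: at_node_def)
      moreover have "agree ?M m m3" using m2 by (simp add: m3_def)
      moreover have u: "upd 8 (nval (Const 0) m2) (nval (Add (V 8) (Add (V 0) (Const 1))) m2) m2 = m3"
        using e by (simp add: m3_def algebra_simps)
      moreover have "fst m3 8 0 = Suc h * Suc n" by (simp add: m3_def)
      ultimately show "(\<lambda>m'. static m' \<and> nodes (ns @ kids_of ns h) m' \<and> fst m' 8 0 = Suc h * Suc n \<and> agree ?M m m')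
        (upd 8 (nval (Const 0) m2) (nval (Add (V 8) (Add (V 0) (Const 1))) m2) m2)" unfolding u by blast
    qed
  qed
qed

end

section \<open>Evaluating the recursion tree\<close>

definition Fill :: "nexp \<Rightarrow> prog" where
  "Fill e = For 20 (Store 10 (Add (V 25) (V 20)) e)"

text \<open>Adding the indicators yields the union because the two results are disjoint.\<close>

definition Join :: prog where
  "Join = Seq (Fill (Add (Load 10 (Add (V 25) (V 20))) (Load 10 (Add (V 8) (V 20)))))
     (Store 11 (V 25) (Add (Load 11 (V 25)) (Load 11 (V 8))))"

definition Replace :: prog where
  "Replace = Seq (Fill (Load 10 (Add (V 8) (V 20))))
     (Seq (Cond (Less (Const 1) (Load 7 (V 8)))
            (Store 10 (Add (V 25) (Sub (Load 7 (V 8)) (Const 2))) (Const 1)) Skip)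
          (Store 11 (V 25) (V 26)))"

definition Improve :: prog where
  "Improve = Seq (Assign 26 (Load 11 (V 8)))
     (Seq (Cond (Less (Const 1) (Load 7 (V 8)))
            (Assign 26 (Add (V 26) (Load 1 (Sub (Load 7 (V 8)) (Const 2))))) Skip)
          (Cond (Less (Load 11 (V 25)) (V 26)) Replace Skip))"

definition Report :: prog where
  "Report = Seq (Assign 25 (Load 6 (V 8))) (Cond (Less (Load 7 (V 8)) (Const 1)) Join Improve)"

definition Init :: prog where
  "Init = Seq (For 20 (Store 4 (V 20) (Const 1))) (Seq (Store 5 (Const 0) (V 30))
     (Seq (Store 7 (Const 0) (Const 1)) (Assign 9 (Add (V 0) (Const 1)))))"

definition Forward :: prog where
  "Forward = Loop (Less (V 8) (V 9)) Expand"

text \<open>The loop stops at address \<open>n + 1\<close>, so node 1 is the last to report and the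
  root is left to hold the final result.\<close>

definition Backward :: prog where
  "Backward = Loop (Less (Add (V 0) (Const 1)) (V 8))
     (Seq (Assign 8 (Sub (V 8) (Add (V 0) (Const 1)))) Report)"

definition Output :: prog where
  "Output = For 20 (Store 3 (V 20) (Load 10 (V 20)))"

definition Solve :: prog where
  "Solve = Seq Init (Seq Forward (Seq Backward Output))"

context wgraph begin

text \<open>\<open>Join\<close> reads the cells that it overwrites; therefore \<open>e\<close> may
  rely on the old contents from \<open>P + i\<close> on, including the cell about to be
  written.\<close>

lemma runs_Fill:
  assumes N: "n \<le> N" and m: "fst m 0 0 = n" "fst m 25 0 = P"
    and e: "\<And>m' i. i < n \<Longrightarrow> agree {10, 20} m m' \<Longrightarrow> fst m' 20 0 = i \<Longrightarrow>
      (\<And>l. l < P \<or> P + i \<le> l \<Longrightarrow> fst m' 10 l = fst m 10 l) \<Longrightarrow> nval e m' = g i"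
  shows "runs N (Fill e) m (\<lambda>m'. agree {10, 20} m m' \<and>
    (\<forall>l. fst m' 10 l = (if P \<le> l \<and> l < P + n then g (l - P) else fst m 10 l)))"
  unfolding Fill_def
proof (rule runs_For[where n = n and Inv = "\<lambda>i m'. agree {10, 20} m m' \<and>
    (\<forall>l. fst m' 10 l = (if P \<le> l \<and> l < P + i then g (l - P) else fst m 10 l))"], goal_cases)
  case (5 i m')
  have "nval e m' = g i" by (rule e) (use 5 in auto)
  moreover have "fst m' 25 0 = P" using agreeD[OF conjunct1[OF 5(2)]] m by simp
  ultimately show ?case by (intro runs_Store) (use 5 in auto)
qed (use N m in auto)

definition stored :: "node list \<Rightarrow> (nat \<Rightarrow> nat set) \<Rightarrow> (nat \<Rightarrow> nat) \<Rightarrow> memory \<Rightarrow> bool" where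
  "stored ns R W m \<longleftrightarrow> (\<forall>i<length ns. (\<forall>v<n. fst m 10 (i * Suc n + v) = of_bool (v \<in> R i)) \<and>
     fst m 11 (i * Suc n) = W i)"

lemma block_iff: "v < n \<Longrightarrow> p * Suc n \<le> i * Suc n + v \<and> i * Suc n + v < p * Suc n + n \<longleftrightarrow> i = p"
  using index_less[of i p v] index_less[of p i n] by (cases i p rule: linorder_cases) auto

lemma stored_update:
  assumes st: "stored ns R W m" and p: "p < length ns"
    and m': "\<And>l. fst m' 10 l = (if p * Suc n \<le> l \<and> l < p * Suc n + n then of_bool (l - p * Suc n \<in> A) else fst m 10 l)"
      "fst m' 11 = (fst m 11)(p * Suc n := x)"
  shows "stored ns (R(p := A)) (W(p := x)) m'"
  unfolding stored_def
proof (intro allI impI conjI)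
  fix i assume i: "i < length ns"
  show "fst m' 10 (i * Suc n + v) = of_bool (v \<in> (R(p := A)) i)" if "v < n" for v
    unfolding m'(1) block_iff[OF that] using st i that by (auto simp: stored_def)
  have "i * Suc n = p * Suc n \<longleftrightarrow> i = p" by (simp only: mult_cancel2) simp
  then show "fst m' 11 (i * Suc n) = (W(p := x)) i"
    using st i by (auto simp: stored_def m'(2) simp del: mult_Suc_right)
qed

text \<open>The parent stands before the node, so their blocks are disjoint and overwriting the one
  result leaves the other readable.\<close>

lemma runs_Report:
  assumes N: "n \<le> N" and m: "at_node ns j m" "stored ns R W m"
    and j: "parent (ns ! j) < j" "tag (ns ! j) = 0 \<Longrightarrow> R (parent (ns ! j)) \<inter> R j = {}"
      "extra (tag (ns ! j)) \<subseteq> {..<n}"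
  shows "runs N Report m (\<lambda>m'. case report ns j (R, W) of (R', W') \<Rightarrow> stored ns R' W' m' \<and> agree {10, 11, 20, 25, 26} m m')"
proof -
  define p where "p = parent (ns ! j)"
  define x where "x = tag (ns ! j)"
  let ?P = "p * Suc n" let ?H = "j * Suc n"
  have jl: "j < length ns" and pl: "p < length ns" using m j by (auto simp: at_node_def p_def)
  have PH: "?P + v < ?H" if "v < Suc n" for v by (rule index_less) (use j that in \<open>auto simp: p_def\<close>)
  have mem: "fst m 0 0 = n" "fst m 8 0 = ?H" "fst m 6 ?H = ?P" "fst m 7 ?H = x"
    using m(1) by (auto simp: at_node_def static_def nodes_def p_def x_def)
  have w1: "fst m 1 i = w i" if "i < n" for i using m(1) that by (simp add: at_node_def static_def)
  have R: "fst m 10 (?P + v) = of_bool (v \<in> R p)" "fst m 10 (?H + v) = of_bool (v \<in> R j)" if "v < n" for v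
    using m(2) jl pl that by (auto simp: stored_def)
  have W: "fst m 11 ?P = W p" "fst m 11 ?H = W j" using m(2) jl pl by (auto simp: stored_def)
  have rep: "report ns j (R, W) = (if x = 0 then (R(p := R p \<union> R j), W(p := W p + W j))
     else if W p < W j + wt (extra x) then (R(p := R j \<union> extra x), W(p := W j + wt (extra x))) else (R, W))"
    by (simp add: report_def p_def x_def Let_def)
  define m1 where "m1 = upd 25 0 ?P m"
  have mem1: "fst m1 0 0 = n" "fst m1 25 0 = ?P" "fst m1 8 0 = ?H" by (auto simp: m1_def mem)
  have st1: "stored ns R W m1" using m(2) by (simp add: stored_def m1_def)
  have join: "runs N Join m1 (\<lambda>m'. stored ns (R(p := R p \<union> R j)) (W(p := W p + W j)) m' \<and> agree {10, 11, 20, 25, 26} m m')"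
    if x0: "x = 0"
    unfolding Join_def
  proof (rule runs_Seq, rule runs_mono[OF runs_Fill[OF N mem1(1,2), where g = "\<lambda>v. of_bool (v \<in> R p \<union> R j)"]], goal_cases)
    case (1 m' i)
    have a: "fst m' 25 0 = ?P" "fst m' 8 0 = ?H" using agreeD[OF 1(2)] mem1 by simp_all
    have "fst m' 10 (?P + i) = fst m 10 (?P + i)" using 1(4)[of "?P + i"] by (simp add: m1_def)
    moreover have "fst m' 10 (?H + i) = fst m 10 (?H + i)" using 1(4)[of "?H + i"] PH[of i] 1(1) by (simp add: m1_def)
    moreover have "i \<notin> R p \<or> i \<notin> R j" using j(2) x0 by (auto simp: p_def x_def)
    ultimately show ?case using a R[OF 1(1)] 1(3) by (auto simp del: mult_Suc_right)
  next
    case (2 m2)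
    have a: "fst m2 25 0 = ?P" "fst m2 8 0 = ?H" "fst m2 11 = fst m 11"
      using agreeD[OF conjunct1[OF 2]] mem1 by (simp_all add: m1_def)
    define m3 where "m3 = upd 11 ?P (W p + W j) m2"
    have "stored ns (R(p := R p \<union> R j)) (W(p := W p + W j)) m3"
      by (rule stored_update[OF st1 pl]) (use 2 a in \<open>auto simp: m3_def m1_def\<close>)
    moreover have "agree {10, 11, 20, 25, 26} m m3" using 2 by (auto simp: m3_def m1_def agree_def)
    ultimately show ?case by (intro runs_Store) (use a W in \<open>simp add: m3_def del: mult_Suc_right\<close>)
  qed
  have extra: "extra x = (if 1 < x then {x - 2} else {})" by (auto simp: extra_def)
  have xn: "x - 2 < n" if "1 < x" using j(3) that by (simp add: x_def[symmetric] extra)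
  have improve: "runs N Improve m1 (\<lambda>m'. (if W p < W j + wt (extra x)
      then stored ns (R(p := R j \<union> extra x)) (W(p := W j + wt (extra x))) m' else stored ns R W m') \<and>
      agree {10, 11, 20, 25, 26} m m')"
  proof -
    let ?Q = "\<lambda>m'. (if W p < W j + wt (extra x)
      then stored ns (R(p := R j \<union> extra x)) (W(p := W j + wt (extra x))) m' else stored ns R W m') \<and>
      agree {10, 11, 20, 25, 26} m m'"
    define m2 where "m2 = upd 26 0 (W j + wt (extra x)) m1"
    have m2': "m2 = (if 1 < x then upd 26 0 (W j + w (x - 2)) (upd 26 0 (W j) m1) else upd 26 0 (W j) m1)"
      by (auto simp: m2_def extra wt_def upd_def)
    have mem2: "fst m2 0 0 = n" "fst m2 25 0 = ?P" "fst m2 8 0 = ?H" "fst m2 7 ?H = x" "fst m2 11 = fst m 11" "fst m2 10 = fst m 10"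
      using mem1 mem by (auto simp: m2_def m1_def)
    have st2: "stored ns R W m2" using st1 by (simp add: stored_def m2_def)
    have ag2: "agree {10, 11, 20, 25, 26} m m2" by (simp add: m2_def m1_def)
    have "runs N (Cond (Less (Load 11 (V 25)) (V 26)) Replace Skip) m2 ?Q"
    proof (rule runs_Cond)
      assume "\<not> bval (Less (Load 11 (V 25)) (V 26)) m2"
      then have "\<not> W p < W j + wt (extra x)" using mem2 W by (simp add: m2_def m1_def)
      then show "runs N Skip m2 ?Q" using st2 ag2 by (intro runs_Skip) simp
    next
      assume "bval (Less (Load 11 (V 25)) (V 26)) m2"
      then have less: "W p < W j + wt (extra x)" using mem2 W by (simp add: m2_def m1_def)
      show "runs N Replace m2 ?Q"
        unfolding Replace_def
      proof (rule runs_Seq, rule runs_mono[OF runs_Fill[OF N mem2(1,2), where g = "\<lambda>v. of_bool (v \<in> R j)"]], goal_cases)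
        case (1 m' i)
        have a: "fst m' 8 0 = ?H" using agreeD[OF 1(2)] mem2 by simp
        have "fst m' 10 (?H + i) = fst m 10 (?H + i)" using 1(4)[of "?H + i"] PH[of i] 1(1) mem2 by simp
        then show ?case using a R[OF 1(1)] 1(3) by (auto simp del: mult_Suc_right)
      next
        case (2 m3)
        note fill = conjunct2[OF 2, rule_format]
        have a: "fst m3 25 0 = ?P" "fst m3 8 0 = ?H" "fst m3 11 = fst m 11" "fst m3 7 ?H = x" "fst m3 26 0 = W j + wt (extra x)"
          using agreeD[OF conjunct1[OF 2]] mem2 by (simp_all add: m2_def)
        define m4 where "m4 = (if 1 < x then upd 10 (?P + (x - 2)) 1 m3 else m3)"
        define m5 where "m5 = upd 11 ?P (W j + wt (extra x)) m4"
        have a4: "fst m4 25 0 = ?P" "fst m4 26 0 = W j + wt (extra x)" using a by (auto simp: m4_def)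
        have "stored ns (R(p := R j \<union> extra x)) (W(p := W j + wt (extra x))) m5"
        proof (rule stored_update[OF st2 pl])
          fix l
          show "fst m5 10 l = (if ?P \<le> l \<and> l < ?P + n then of_bool (l - ?P \<in> R j \<union> extra x) else fst m2 10 l)"
            using fill[of l] xn by (auto simp: m5_def m4_def extra simp del: mult_Suc_right split: if_splits)
        qed (use a mem2 in \<open>simp add: m5_def m4_def\<close>)
        moreover have "agree {10, 11, 20, 25, 26} m m5"
          using 2 by (auto simp: m5_def m4_def m2_def m1_def agree_def)
        ultimately have fin: "?Q m5" using less by simp
        have "runs N (Cond (Less (Const 1) (Load 7 (V 8)))
            (Store 10 (Add (V 25) (Sub (Load 7 (V 8)) (Const 2))) (Const 1)) Skip) m3 (\<lambda>m'. m' = m4)"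
          by (intro runs_Cond runs_Store runs_Skip) (use a in \<open>auto simp: m4_def\<close>)
        moreover have u5: "upd 11 (nval (V 25) m4) (nval (V 26) m4) m4 = m5" using a4 by (simp add: m5_def)
        have "runs N (Store 11 (V 25) (V 26)) m4 ?Q"
          by (rule runs_Store, unfold u5) (rule fin)
        ultimately show ?case by (intro runs_Seq) (auto elim!: runs_mono simp only:)
      qed
    qed
    moreover have "runs N (Cond (Less (Const 1) (Load 7 (V 8)))
            (Assign 26 (Add (V 26) (Load 1 (Sub (Load 7 (V 8)) (Const 2))))) Skip) (upd 26 0 (W j) m1) (\<lambda>m'. m' = m2)"
      by (intro runs_Cond runs_Store runs_Skip) (use mem mem1 w1 xn in \<open>auto simp: m2' m1_def\<close>)
    moreover have "upd 26 (nval (Const 0) m1) (nval (Load 11 (V 8)) m1) m1 = upd 26 0 (W j) m1"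
      using mem1 W by (simp add: m1_def)
    ultimately show ?thesis unfolding Improve_def
      by (intro runs_Seq runs_Store) (auto elim!: runs_mono)
  qed
  have u: "upd 25 (nval (Const 0) m) (nval (Load 6 (V 8)) m) m = m1" using mem by (simp add: m1_def)
  have b: "bval (Less (Load 7 (V 8)) (Const 1)) m1 \<longleftrightarrow> x = 0" using mem by (simp add: m1_def)
  have "runs N Report m (\<lambda>m'. (if x = 0 then stored ns (R(p := R p \<union> R j)) (W(p := W p + W j)) m'
     else if W p < W j + wt (extra x) then stored ns (R(p := R j \<union> extra x)) (W(p := W j + wt (extra x))) m' else stored ns R W m')
      \<and> agree {10, 11, 20, 25, 26} m m')"
    unfolding Report_def
    by (rule runs_Seq, rule runs_Store, unfold u, rule runs_Cond)
      (use join improve b in \<open>auto elim!: runs_mono split: if_splits\<close>)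
  then show ?thesis by (rule runs_mono) (auto simp: rep split: if_splits)
qed

lemma runs_Init:
  assumes N: "n \<le> N" and m: "static m" "\<forall>a\<in>{3..11}. \<forall>i. fst m a i = 0" "fst m 30 0 = k0"
  shows "runs N Init m (\<lambda>m'. static m' \<and> nodes [({..<n}, k0, 0, 1)] m' \<and> (\<forall>a\<in>{3, 8, 10, 11}. \<forall>i. fst m' a i = 0))"
  unfolding Init_def
proof (rule runs_Seq, rule runs_For[where n = n and Inv = "\<lambda>i m'. agree {4, 20} m m' \<and> (\<forall>v<i. fst m' 4 v = 1)"], goal_cases)
  case (5 i m')
  then show ?case by (intro runs_Store) (auto simp: less_Suc_eq)
next
  case (6 m')
  have a: "fst m' b = fst m b" if "b \<notin> {4, 20}" for b using agreeD[OF conjunct1[OF 6] that] .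
  show ?case
    by (intro runs_Seq runs_Store) (use 6 m in \<open>auto simp: a nodes_def static_def\<close>)
qed (use N m in \<open>auto simp: static_def\<close>)

lemma runs_Forward:
  assumes N: "n \<le> N" "size_bound ({..<n}, k0, 0, 1) \<le> N"
    and m: "static m" "nodes [({..<n}, k0, 0, 1)] m" "\<forall>a\<in>{3, 8, 10, 11}. \<forall>i. fst m a i = 0"
  shows "runs N Forward m (\<lambda>m'. \<exists>ns. tree k0 ns (length ns) \<and> static m' \<and> nodes ns m' \<and>
    fst m' 8 0 = length ns * Suc n \<and> (\<forall>a\<in>{3, 10, 11}. \<forall>i. fst m' a i = 0))"
  unfolding Forward_def
proof (rule runs_Loop[where Inv = "\<lambda>h m'. \<exists>ns. tree k0 ns h \<and> static m' \<and> nodes ns m' \<and>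
    fst m' 8 0 = h * Suc n \<and> (\<forall>a\<in>{3, 10, 11}. \<forall>i. fst m' a i = 0)"], goal_cases)
  case 1
  show ?case using m tree_init by (intro exI[of _ "[({..<n}, k0, 0, 1)]"]) auto
next
  case (2 h m')
  then obtain ns where ns: "tree k0 ns h" "static m'" "nodes ns m'" "fst m' 8 0 = h * Suc n"
    "\<forall>a\<in>{3, 10, 11}. \<forall>i. fst m' a i = 0" by blast
  have "h * Suc n < length ns * Suc n" using 2(2) ns by (simp add: nodes_def)
  then have h: "h < length ns" by (simp only: mult_less_cancel2)
  note T = tree_step[OF ns(1) h]
  \<comment> \<open>The bound is applied to the tree after the step, which gives
    \<open>Suc h\<close> and hence a strict inequality.\<close>
  have "h < N" using tree_length[OF T] N by simp
  moreover have "at_node ns h m'" using ns h by (simp add: at_node_def)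
  from runs_Expand[OF N(1) this treeD(4)[OF ns(1) h]]
  have "runs N Expand m' (\<lambda>m'. \<exists>ns. tree k0 ns (Suc h) \<and> static m' \<and> nodes ns m' \<and>
    fst m' 8 0 = Suc h * Suc n \<and> (\<forall>a\<in>{3, 10, 11}. \<forall>i. fst m' a i = 0))"
  proof (rule runs_mono)
    fix m'' assume q: "static m'' \<and> nodes (ns @ kids_of ns h) m'' \<and> fst m'' 8 0 = Suc h * Suc n \<and>
      agree ({4..9} \<union> {12..24}) m' m''"
    then have "\<forall>a\<in>{3, 10, 11}. \<forall>i. fst m'' a i = 0" using ns(5) by (auto simp: agree_def)
    then show "\<exists>ns. tree k0 ns (Suc h) \<and> static m'' \<and> nodes ns m'' \<and>
      fst m'' 8 0 = Suc h * Suc n \<and> (\<forall>a\<in>{3, 10, 11}. \<forall>i. fst m'' a i = 0)" using q T by blast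
  qed
  ultimately show ?case by blast
next
  case (3 h m')
  then obtain ns where ns: "tree k0 ns h" "static m'" "nodes ns m'" "fst m' 8 0 = h * Suc n"
    "\<forall>a\<in>{3, 10, 11}. \<forall>i. fst m' a i = 0" by blast
  have "\<not> h * Suc n < length ns * Suc n" using 3(2) ns by (simp add: nodes_def)
  then have "\<not> h < length ns" by (simp only: mult_less_cancel2) simp
  then have "h = length ns" using treeD(1)[OF ns(1)] by simp
  then show ?case using ns by blast
qed

lemma runs_Backward:
  assumes N: "n \<le> N" "length ns \<le> N" and T: "tree k0 ns (length ns)"
    and m: "static m" "nodes ns m" "fst m 8 0 = length ns * Suc n" "\<forall>a\<in>{3, 10, 11}. \<forall>i. fst m a i = 0"
  shows "runs N Backward m (\<lambda>m'. fst m' 0 0 = n \<and> (\<forall>i. fst m' 3 i = 0) \<and>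
    (\<exists>R W. results ns 1 R W \<and> stored ns R W m'))"
  unfolding Backward_def
proof (rule runs_Loop[where Inv = "\<lambda>i m'. i < length ns \<and> static m' \<and> nodes ns m' \<and>
    fst m' 8 0 = (length ns - i) * Suc n \<and> (\<forall>i. fst m' 3 i = 0) \<and>
    (\<exists>R W. results ns (length ns - i) R W \<and> stored ns R W m')"], goal_cases)
  case 1
  have "stored ns (\<lambda>_. {}) (\<lambda>_. 0) m" using m(4) by (simp add: stored_def)
  then show ?case using m results_init treeD(2)[OF T] by auto
next
  case (2 i m1)
  then obtain R W where RW: "results ns (length ns - i) R W" "stored ns R W m1" by blast
  have n1: "fst m1 0 0 = n" using 2 by (simp add: static_def)
  have "1 * Suc n < (length ns - i) * Suc n" using 2 n1 by (simp del: mult_Suc_right)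
  then have "1 < length ns - i" by (simp only: mult_less_cancel2)
  then obtain j where j: "length ns - i = Suc j" "0 < j" "length ns - Suc i = j" "j < length ns" "Suc i < length ns"
    by (cases "length ns - i") auto
  define m2 where "m2 = upd 8 0 (j * Suc n) m1"
  have ag2: "agree {8} m1 m2" by (simp add: m2_def)
  have u: "upd 8 (nval (Const 0) m1) (nval (Sub (V 8) (Add (V 0) (Const 1))) m1) m1 = m2"
    using 2 n1 j(1) by (simp add: m2_def)
  have "at_node ns j m2"
    using 2 j static_agree[of m1 "{8}" m2] nodes_agree[of ns m1 "{8}" m2] by (simp add: at_node_def m2_def)
  moreover have "stored ns R W m2" using RW by (simp add: stored_def m2_def)
  ultimately have "runs N Report m2 (\<lambda>m'. case report ns j (R, W) of (R', W') \<Rightarrow> stored ns R' W' m' \<and> agree {10, 11, 20, 25, 26} m2 m')"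
  proof (rule runs_Report[OF N(1)])
    have kid: "ns ! j \<in> set (kids_of ns (parent (ns ! j)))" and p: "parent (ns ! j) < length ns"
      using treeD(6,7)[OF T j(2,4)] by auto
    show "parent (ns ! j) < j" by (rule treeD(5)[OF T j(2,4)])
    note res = RW(1)[unfolded j(1)]
    show "R (parent (ns ! j)) \<inter> R j = {}" if "tag (ns ! j) = 0"
      using resultsD(5)[OF res p j(2) _ j(4) refl that] resultsD(1)[OF res j(4)] by blast
    show "extra (tag (ns ! j)) \<subseteq> {..<n}"
    proof (cases "tag (ns ! j) = 0")
      case True
      then show ?thesis by (simp add: extra_def)
    next
      case False
      have "indep {}" by (simp add: indep_def)
      with kids_tag1(4)[OF treeD(4)[OF T p] kid[unfolded kids_of_def] False, of "{}"]
      have "extra (tag (ns ! j)) \<subseteq> vset (ns ! parent (ns ! j))" by simp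
      then show ?thesis using treeD(4)[OF T p] by (rule order.trans)
    qed
  qed
  then have "runs N Report m2 (\<lambda>m'. Suc i < length ns \<and> static m' \<and> nodes ns m' \<and>
    fst m' 8 0 = (length ns - Suc i) * Suc n \<and> (\<forall>i. fst m' 3 i = 0) \<and>
    (\<exists>R W. results ns (length ns - Suc i) R W \<and> stored ns R W m'))"
  proof (rule runs_mono)
    fix m3 assume q: "case report ns j (R, W) of (R', W') \<Rightarrow> stored ns R' W' m3 \<and> agree {10, 11, 20, 25, 26} m2 m3"
    obtain R' W' where RW': "report ns j (R, W) = (R', W')" by fastforce
    then have q': "stored ns R' W' m3" "agree {10, 11, 20, 25, 26} m2 m3" using q by auto
    have "results ns j R' W'" by (rule results_step[OF T _ j(2,4) RW']) (use RW j in simp)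
    moreover have "static m3" "nodes ns m3"
      using q'(2) \<open>at_node ns j m2\<close> static_agree[OF _ q'(2)] nodes_agree[OF _ q'(2)] by (auto simp: at_node_def)
    moreover have "fst m3 8 0 = j * Suc n" "\<forall>i. fst m3 3 i = 0"
      using 2 agreeD[OF q'(2)] by (auto simp: m2_def)
    ultimately show "Suc i < length ns \<and> static m3 \<and> nodes ns m3 \<and>
      fst m3 8 0 = (length ns - Suc i) * Suc n \<and> (\<forall>i. fst m3 3 i = 0) \<and>
      (\<exists>R W. results ns (length ns - Suc i) R W \<and> stored ns R W m3)" using q'(1) j by auto
  qed
  moreover have "i < N" using 2 N by simp
  ultimately show ?case by (intro conjI runs_Seq runs_Store) (auto simp only: u)
next
  case (3 i m1)
  have n1: "fst m1 0 0 = n" using 3 by (simp add: static_def)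
  then have "\<not> 1 * Suc n < (length ns - i) * Suc n" using 3 by (simp del: mult_Suc_right)
  then have "\<not> 1 < length ns - i" by (simp only: mult_less_cancel2) simp
  then have "length ns - i = 1" using 3 by linarith
  then show ?case using 3 n1 by auto
qed

lemma runs_Output:
  assumes N: "n \<le> N" and m: "fst m 0 0 = n" "\<forall>i. fst m 3 i = 0" "\<forall>v<n. fst m 10 v = of_bool (v \<in> A)" "A \<subseteq> {..<n}"
  shows "runs N Output m (\<lambda>m'. output_set m' = A)"
  unfolding Output_def
proof (rule runs_For[where n = n and Inv = "\<lambda>i m'. agree {3, 20} m m' \<and> (\<forall>v. fst m' 3 v = of_bool (v < i \<and> v \<in> A))"], goal_cases)
  case (5 i m')
  have "fst m' 10 i = of_bool (i \<in> A)" using agreeD[OF conjunct1[OF 5(2)]] m 5(1) by simp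
  then show ?case by (intro runs_Store) (use 5 in \<open>auto simp: less_Suc_eq\<close>)
next
  case (6 m')
  then show ?case using m(4) by (auto simp: output_set_def)
qed (use N m in auto)

lemma runs_Solve:
  assumes N: "n \<le> N" "size_bound ({..<n}, k0, 0, 1) \<le> N"
    and m: "static m" "\<forall>a\<in>{3..11}. \<forall>i. fst m a i = 0" "fst m 30 0 = k0"
  shows "runs N Solve m (\<lambda>m'. output_set m' \<subseteq> {..<n} \<and> indep (output_set m') \<and> val {..<n} k0 \<le> wt (output_set m'))"
  unfolding Solve_def
proof (rule runs_Seq, rule runs_mono[OF runs_Init[OF N(1) m]])
  fix m1 assume m1: "static m1 \<and> nodes [({..<n}, k0, 0, 1)] m1 \<and> (\<forall>a\<in>{3, 8, 10, 11}. \<forall>i. fst m1 a i = 0)"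
  let ?Q = "\<lambda>m'. output_set m' \<subseteq> {..<n} \<and> indep (output_set m') \<and> val {..<n} k0 \<le> wt (output_set m')"
  show "runs N (Seq Forward (Seq Backward Output)) m1 ?Q"
  proof (rule runs_Seq, rule runs_mono[OF runs_Forward[OF N, of m1]])
    fix m2 assume "\<exists>ns. tree k0 ns (length ns) \<and> static m2 \<and> nodes ns m2 \<and>
      fst m2 8 0 = length ns * Suc n \<and> (\<forall>a\<in>{3, 10, 11}. \<forall>i. fst m2 a i = 0)"
    then obtain ns where ns: "tree k0 ns (length ns)" "static m2" "nodes ns m2"
      "fst m2 8 0 = length ns * Suc n" "\<forall>a\<in>{3, 10, 11}. \<forall>i. fst m2 a i = 0" by blast
    have "length ns \<le> N" using tree_length[OF ns(1)] N(2) by simp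
    show "runs N (Seq Backward Output) m2 ?Q"
    proof (rule runs_Seq, rule runs_mono[OF runs_Backward[OF N(1) \<open>length ns \<le> N\<close> ns]])
      fix m3 assume m3: "fst m3 0 0 = n \<and> (\<forall>i. fst m3 3 i = 0) \<and> (\<exists>R W. results ns 1 R W \<and> stored ns R W m3)"
      then obtain R W where RW: "results ns 1 R W" "stored ns R W m3" by blast
      have l: "0 < length ns" and root: "ns ! 0 = ({..<n}, k0, 0, 1)" using treeD(2,3)[OF ns(1)] by auto
      note r = resultsD(1-3)[OF RW(1) l]
      have "val {..<n} k0 \<le> W 0" using results_val[OF ns(1) RW(1) l] root by simp
      moreover have "\<forall>v<n. fst m3 10 v = of_bool (v \<in> R 0)"
      proof (intro allI impI)
        fix v assume "v < n"
        then have "fst m3 10 (0 * Suc n + v) = of_bool (v \<in> R 0)" using RW(2) l unfolding stored_def by blast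
        then show "fst m3 10 v = of_bool (v \<in> R 0)" by simp
      qed
      moreover have "R 0 \<subseteq> {..<n}" using r(1) root by simp
      ultimately show "runs N Output m3 ?Q"
        using m3 r by (intro runs_mono[OF runs_Output[OF N(1), of m3 "R 0"]]) auto
    qed
  qed (use m1 in auto)
qed

end

section \<open>Computing the budgets\<close>

text \<open>The factor is a constant of the program, a multiple of \<open>t\<close>, so the product
  can be unrolled into additions.\<close>

primrec scale :: "nat \<Rightarrow> nexp \<Rightarrow> nexp" where
  "scale 0 e = Const 0"
| "scale (Suc c) e = Add e (scale c e)"

lemma nval_scale [simp]: "nval (scale c e) m = c * nval e m"
  by (induction c) auto

text \<open>Binary length of \<open>n\<close>, raised to 1 for \<open>n = 0\<close> because
  \<open>light_net\<close> and the final division need a positive number.\<close>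

definition log_bound :: "nat \<Rightarrow> nat" where
  "log_bound n = (LEAST l. 1 \<le> l \<and> n < 2 ^ l)"

definition sqrt_bound :: "nat \<Rightarrow> nat" where
  "sqrt_bound n = (LEAST r. n \<le> r * r)"

lemma log_bound: "1 \<le> log_bound n" "n < 2 ^ log_bound n"
proof -
  have "n < 2 ^ Suc n" unfolding power_Suc using less_exp[of n] by linarith
  then have "1 \<le> Suc n \<and> n < 2 ^ Suc n" by simp
  from LeastI[of "\<lambda>l. 1 \<le> l \<and> n < 2 ^ l", OF this]
  show "1 \<le> log_bound n" "n < 2 ^ log_bound n" by (auto simp: log_bound_def)
qed

lemma log_bound_eqI:
  assumes "n < 2 ^ Suc i" "i = 0 \<or> 2 ^ i \<le> n"
  shows "log_bound n = Suc i"
  unfolding log_bound_def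
proof (rule Least_equality)
  show "1 \<le> Suc i \<and> n < 2 ^ Suc i" using assms by simp
  fix l :: nat assume l: "1 \<le> l \<and> n < 2 ^ l"
  show "Suc i \<le> l"
  proof (rule ccontr)
    assume "\<not> Suc i \<le> l"
    then have "l \<le> i" by simp
    then have "(2::nat) ^ l \<le> 2 ^ i" by (rule power_increasing) simp
    moreover have "2 ^ i \<le> n" using assms(2) l \<open>l \<le> i\<close> by auto
    ultimately show False using l by linarith
  qed
qed

text \<open>By convention \<open>log 2 0 = 0\<close>, so the estimate covers the graph without
  vertices too.\<close>

lemma log_bound_le: "real (log_bound n) \<le> log 2 (real n) + 2"
proof (cases "log_bound n = 1")
  case True
  have "0 \<le> log 2 (real n)" by (cases "n = 0") (auto simp: log_def)
  then show ?thesis using True by simp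
next
  case False
  then obtain i where i: "log_bound n = Suc i" "1 \<le> i" using log_bound(1)[of n] by (cases "log_bound n") auto
  have "\<not> (1 \<le> i \<and> n < 2 ^ i)" using not_less_Least[of i "\<lambda>l. 1 \<le> l \<and> n < 2 ^ l"] i(1) unfolding log_bound_def by simp
  then have "2 ^ i \<le> n" using i by simp
  then have "real (2 ^ i) \<le> real n" by (simp only: of_nat_le_iff)
  then have le: "(2::real) ^ i \<le> real n" by simp
  then have "log 2 (2 ^ i) \<le> log 2 (real n)"
    by (intro log_mono) auto
  then show ?thesis using i by simp
qed

lemma sqrt_bound: "n \<le> sqrt_bound n * sqrt_bound n"
proof -
  have "n \<le> n * n" by (cases n) auto
  from LeastI[of "\<lambda>r. n \<le> r * r", OF this] show ?thesis unfolding sqrt_bound_def .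
qed

lemma sqrt_bound_eqI:
  assumes "n \<le> i * i" "i = 0 \<or> (i - 1) * (i - 1) < n"
  shows "sqrt_bound n = i"
  unfolding sqrt_bound_def
proof (rule Least_equality)
  fix r assume r: "n \<le> r * r"
  show "i \<le> r"
  proof (rule ccontr)
    assume "\<not> i \<le> r"
    then have "r * r \<le> (i - 1) * (i - 1)" by (intro mult_le_mono) auto
    then show False using r assms(2) \<open>\<not> i \<le> r\<close> by auto
  qed
qed fact

lemma sqrt_bound_le: "real (sqrt_bound n) \<le> sqrt (real n) + 1"
proof (cases "sqrt_bound n")
  case (Suc i)
  have "\<not> n \<le> i * i" using not_less_Least[of i "\<lambda>r. n \<le> r * r"] Suc unfolding sqrt_bound_def by simp
  then have "real i * real i \<le> real n" by (simp flip: of_nat_mult)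
  then have "real i \<le> sqrt (real n)" by (intro real_le_rsqrt) (simp add: power2_eq_square)
  then show ?thesis using Suc by simp
qed simp

lemma sqrt_le_sqrt_bound: "sqrt (real n) \<le> real (sqrt_bound n)"
proof (rule real_le_lsqrt)
  have "real n \<le> real (sqrt_bound n * sqrt_bound n)" using sqrt_bound[of n] by (simp only: of_nat_le_iff)
  then show "real n \<le> (real (sqrt_bound n))\<^sup>2" by (simp add: power2_eq_square)
qed simp

text \<open>Scalar 32 holds the square of scalar 31, updated by adding \<open>2 * i + 1\<close>;
  both start from cleared memory.\<close>

definition Sqrt :: prog where
  "Sqrt = Loop (Less (V 32) (V 0)) (Seq (Assign 32 (Add (V 32) (Add (V 31) (Add (V 31) (Const 1)))))
     (Assign 31 (Add (V 31) (Const 1))))"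

lemma runs_Sqrt:
  assumes "n \<le> N" "fst m 0 0 = n" "fst m 31 0 = 0" "fst m 32 0 = 0"
  shows "runs N Sqrt m (\<lambda>m'. agree {31, 32} m m' \<and> fst m' 31 0 = sqrt_bound n)"
  unfolding Sqrt_def
proof (rule runs_Loop[where Inv = "\<lambda>i m'. agree {31, 32} m m' \<and> fst m' 31 0 = i \<and> fst m' 32 0 = i * i \<and>
    (i = 0 \<or> (i - 1) * (i - 1) < n)"], goal_cases)
  case (2 i m')
  have "fst m' 0 0 = n" using agreeD[OF conjunct1[OF 2(1)]] assms by simp
  then have ii: "i * i < n" using 2 by simp
  moreover have "i \<le> i * i" by (cases i) auto
  ultimately have "i < N" using assms by linarith
  then show ?case by (intro conjI runs_Seq runs_Store) (use 2 ii in auto)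
next
  case (3 i m')
  have "fst m' 0 0 = n" using agreeD[OF conjunct1[OF 3(1)]] assms by simp
  then show ?case using 3 sqrt_bound_eqI[of n i] by auto
qed (use assms in auto)

definition Log :: prog where
  "Log = Seq (Assign 31 (Const 1)) (Seq (Assign 32 (Const 2)) (Loop (Less (V 32) (Add (V 0) (Const 1)))
     (Seq (Assign 32 (Add (V 32) (V 32))) (Assign 31 (Add (V 31) (Const 1))))))"

lemma runs_Log:
  assumes "n \<le> N" "fst m 0 0 = n"
  shows "runs N Log m (\<lambda>m'. agree {31, 32} m m' \<and> fst m' 31 0 = log_bound n)"
  unfolding Log_def
proof (rule runs_Seq, rule runs_Store, rule runs_Seq, rule runs_Store,
    rule runs_Loop[where Inv = "\<lambda>i m'. agree {31, 32} m m' \<and> fst m' 31 0 = Suc i \<and> fst m' 32 0 = 2 ^ Suc i \<and>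
    (i = 0 \<or> 2 ^ i \<le> n)"], goal_cases)
  case (2 i m')
  have "fst m' 0 0 = n" using agreeD[OF conjunct1[OF 2(1)]] assms by simp
  then have ii: "2 ^ Suc i \<le> n" using 2 by simp
  moreover have "i < 2 ^ Suc i" by (rule less_trans[OF _ less_exp]) simp
  ultimately have "i < N" using assms by linarith
  then show ?case by (intro conjI runs_Seq runs_Store) (use 2 ii in auto)
next
  case (3 i m')
  have "fst m' 0 0 = n" using agreeD[OF conjunct1[OF 3(1)]] assms by simp
  then show ?case using 3 log_bound_eqI[of n i] by auto
qed (use assms in auto)

text \<open>Division by repeated addition: the ceiling of \<open>1 / \<epsilon>\<close> is the
  number of copies of \<open>\<epsilon>\<close> needed to reach 1.\<close>

definition Ceil_inverse :: prog where
  "Ceil_inverse = Loop (RLess (Reg 1) (OfNat (Const 1)))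
     (Seq (RStore 1 (RAdd (Reg 1) (Reg 0))) (Assign 33 (Add (V 33) (Const 1))))"

lemma runs_Ceil_inverse:
  assumes "0 < \<epsilon>" "nat \<lceil>1 / \<epsilon>\<rceil> \<le> N" "snd m 0 = \<epsilon>" "snd m 1 = 0" "fst m 33 0 = 0"
  shows "runs N Ceil_inverse m (\<lambda>m'. agree {33} m m' \<and> fst m' 33 0 = nat \<lceil>1 / \<epsilon>\<rceil>)"
  unfolding Ceil_inverse_def
proof (rule runs_Loop[where Inv = "\<lambda>i m'. agree {33} m m' \<and> fst m' 33 0 = i \<and> snd m' 0 = \<epsilon> \<and> snd m' 1 = real i * \<epsilon> \<and>
    i \<le> nat \<lceil>1 / \<epsilon>\<rceil>"], goal_cases)
  case (2 i m')
  then have "real i * \<epsilon> < 1" by simp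
  then have "real i < 1 / \<epsilon>" using assms by (simp add: field_simps)
  also have "\<dots> \<le> real (nat \<lceil>1 / \<epsilon>\<rceil>)" by (rule real_nat_ceiling_ge)
  finally have "i < nat \<lceil>1 / \<epsilon>\<rceil>" by simp
  moreover from this have "i < N" using assms(2) by linarith
  moreover have "agree {33} m (upd 33 0 (Suc i) (fst m', (snd m')(1 := r)))" for r
    using 2 by (auto simp: agree_def)
  ultimately show ?case
    by (intro conjI runs_Seq runs_RStore runs_Store) (use 2 in \<open>auto simp: algebra_simps\<close>)
next
  case (3 i m')
  then have "1 \<le> real i * \<epsilon>" by simp
  then have "1 / \<epsilon> \<le> real i" using assms by (simp add: field_simps)
  then have "nat \<lceil>1 / \<epsilon>\<rceil> \<le> i" by (simp add: ceiling_le_iff nat_le_iff)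
  then have "i = nat \<lceil>1 / \<epsilon>\<rceil>" using 3 by (intro antisym) auto
  then show ?case using 3 by blast
qed (use assms in auto)

definition Mult :: "nat \<Rightarrow> nat \<Rightarrow> nat \<Rightarrow> prog" where
  "Mult d x y = Seq (Assign d (Const 0)) (Seq (Assign 38 (Const 0)) (Loop (Less (V 38) (V x))
     (Seq (Assign d (Add (V d) (V y))) (Assign 38 (Add (V 38) (Const 1))))))"

lemma runs_Mult:
  assumes "fst m x 0 \<le> N" "distinct [d, x, y, 38] \<or> distinct [d, x, 38] \<and> x = y"
  shows "runs N (Mult d x y) m (\<lambda>m'. agree {d, 38} m m' \<and> fst m' d 0 = fst m x 0 * fst m y 0)"
  unfolding Mult_def
proof (rule runs_Seq, rule runs_Store, rule runs_Seq, rule runs_Store,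
    rule runs_Loop[where Inv = "\<lambda>i m'. agree {d, 38} m m' \<and> fst m' 38 0 = i \<and> fst m' d 0 = i * fst m y 0 \<and> i \<le> fst m x 0"], goal_cases)
  case (2 i m')
  have "fst m' x 0 = fst m x 0" "fst m' y 0 = fst m y 0" using agreeD[OF conjunct1[OF 2(1)]] assms by auto
  then show ?case by (intro conjI runs_Seq runs_Store) (use 2 assms in auto)
next
  case (3 i m')
  have "fst m' x 0 = fst m x 0" using agreeD[OF conjunct1[OF 3(1)]] assms by auto
  then show ?case using 3 by auto
qed (use assms in auto)

text \<open>Scalars 31 and 33 hold \<open>l\<close> and \<open>q\<close>, while 34, 35 and 36
  receive \<open>l^2\<close>, \<open>l^3\<close> and \<open>q * l^3\<close>.\<close>

definition Approx_prog :: "nat \<Rightarrow> prog" where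
  "Approx_prog t = Seq Ceil_inverse (Seq Log (Seq (Mult 34 31 31) (Seq (Mult 35 31 34) (Seq (Mult 36 33 35)
     (Seq (Assign 30 (scale t (Add (V 36) (V 31)))) Solve)))))"

definition Exact_prog :: "nat \<Rightarrow> prog" where
  "Exact_prog t = Seq Sqrt (Seq (Assign 30 (scale (8 * t) (V 31))) Solve)"

context wgraph begin

lemma size_bound_le:
  assumes "n < 2 ^ l"
  shows "size_bound ({..<n}, k, 0, 1) \<le> 2 ^ (3 * l * k + 2 * l)"
proof -
  have "n ^ 3 + n + 1 \<le> (n + 1) ^ 3" by (simp add: power3_eq_cube algebra_simps)
  also have "\<dots> \<le> (2 ^ l) ^ 3" using assms by (intro power_mono) auto
  finally have "(n ^ 3 + n + 1) ^ k \<le> ((2 ^ l) ^ 3) ^ k" by (intro power_mono) auto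
  moreover have "n\<^sup>2 + 1 \<le> (n + 1)\<^sup>2" by (simp add: power2_eq_square)
  then have "n\<^sup>2 + 1 \<le> (2 ^ l)\<^sup>2" using assms by (elim order.trans) (intro power_mono; simp)
  ultimately have "(n ^ 3 + n + 1) ^ k * (n\<^sup>2 + 1) \<le> ((2 ^ l) ^ 3) ^ k * (2 ^ l)\<^sup>2" by (rule mult_le_mono)
  also have "\<dots> = 2 ^ (3 * l * k + 2 * l)" by (simp add: power_mult[symmetric] power_add mult_ac)
  finally show ?thesis by (simp add: size_bound_def)
qed

lemma runs_Exact_prog:
  assumes m: "static m" "\<forall>a\<ge>3. \<forall>i. fst m a i = 0"
    and N: "N = 2 ^ (3 * log_bound n * (8 * t * sqrt_bound n) + 2 * log_bound n)"
  shows "runs N (Exact_prog t) m (\<lambda>m'. output_set m' \<subseteq> {..<n} \<and> indep (output_set m') \<and>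
    val {..<n} (8 * t * sqrt_bound n) \<le> wt (output_set m'))"
  unfolding Exact_prog_def
proof -
  have "n < 2 ^ log_bound n" by (rule log_bound)
  also have "\<dots> \<le> N" unfolding N by (rule power_increasing) auto
  finally have nN: "n \<le> N" by simp
  have n0: "fst m 0 0 = n" using m by (simp add: static_def)
  show "runs N (Seq Sqrt (Seq (Assign 30 (scale (8 * t) (V 31))) Solve)) m
    (\<lambda>m'. output_set m' \<subseteq> {..<n} \<and> indep (output_set m') \<and> val {..<n} (8 * t * sqrt_bound n) \<le> wt (output_set m'))"
  proof (rule runs_Seq, rule runs_mono[OF runs_Sqrt[OF nN n0]], goal_cases)
    case (3 m1)
    define m2 where "m2 = upd 30 0 (8 * t * sqrt_bound n) m1"
    have ag: "agree {30, 31, 32} m m2" using 3 by (auto simp: m2_def agree_def)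
    show ?case
    proof (rule runs_Seq, rule runs_Store, rule runs_Solve[OF nN])
      show "size_bound ({..<n}, 8 * t * sqrt_bound n, 0, 1) \<le> N"
        unfolding N by (rule size_bound_le) (rule log_bound)
      have u: "upd 30 (nval (Const 0) m1) (nval (scale (8 * t) (V 31)) m1) m1 = m2" using 3 by (simp add: m2_def)
      show "static (upd 30 (nval (Const 0) m1) (nval (scale (8 * t) (V 31)) m1) m1)"
        unfolding u using static_agree[OF m(1) ag] by simp
      show "\<forall>a\<in>{3..11}. \<forall>i. fst (upd 30 (nval (Const 0) m1) (nval (scale (8 * t) (V 31)) m1) m1) a i = 0"
        unfolding u using m(2) agreeD[OF ag] by auto
      show "fst (upd 30 (nval (Const 0) m1) (nval (scale (8 * t) (V 31)) m1) m1) 30 0 = 8 * t * sqrt_bound n"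
        unfolding u by (simp add: m2_def)
    qed
  qed (use m in auto)
qed

text \<open>The summand \<open>q\<close> in the exponent of \<open>N\<close> provides for the loops
  that count to \<open>q\<close>; the other summands cover the tree.\<close>

lemma runs_Approx_prog:
  assumes m: "static m" "\<forall>a\<ge>3. \<forall>i. fst m a i = 0" "snd m 0 = \<epsilon>" "snd m 1 = 0" and \<epsilon>: "0 < \<epsilon>"
    and q: "q = nat \<lceil>1 / \<epsilon>\<rceil>" and l: "l = log_bound n" and k: "k = t * (q * (l * (l * l)) + l)"
    and N: "N = 2 ^ (3 * l * k + 2 * l + q)"
  shows "runs N (Approx_prog t) m (\<lambda>m'. output_set m' \<subseteq> {..<n} \<and> indep (output_set m') \<and>
    val {..<n} k \<le> wt (output_set m'))"
proof -
  have "n < 2 ^ l" unfolding l by (rule log_bound)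
  also have "\<dots> \<le> N" unfolding N by (rule power_increasing) auto
  finally have nN: "n \<le> N" by simp
  have "l < 2 ^ l" by (rule less_exp)
  also have "\<dots> \<le> N" unfolding N by (rule power_increasing) auto
  finally have lN: "l \<le> N" by simp
  have "q < 2 ^ q" by (rule less_exp)
  also have "\<dots> \<le> N" unfolding N by (rule power_increasing) auto
  finally have qN: "q \<le> N" by simp
  have "size_bound ({..<n}, k, 0, 1) \<le> 2 ^ (3 * l * k + 2 * l)" unfolding l by (rule size_bound_le) (rule log_bound)
  also have "\<dots> \<le> N" unfolding N by (rule power_increasing) auto
  finally have sN: "size_bound ({..<n}, k, 0, 1) \<le> N" .
  have n0: "fst m 0 0 = n" using m by (simp add: static_def)
  let ?P4 = "Seq (Assign 30 (scale t (Add (V 36) (V 31)))) Solve"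
  let ?P3 = "Seq (Mult 36 33 35) ?P4"
  let ?P2 = "Seq (Mult 35 31 34) ?P3"
  let ?P1 = "Seq (Mult 34 31 31) ?P2"
  let ?Q = "\<lambda>m'. output_set m' \<subseteq> {..<n} \<and> indep (output_set m') \<and> val {..<n} k \<le> wt (output_set m')"
  show ?thesis unfolding Approx_prog_def
  proof (rule runs_Seq, rule runs_mono[OF runs_Ceil_inverse[OF \<epsilon> qN[unfolded q] m(3,4)]])
    show "fst m 33 0 = 0" using m by simp
    fix m1 assume m1: "agree {33} m m1 \<and> fst m1 33 0 = nat \<lceil>1 / \<epsilon>\<rceil>"
    have n1: "fst m1 0 0 = n" using agreeD[OF conjunct1[OF m1]] n0 by simp
    show "runs N (Seq Log ?P1) m1 ?Q"
    proof (rule runs_Seq, rule runs_mono[OF runs_Log[OF nN n1]])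
      fix m2 assume m2: "agree {31, 32} m1 m2 \<and> fst m2 31 0 = log_bound n"
      have l2: "fst m2 31 0 = l" using m2 l by simp
      show "runs N ?P1 m2 ?Q"
      proof (rule runs_Seq, rule runs_mono[OF runs_Mult])
        fix m3 assume m3: "agree {34, 38} m2 m3 \<and> fst m3 34 0 = fst m2 31 0 * fst m2 31 0"
        have l3: "fst m3 31 0 = l" using agreeD[OF conjunct1[OF m3]] l2 by simp
        show "runs N ?P2 m3 ?Q"
        proof (rule runs_Seq, rule runs_mono[OF runs_Mult])
          fix m4 assume m4: "agree {35, 38} m3 m4 \<and> fst m4 35 0 = fst m3 31 0 * fst m3 34 0"
          have q4: "fst m4 33 0 = q" using agreeD[OF conjunct1[OF m4]] agreeD[OF conjunct1[OF m3]]
            agreeD[OF conjunct1[OF m2]] m1 q by simp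
          show "runs N ?P3 m4 ?Q"
          proof (rule runs_Seq, rule runs_mono[OF runs_Mult])
            fix m5 assume m5: "agree {36, 38} m4 m5 \<and> fst m5 36 0 = fst m4 33 0 * fst m4 35 0"
            have "fst m5 31 0 = l" using agreeD[OF conjunct1[OF m5]] agreeD[OF conjunct1[OF m4]] l3 by simp
            moreover have "fst m5 36 0 = q * (l * (l * l))" using m5 q4 m4 m3 l2 l3 by simp
            ultimately have k5: "nval (scale t (Add (V 36) (V 31))) m5 = k" by (simp add: k)
            define m6 where "m6 = upd 30 0 k m5"
            have ag: "agree {30..38} m m6" using m1 m2 m3 m4 m5 by (auto simp: m6_def agree_def)
            show "runs N ?P4 m5 ?Q"
            proof (rule runs_Seq, rule runs_Store, rule runs_Solve[OF nN sN])
              have u: "upd 30 (nval (Const 0) m5) (nval (scale t (Add (V 36) (V 31))) m5) m5 = m6"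
                unfolding k5 by (simp add: m6_def)
              show "static (upd 30 (nval (Const 0) m5) (nval (scale t (Add (V 36) (V 31))) m5) m5)"
                unfolding u using static_agree[OF m(1) ag] by simp
              show "\<forall>a\<in>{3..11}. \<forall>i. fst (upd 30 (nval (Const 0) m5) (nval (scale t (Add (V 36) (V 31))) m5) m5) a i = 0"
                unfolding u using m(2) agreeD[OF ag] by auto
              show "fst (upd 30 (nval (Const 0) m5) (nval (scale t (Add (V 36) (V 31))) m5) m5) 30 0 = k"
                unfolding u by (simp add: m6_def)
            qed
          qed (use q4 qN in auto)
        qed (use l3 lN in auto)
      qed (use l2 lN in auto)
    qed
  qed
qed

end

section \<open>The two algorithms\<close>

lemma (in pair_graph) sgraph_arcs: "sgraph (\<lambda>u v. (u, v) \<in> parcs G)"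
proof
  show "(v, u) \<in> parcs G" if "(u, v) \<in> parcs G" for u v
    using pair_sym_arcs that unfolding symmetric_def by (auto dest: symD)
  show "(v, v) \<notin> parcs G" for v using pair_no_loops[of "(v, v)"] by auto
qed

text \<open>A hole lists its vertices in cyclic order, so the subgraph induced on them has exactly
  the cyclically consecutive pairs as edges.\<close>

lemma (in pair_graph) hole_induces_cycle:
  assumes hole: "sgraph.hole (\<lambda>u v. (u, v) \<in> parcs G) vs" and len: "3 \<le> length vs"
  obtains H where "cycle_graph (length vs) H" "induced_subgraph (with_proj H) (with_proj G)"
proof -
  interpret S: sgraph "\<lambda>u v. (u, v) \<in> parcs G" by (rule sgraph_arcs)
  let ?k = "length vs"
  have d: "distinct vs" using hole by (simp add: S.hole_def)
  have adj: "(vs ! i, vs ! j) \<in> parcs G \<longleftrightarrow> j = Suc i \<or> i = 0 \<and> j = ?k - 1" if "i < j" "j < ?k" for i j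
    using hole that by (simp add: S.hole_def)
  have next_adj: "(vs ! i, vs ! (Suc i mod ?k)) \<in> parcs G" if "i < ?k" for i
  proof (cases "Suc i < ?k")
    case True
    then show ?thesis using adj[of i "Suc i"] by simp
  next
    case False
    then have "Suc i = ?k" using that by simp
    then have "(vs ! 0, vs ! i) \<in> parcs G" using adj[of 0 i] len by simp
    then show ?thesis using S.sym \<open>Suc i = ?k\<close> by simp
  qed
  define H where "H = \<lparr>pverts = set vs, parcs = {(u, v) \<in> parcs G. u \<in> set vs \<and> v \<in> set vs}\<rparr>"
  have "parcs H = {(u, v). \<exists>i<?k. {u, v} = {vs ! i, vs ! (Suc i mod ?k)}}"
  proof (intro subset_antisym subsetI)
    fix e assume "e \<in> parcs H"
    then obtain a b where e: "e = (vs ! a, vs ! b)" "e \<in> parcs G" "a < ?k" "b < ?k"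
      by (auto simp: H_def in_set_conv_nth)
    have consec: "\<exists>i<?k. {vs ! a, vs ! b} = {vs ! i, vs ! (Suc i mod ?k)}"
      if ab: "a < b" "b < ?k" "(vs ! a, vs ! b) \<in> parcs G" for a b
    proof (cases "b = Suc a")
      case True
      then show ?thesis using ab by (intro exI[of _ a]) auto
    next
      case False
      \<comment> \<open>The remaining edge joins the two ends; \<open>mod\<close> makes it the step
        from the last index \<open>b\<close> back to 0.\<close>
      then have "a = 0" "Suc b = ?k" using adj[OF ab(1,2)] ab(3) len by auto
      then show ?thesis using ab by (intro exI[of _ b]) auto
    qed
    have "a \<noteq> b" using e S.irrefl by auto
    moreover have "(vs ! b, vs ! a) \<in> parcs G" using e S.sym by auto
    ultimately have "\<exists>i<?k. {vs ! a, vs ! b} = {vs ! i, vs ! (Suc i mod ?k)}"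
      using e consec[of a b] consec[of b a] by (cases a b rule: linorder_cases) (auto simp: insert_commute)
    then show "e \<in> {(u, v). \<exists>i<?k. {u, v} = {vs ! i, vs ! (Suc i mod ?k)}}" using e by simp
  next
    fix e assume "e \<in> {(u, v). \<exists>i<?k. {u, v} = {vs ! i, vs ! (Suc i mod ?k)}}"
    then obtain u v i where e: "e = (u, v)" "i < ?k" "{u, v} = {vs ! i, vs ! (Suc i mod ?k)}" by auto
    have "Suc i mod ?k < ?k" using len by (intro mod_less_divisor) linarith
    then have "vs ! i \<in> set vs" "vs ! (Suc i mod ?k) \<in> set vs" using e(2) by auto
    then show "e \<in> parcs H" using next_adj[OF e(2)] S.sym e by (auto simp: H_def doubleton_eq_iff)
  qed
  then have "cycle_graph ?k H" unfolding cycle_graph_def using len d by (auto simp: H_def intro!: exI[of _ vs])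
  moreover have "induced_subgraph (with_proj H) (with_proj G)"
  proof -
    have sub: "set vs \<subseteq> pverts G"
    proof
      fix v assume "v \<in> set vs"
      then obtain i where "i < ?k" "v = vs ! i" by (auto simp: in_set_conv_nth)
      then show "v \<in> pverts G" using next_adj in_arcsD1 by blast
    qed
    have wf: "wf_digraph (with_proj H)" "wf_digraph (with_proj G)"
      by (auto simp: wf_digraph_def H_def intro: in_arcsD1 in_arcsD2)
    show ?thesis unfolding induced_subgraph_def subgraph_def compatible_def
      using sub wf by (auto simp: H_def)
  qed
  ultimately show ?thesis by (rule that)
qed

text \<open>\<open>A\<close> and \<open>d\<close> depend on the program alone and so serve all
  inputs. For \<open>N = 2 ^ X\<close> a polynomial in \<open>N\<close> is at most 2 to a linear
  function of \<open>X\<close>.\<close>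

lemma runs_time:
  obtains A d where "\<And>N X m Q. N = 2 ^ X \<Longrightarrow> runs N P m Q \<Longrightarrow>
    \<exists>T m'. exec P m T m' \<and> T \<le> 2 ^ (A + d * (X + 1)) \<and> Q m'"
proof -
  obtain A d where A: "\<And>N. loop_cost N P \<le> A * (N + 1) ^ d"
    using poly_bounded_loop_cost unfolding poly_bounded_def by blast
  have bound: "loop_cost (2 ^ X) P \<le> 2 ^ (A + d * (X + 1))" for X
  proof -
    have "(1::nat) \<le> 2 ^ X" by simp
    then have "(2::nat) ^ X + 1 \<le> 2 ^ (X + 1)" unfolding power_add power_one_right by linarith
    then have "((2::nat) ^ X + 1) ^ d \<le> (2 ^ (X + 1)) ^ d" by (rule power_mono) simp
    moreover have "A \<le> 2 ^ A" using less_exp[of A] by linarith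
    ultimately have "A * (2 ^ X + 1) ^ d \<le> 2 ^ A * (2 ^ (X + 1)) ^ d" by (intro mult_le_mono)
    also have "\<dots> = 2 ^ (A + d * (X + 1))" by (simp add: power_add power_mult[symmetric] mult.commute)
    finally show ?thesis using A[of "2 ^ X"] by linarith
  qed
  show ?thesis
  proof (rule that)
    fix N X m Q assume "N = 2 ^ X" "runs N P m Q"
    then show "\<exists>T m'. exec P m T m' \<and> T \<le> 2 ^ (A + d * (X + 1)) \<and> Q m'"
      using bound[of X] unfolding runs_def by (meson order.trans)
  qed
qed

locale hole_free_instance =
  fixes t n :: nat and G :: "nat pair_pre_digraph" and w :: "nat \<Rightarrow> nat"
  assumes t: "4 \<le> t" and graph: "pair_graph G" and verts: "pverts G = {..<n}"
    and free: "no_long_induced_cycle t G"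
begin

sublocale wgraph "\<lambda>u v. (u, v) \<in> parcs G" n w
  using pair_graph.sgraph_arcs[OF graph] by (simp add: wgraph_def)

lemma no_hole:
  assumes "hole xs"
  shows "length xs < t"
proof (rule ccontr)
  assume "\<not> length xs < t"
  then have "t \<le> length xs" "3 \<le> length xs" using t by auto
  moreover obtain H where "cycle_graph (length xs) H" "induced_subgraph (with_proj H) (with_proj G)"
    using pair_graph.hole_induces_cycle[OF graph assms \<open>3 \<le> length xs\<close>] .
  ultimately show False using free unfolding no_long_induced_cycle_def by blast
qed

lemma independent_set_iff: "independent_set G I \<longleftrightarrow> I \<subseteq> {..<n} \<and> indep I"
  by (simp add: independent_set_def indep_def verts)

lemma graph_input:
  assumes "fst m = graph_input n G w"
  shows "static m" "\<forall>a\<ge>3. \<forall>i. fst m a i = 0"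
proof -
  have "i * n + j < n * n" if "i < n" "j < n" for i j
  proof -
    have "i * n + j < Suc i * n" using that by simp
    also have "\<dots> \<le> n * n" using that by (intro mult_le_mono1) simp
    finally show ?thesis .
  qed
  then show "static m" by (simp add: static_def assms graph_input_def)
  show "\<forall>a\<ge>3. \<forall>i. fst m a i = 0" by (simp add: assms graph_input_def)
qed

end

text \<open>From \<open>n = 2\<close> on, \<open>sqrt n\<close> and \<open>log 2 n\<close> are at
  least 1, so their product absorbs all rounding terms.\<close>

lemma exact_time_bigo:
  "(\<lambda>n. real (A + d * (3 * log_bound n * (8 * t * sqrt_bound n) + 2 * log_bound n + 1)))
     \<in> O(\<lambda>n. real n powr (1/2) * log 2 (real n))"
proof (rule bigoI, rule eventually_mono[OF eventually_ge_at_top[of 2]])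
  fix n :: nat assume n: "2 \<le> n"
  define s where "s = sqrt (real n)"
  define g where "g = log 2 (real n)"
  have s1: "1 \<le> s" using n by (simp add: s_def)
  have "log 2 2 \<le> log 2 (real n)" using n by (intro log_mono) auto
  then have g1: "1 \<le> g" by (simp add: g_def)
  have L: "real (log_bound n) \<le> 3 * g" using log_bound_le[of n] g1 unfolding g_def by linarith
  have R: "real (sqrt_bound n) \<le> 2 * s" using sqrt_bound_le[of n] s1 unfolding s_def by linarith
  have sg: "1 \<le> s * g" "g \<le> s * g" using mult_mono[OF s1 g1] mult_right_mono[OF s1, of g] g1 by auto
  have "real (3 * log_bound n * (8 * t * sqrt_bound n)) \<le> 3 * (3 * g) * (8 * real t * (2 * s))"
    unfolding of_nat_mult of_nat_numeral using g1 s1 by (intro mult_mono L R order.refl) auto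
  then have "real (3 * log_bound n * (8 * t * sqrt_bound n) + 2 * log_bound n + 1) \<le> (144 * real t + 7) * (s * g)"
    using L sg by (simp add: algebra_simps)
  then have "real d * real (3 * log_bound n * (8 * t * sqrt_bound n) + 2 * log_bound n + 1) \<le> real d * ((144 * real t + 7) * (s * g))"
    by (rule mult_left_mono) simp
  moreover have "real A * 1 \<le> real A * (s * g)" by (intro mult_left_mono sg) simp
  ultimately have "real (A + d * (3 * log_bound n * (8 * t * sqrt_bound n) + 2 * log_bound n + 1))
    \<le> (real A + real d * (144 * real t + 7)) * (s * g)" by (simp add: algebra_simps)
  moreover have "real n powr (1/2) * log 2 (real n) = s * g" using n by (simp add: powr_half_sqrt s_def g_def)
  ultimately show "norm (real (A + d * (3 * log_bound n * (8 * t * sqrt_bound n) + 2 * log_bound n + 1)))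
    \<le> (real A + real d * (144 * real t + 7)) * norm (real n powr (1/2) * log 2 (real n))"
    using sg by simp
qed

theorem theorem1p4:
  fixes t :: nat
  assumes "4 \<le> t"
  shows
    "(\<exists>(p :: real poly poly) (P :: prog).
        \<forall>(n :: nat) (G :: nat pair_pre_digraph) (w :: nat \<Rightarrow> nat) (\<epsilon> :: real).
          pair_graph G \<and> pverts G = {..<n} \<and> no_long_induced_cycle t G \<and> \<epsilon> > 0 \<longrightarrow>
          (\<exists>T m. exec P (input_with_real n G w \<epsilon>) T m \<and>
             real T \<le> 2 powr poly2 p (log 2 (real n)) (inverse \<epsilon>) \<and>
             independent_set G (output_set m) \<and>
             (\<forall>I'. independent_set G I' \<longrightarrow>
                real (\<Sum>v\<in>output_set m. w v) \<ge> (1 - \<epsilon>) * real (\<Sum>v\<in>I'. w v))))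
     \<and>
     (\<exists>(f :: nat \<Rightarrow> real) (P :: prog).
        f \<in> O(\<lambda>n. real n powr (1/2) * log 2 (real n)) \<and>
        (\<forall>(n :: nat) (G :: nat pair_pre_digraph) (w :: nat \<Rightarrow> nat).
          pair_graph G \<and> pverts G = {..<n} \<and> no_long_induced_cycle t G \<longrightarrow>
          (\<exists>T m. exec P (input n G w) T m \<and>
             real T \<le> 2 powr f n \<and>
             independent_set G (output_set m) \<and>
             (\<forall>I'. independent_set G I' \<longrightarrow> (\<Sum>v\<in>I'. w v) \<le> (\<Sum>v\<in>output_set m. w v)))))"
proof (rule conjI, goal_cases)
  case 1
  obtain A d where time: "\<And>N X m Q. N = 2 ^ X \<Longrightarrow> runs N (Approx_prog t) m Q \<Longrightarrow>
    \<exists>T m'. exec (Approx_prog t) m T m' \<and> T \<le> 2 ^ (A + d * (X + 1)) \<and> Q m'"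
    using runs_time[of "Approx_prog t"] by metis
  \<comment> \<open>For \<open>poly2\<close> the outer variable is \<open>log 2 n\<close> and the
    inner one \<open>1 / \<epsilon>\<close>. Thus \<open>x\<close> stands for
    \<open>log 2 n + 2\<close> and \<open>y\<close> for \<open>1 / \<epsilon> + 1\<close>, upper
    estimates of \<open>l\<close> and \<open>q\<close>, and \<open>p\<close> repeats the exponent of
    the running time with these estimates.\<close>
  define c :: "real \<Rightarrow> real poly poly" where "c r = [:[:r:]:]" for r
  define x :: "real poly poly" where "x = [:[:2:], [:1:]:]"
  define y :: "real poly poly" where "y = [:[:1, 1:]:]"
  define p where "p = c A + c d * (c 3 * x * (c t * (y * (x * (x * x)) + x)) + c 2 * x + y + c 1)"
  have p: "poly2 p a b = real A + real d * (3 * (a + 2) * (real t * ((b + 1) * ((a + 2) * ((a + 2) * (a + 2))) + (a + 2)))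
      + 2 * (a + 2) + (b + 1) + 1)" for a b
  proof -
    have 1: "poly2 (u + v) a b = poly2 u a b + poly2 v a b" "poly2 (u * v) a b = poly2 u a b * poly2 v a b" for u v
      by (simp_all add: poly2_def)
    have 2: "poly2 (c r) a b = r" for r by (simp add: poly2_def c_def)
    have 3: "poly2 x a b = a + 2" "poly2 y a b = b + 1" by (simp_all add: poly2_def x_def y_def)
    show ?thesis unfolding p_def 1 2 3 by (rule refl)
  qed
  show ?case
  proof (rule exI[of _ p], rule exI[of _ "Approx_prog t"], intro allI impI, elim conjE)
    fix n :: nat and G :: "nat pair_pre_digraph" and w :: "nat \<Rightarrow> nat" and \<epsilon> :: real
    assume G: "pair_graph G" "pverts G = {..<n}" "no_long_induced_cycle t G" and \<epsilon>: "\<epsilon> > 0"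
    interpret hole_free_instance t n G w by (rule hole_free_instance.intro[OF assms G])
    define q where "q = nat \<lceil>1 / \<epsilon>\<rceil>"
    define l where "l = log_bound n"
    define k where "k = t * (q * (l * (l * l)) + l)"
    let ?m = "input_with_real n G w \<epsilon>"
    have fm: "fst ?m = graph_input n G w" by (simp add: input_with_real_def)
    have "runs (2 ^ (3 * l * k + 2 * l + q)) (Approx_prog t) ?m (\<lambda>m'. output_set m' \<subseteq> {..<n} \<and> indep (output_set m') \<and>
      val {..<n} k \<le> wt (output_set m'))"
      by (rule runs_Approx_prog[OF graph_input[OF fm] _ _ \<epsilon> q_def l_def k_def refl]) (simp_all add: input_with_real_def)
    from time[OF refl this] obtain T m' where T: "exec (Approx_prog t) ?m T m'"
      "T \<le> 2 ^ (A + d * (3 * l * k + 2 * l + q + 1))" "output_set m' \<subseteq> {..<n}" "indep (output_set m')"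
      "val {..<n} k \<le> wt (output_set m')" by blast
    have q1: "1 \<le> q" using \<epsilon> by (simp add: q_def Suc_leI)
    have qe: "1 / \<epsilon> \<le> real q" unfolding q_def by (rule real_nat_ceiling_ge)
    have qle: "real q \<le> inverse \<epsilon> + 1"
      using \<epsilon> of_int_ceiling_le_add_one[of "1 / \<epsilon>"] by (simp add: q_def inverse_eq_divide)
    have l1: "1 \<le> l" "n < 2 ^ l" unfolding l_def by (rule log_bound)+
    have lle: "real l \<le> log 2 (real n) + 2" unfolding l_def by (rule log_bound_le)
    have "real T \<le> 2 powr poly2 p (log 2 (real n)) (inverse \<epsilon>)"
    proof -
      let ?x = "log 2 (real n) + 2" and ?y = "inverse \<epsilon> + 1"
      have pos: "0 \<le> ?x" "0 \<le> ?y" using lle l1 \<epsilon> by (auto intro: order.trans[OF of_nat_0_le_iff])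
      have k: "real k \<le> real t * (?y * (?x * (?x * ?x)) + ?x)"
        unfolding k_def of_nat_mult of_nat_add
        by (intro mult_left_mono add_mono mult_mono lle qle mult_nonneg_nonneg pos) auto
      have "real (A + d * (3 * l * k + 2 * l + q + 1)) \<le> poly2 p (log 2 (real n)) (inverse \<epsilon>)"
        unfolding p of_nat_mult of_nat_add of_nat_numeral of_nat_1
        by (intro add_mono mult_mono order.refl lle qle k mult_nonneg_nonneg add_nonneg_nonneg pos) (use pos in auto)
      then have "2 powr real (A + d * (3 * l * k + 2 * l + q + 1)) \<le> 2 powr poly2 p (log 2 (real n)) (inverse \<epsilon>)"
        by (rule powr_mono) simp
      moreover have "real T \<le> real (2 ^ (A + d * (3 * l * k + 2 * l + q + 1)))" using T(2) by (simp only: of_nat_le_iff)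
      moreover have "real (2 ^ (A + d * (3 * l * k + 2 * l + q + 1))) = 2 powr real (A + d * (3 * l * k + 2 * l + q + 1))"
        by (subst powr_realpow) auto
      ultimately show ?thesis by linarith
    qed
    moreover have "real (\<Sum>v\<in>output_set m'. w v) \<ge> (1 - \<epsilon>) * real (\<Sum>v\<in>I. w v)" if I: "independent_set G I" for I
    proof -
      \<comment> \<open>With \<open>Q = t * l * q\<close> and \<open>d = l\<close>, the loss
        \<open>l * t\<close> is a \<open>1 / q\<close> share of \<open>Q\<close>. Cancelling
        \<open>t * l\<close> leaves the ratio \<open>(q - 1) / q\<close>, which is at least
        \<open>1 - \<epsilon>\<close>.\<close>
      have "(t * l * q - l * t) * wt I \<le> (t * l * q) * val {..<n} k"
      proof (rule val_approx[where t = t and L = l])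
        show "l * (t * l * q * l + t) \<le> k" unfolding k_def by (simp add: algebra_simps)
        show "1 \<le> t * l * q" using assms l1 q1 by (simp add: Suc_leI)
      qed (use assms no_hole l1 I in \<open>auto simp: independent_set_iff\<close>)
      also have "t * l * q - l * t = t * l * (q - 1)" by (simp add: diff_mult_distrib2 mult_ac)
      finally have "(t * l) * ((q - 1) * wt I) \<le> (t * l) * (q * val {..<n} k)" by (simp only: mult_ac)
      then have "(q - 1) * wt I \<le> q * val {..<n} k" using assms l1 by (simp only: mult_le_cancel1) simp
      also have "\<dots> \<le> q * wt (output_set m')" using T(5) by (rule mult_le_mono2)
      finally have "real ((q - 1) * wt I) \<le> real (q * wt (output_set m'))" by (simp only: of_nat_le_iff)
      then have "(real q - 1) * real (wt I) \<le> real q * real (wt (output_set m'))" using q1 by (simp add: of_nat_diff)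
      then have "(1 - 1 / real q) * real (wt I) \<le> real (wt (output_set m'))" using q1 by (simp add: field_simps)
      moreover have "1 / real q \<le> \<epsilon>" using qe \<epsilon> q1 by (simp add: field_simps)
      then have "(1 - \<epsilon>) * real (wt I) \<le> (1 - 1 / real q) * real (wt I)" by (intro mult_right_mono) auto
      ultimately show ?thesis by (simp add: wt_def)
    qed
    ultimately show "\<exists>T m. exec (Approx_prog t) ?m T m \<and> real T \<le> 2 powr poly2 p (log 2 (real n)) (inverse \<epsilon>) \<and>
       independent_set G (output_set m) \<and>
       (\<forall>I'. independent_set G I' \<longrightarrow> (1 - \<epsilon>) * real (\<Sum>v\<in>I'. w v) \<le> real (\<Sum>v\<in>output_set m. w v))"
      using T by (intro exI[of _ T] exI[of _ m']) (auto simp: independent_set_iff)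
  qed
next
  case 2
  obtain A d where time: "\<And>N X m Q. N = 2 ^ X \<Longrightarrow> runs N (Exact_prog t) m Q \<Longrightarrow>
    \<exists>T m'. exec (Exact_prog t) m T m' \<and> T \<le> 2 ^ (A + d * (X + 1)) \<and> Q m'"
    using runs_time[of "Exact_prog t"] by metis
  let ?X = "\<lambda>n. A + d * (3 * log_bound n * (8 * t * sqrt_bound n) + 2 * log_bound n + 1)"
  show ?case
  proof (rule exI[of _ "\<lambda>n. real (?X n)"], rule exI[of _ "Exact_prog t"], intro conjI allI impI exact_time_bigo, elim conjE)
    fix n :: nat and G :: "nat pair_pre_digraph" and w :: "nat \<Rightarrow> nat"
    assume G: "pair_graph G" "pverts G = {..<n}" "no_long_induced_cycle t G"
    interpret hole_free_instance t n G w by (rule hole_free_instance.intro[OF assms G])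
    let ?m = "input n G w"
    have fm: "fst ?m = graph_input n G w" by (simp add: input_def)
    from time[OF refl runs_Exact_prog[OF graph_input[OF fm] refl]]
    obtain T m' where T: "exec (Exact_prog t) ?m T m'" "T \<le> 2 ^ ?X n" "output_set m' \<subseteq> {..<n}" "indep (output_set m')"
      "val {..<n} (8 * t * sqrt_bound n) \<le> wt (output_set m')" by blast
    have "real T \<le> real (2 ^ ?X n)" using T(2) by (simp only: of_nat_le_iff)
    also have "\<dots> = 2 powr real (?X n)" by (subst powr_realpow) auto
    finally have "real T \<le> 2 powr real (?X n)" .
    moreover have "(\<Sum>v\<in>I. w v) \<le> (\<Sum>v\<in>output_set m'. w v)" if I: "independent_set G I" for I
    proof -
      have "wt I \<le> val {..<n} (8 * t * sqrt_bound n)"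
      proof (rule val_exact[where t = t])
        show "8 * real t * sqrt (real (card {..<n})) \<le> real (8 * t * sqrt_bound n)"
          using sqrt_le_sqrt_bound[of n] by (simp add: mult_left_mono)
      qed (use assms no_hole I in \<open>auto simp: independent_set_iff\<close>)
      then show ?thesis using T(5) by (simp add: wt_def)
    qed
    ultimately show "\<exists>T m. exec (Exact_prog t) ?m T m \<and> real T \<le> 2 powr real (?X n) \<and>
        independent_set G (output_set m) \<and>
        (\<forall>I'. independent_set G I' \<longrightarrow> (\<Sum>v\<in>I'. w v) \<le> (\<Sum>v\<in>output_set m. w v))"
      using T by (intro exI[of _ T] exI[of _ m']) (auto simp: independent_set_iff)
  qed
qed

end
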